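(* Let $\kappa=\sup_{\xi\in\mathcal{O}}|q(\xi,\xi)|$. If $$2(\lambda_1+\beta_0)-\beta_1^2\kappa>0,$$ then the stochastic heat equation $$\frac{\partial u}{\partial t}(t,x)=\Delta u(t,x)-\beta_0u(t,x)+\beta_1u(t,x)\dot W(t,x),\qquad t\ge 0,\ x\in\mathcal{O},$$ with Dirichlet boundary condition $u(t,x)=0$ for $x\in\partial\mathcal{O}$ and initial value $u(0,\cdot)=u^0\in L^2(\mathcal{O})$ is stable in the mean square sense, namely $$\lim_{t\to\infty}\left(\mathbb{E}\|u(t,\cdot)\|_2^2\right)^{1/2}=0 .$$
   Context: $\mathcal{O}\subset\mathbb{R}^d$ is a bounded domain with smooth boundary, $\|\cdot\|_2$ and $\langle\cdot,\cdot\rangle$ are the norm and inner product of $L^2(\mathcal{O})$, and $\beta_0,\beta_1\in\mathbb{R}$ are constants. $0<\lambda_1\le\lambda_2\le\cdots$ are the eigenvalues of $-\Delta$ on $\mathcal{O}$ with Dirichlet boundary condition and $(e_k)_{k\ge1}$ is a corresponding orthonormal basis of $L^2(\mathcal{O})$ of eigenfunctions, $\Delta e_k=-\lambda_ke_k$. $\dot W$ is a mean zero Gaussian noise on a probability space $(\Omega,\mathcal{F},\mathbb{P})$ with covariance $\mathbb{E}(\dot W(t,x)\dot W(s,y))=\delta(t-s)q(x,y)$, where $\delta$ is the Dirac delta function and $q:\mathcal{O}\times\mathcal{O}\to\mathbb{R}$ is a positive and positive definite function. The product $u\dot W$ is interpreted in the Itô–Skorohod sense. Explicitly, put $\alpha_{ij}=\int_{\mathcal{O}^2}q(x,y)e_i(x)e_j(y)\,dx\,dy$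 and $a_{jki}=\int_{\mathcal{O}}e_je_ke_i\,dx$. Then $B_j(t)=\int_0^t\langle\dot W(s,\cdot),e_j\rangle ds$, $j\ge1$, are jointly Gaussian Brownian motions with $\mathbb{E}[B_i(t)B_j(s)]=\alpha_{ij}\min(t,s)$. Writing $u(t,x)=\sum_k u_k(t)e_k(x)$ with $u_k(t)=\langle u(t,\cdot),e_k\rangle$, the equation is the infinite system of Itô equations $$du_k(t)=-(\lambda_k+\beta_0)u_k(t)\,dt+\beta_1\sum_{i,j=1}^\infty a_{jki}u_i(t)\,dB_j(t),\quad k\ge1,\qquad u_k(0)=\langle u^0,e_k\rangle .$$ $u$ denotes its (adapted, square integrable, $L^2(\mathcal{O})$-valued) solution. *)

theory Defs
  imports "HOL-Probability.Probability"
begin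

section \<open>Bounded domains with smooth boundary, and the Dirichlet Laplacian\<close>

primrec C_n_on :: "nat \<Rightarrow> 'a::euclidean_space set \<Rightarrow> ('a \<Rightarrow> real) \<Rightarrow> bool" where
  "C_n_on 0 U f \<longleftrightarrow> continuous_on U f"
| "C_n_on (Suc n) U f \<longleftrightarrow> (\<forall>x\<in>U. f differentiable (at x)) \<and>
     (\<forall>b\<in>Basis. C_n_on n U (\<lambda>x. frechet_derivative f (at x) b))"

text \<open>Near each boundary point the domain is the sublevel set of a smooth function without
  critical points; in particular it lies locally on one side of its boundary.\<close>

definition smooth_boundary :: "'a::euclidean_space set \<Rightarrow> bool" where
  "smooth_boundary D \<longleftrightarrow> (\<forall>p\<in>frontier D. \<exists>U \<rho>. open U \<and> p \<in> U \<and> (\<forall>n. C_n_on n U \<rho>) \<and>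
     (\<forall>x\<in>U. frechet_derivative \<rho> (at x) \<noteq> (\<lambda>_. 0)) \<and>
     D \<inter> U = {x \<in> U. \<rho> x < 0} \<and> frontier D \<inter> U = {x \<in> U. \<rho> x = 0})"

definition smooth_bounded_domain :: "'a::euclidean_space set \<Rightarrow> bool" where
  "smooth_bounded_domain D \<longleftrightarrow>
     D \<noteq> {} \<and> open D \<and> connected D \<and> bounded D \<and> smooth_boundary D"

definition laplacian :: "('a::euclidean_space \<Rightarrow> real) \<Rightarrow> 'a \<Rightarrow> real" where
  "laplacian f x =
     (\<Sum>b\<in>Basis. frechet_derivative (\<lambda>y. frechet_derivative f (at y) b) (at x) b)"

text \<open>Elements of $L^2(D)$ are represented by square integrable Borel functions on \<open>D\<close>; all
  notions below depend only on the class of such a function modulo null sets.\<close>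

abbreviation dom_measure :: "'a::euclidean_space set \<Rightarrow> 'a measure" where
  "dom_measure D \<equiv> restrict_space lborel D"

definition L2 :: "'a::euclidean_space set \<Rightarrow> ('a \<Rightarrow> real) set" where
  "L2 D = {f. f \<in> borel_measurable (dom_measure D) \<and> integrable (dom_measure D) (\<lambda>x. (f x)\<^sup>2)}"

definition L2_inner :: "'a::euclidean_space set \<Rightarrow> ('a \<Rightarrow> real) \<Rightarrow> ('a \<Rightarrow> real) \<Rightarrow> real" where
  "L2_inner D f g = (LINT x|dom_measure D. f x * g x)"

definition L2_norm :: "'a::euclidean_space set \<Rightarrow> ('a \<Rightarrow> real) \<Rightarrow> real" where
  "L2_norm D f = sqrt (L2_inner D f f)"

definition L2_orthonormal_basis :: "'a::euclidean_space set \<Rightarrow> (nat \<Rightarrow> 'a \<Rightarrow> real) \<Rightarrow> bool" where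
  "L2_orthonormal_basis D e \<longleftrightarrow>
     (\<forall>k. e k \<in> L2 D) \<and>
     (\<forall>i j. L2_inner D (e i) (e j) = (if i = j then 1 else 0)) \<and>
     (\<forall>f\<in>L2 D. (\<lambda>n. L2_norm D (\<lambda>x. f x - (\<Sum>k<n. L2_inner D f (e k) * e k x))) \<longlonglongrightarrow> 0)"

text \<open>Sequences are indexed from 0: \<open>lam 0\<close> is the smallest eigenvalue. Since \<open>e\<close> is an
  orthonormal basis, \<open>lam\<close> lists every eigenvalue, repeated according to its multiplicity.\<close>

definition dirichlet_eigensystem ::
    "'a::euclidean_space set \<Rightarrow> (nat \<Rightarrow> real) \<Rightarrow> (nat \<Rightarrow> 'a \<Rightarrow> real) \<Rightarrow> bool" where
  "dirichlet_eigensystem D lam e \<longleftrightarrow>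
     0 < lam 0 \<and> mono lam \<and> L2_orthonormal_basis D e \<and>
     (\<forall>k. continuous_on (closure D) (e k) \<and> C_n_on 2 D (e k) \<and>
          (\<forall>x\<in>frontier D. e k x = 0) \<and> (\<forall>x\<in>D. laplacian (e k) x = - lam k * e k x))"


section \<open>The noise\<close>

definition pos_def_kernel :: "'a set \<Rightarrow> ('a \<Rightarrow> 'a \<Rightarrow> real) \<Rightarrow> bool" where
  "pos_def_kernel D q \<longleftrightarrow>
     (\<forall>x\<in>D. \<forall>y\<in>D. q x y = q y x) \<and>
     (\<forall>S c. finite S \<and> S \<subseteq> D \<longrightarrow> 0 \<le> (\<Sum>x\<in>S. \<Sum>y\<in>S. c x * c y * q x y))"

text \<open>With \<open>f\<close>, \<open>g\<close> the $i$-th and $j$-th eigenfunction this is the coefficient $\alpha_{ij}$.\<close>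

definition kernel_form ::
    "'a::euclidean_space set \<Rightarrow> ('a \<Rightarrow> 'a \<Rightarrow> real) \<Rightarrow> ('a \<Rightarrow> real) \<Rightarrow> ('a \<Rightarrow> real) \<Rightarrow> real" where
  "kernel_form D q f g =
     (LINT (x, y)|(dom_measure D \<Otimes>\<^sub>M dom_measure D). q x y * f x * g y)"

text \<open>The degenerate (zero variance) case is included.\<close>

definition centered_gaussian :: "'w measure \<Rightarrow> ('w \<Rightarrow> real) \<Rightarrow> bool" where
  "centered_gaussian M X \<longleftrightarrow> X \<in> borel_measurable M \<and>
     ((AE \<omega> in M. X \<omega> = 0) \<or> (\<exists>\<sigma>>0. distributed M lborel X (\<lambda>x. ennreal (normal_density 0 \<sigma> x))))"

text \<open>The noise is a generalized random field. \<open>W t f\<close> is its pairing with the test function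
  $1_{[0,t]}\otimes f$, that is, $\int_0^t \langle \dot W(s,\cdot), f\rangle\,ds$ for $f\in L^2(D)$;
  pairing the covariance $\delta(t-s)q(x,y)$ with two such test functions gives
  $\min(t,s)\int_{D^2} q(x,y) f(x) g(y)\,dx\,dy$. Hence \<open>W t (e j)\<close> is the Brownian motion $B_j(t)$.\<close>

definition white_in_time_noise ::
    "'w measure \<Rightarrow> 'a::euclidean_space set \<Rightarrow> ('a \<Rightarrow> 'a \<Rightarrow> real) \<Rightarrow>
     (real \<Rightarrow> ('a \<Rightarrow> real) \<Rightarrow> 'w \<Rightarrow> real) \<Rightarrow> bool" where
  "white_in_time_noise M D q W \<longleftrightarrow>
     (\<forall>(n::nat) c \<tau> f. (\<forall>i<n. 0 \<le> \<tau> i \<and> f i \<in> L2 D) \<longrightarrow>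
        centered_gaussian M (\<lambda>\<omega>. \<Sum>i<n. c i * W (\<tau> i) (f i) \<omega>)) \<and>
     (\<forall>f\<in>L2 D. \<forall>g\<in>L2 D. \<forall>t\<ge>0. \<forall>s\<ge>0.
        prob_space.expectation M (\<lambda>\<omega>. W t f \<omega> * W s g \<omega>) = min t s * kernel_form D q f g) \<and>
     (\<forall>f\<in>L2 D. AE \<omega> in M. continuous_on {0..} (\<lambda>t. W t f \<omega>))"

text \<open>The noise is adapted to \<open>F\<close> and its increments after time \<open>s\<close> are jointly independent
  of \<open>F s\<close>, so that all $B_j$ are Brownian motions relative to one filtration.\<close>

definition noise_filtration ::
    "'w measure \<Rightarrow> (real \<Rightarrow> 'w measure) \<Rightarrow> 'a::euclidean_space set \<Rightarrow>
     (real \<Rightarrow> ('a \<Rightarrow> real) \<Rightarrow> 'w \<Rightarrow> real) \<Rightarrow> bool" where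
  "noise_filtration M F D W \<longleftrightarrow>
     filtration (space M) F \<and> (\<forall>t. subalgebra M (F t)) \<and>
     (\<forall>t\<ge>0. \<forall>f\<in>L2 D. W t f \<in> borel_measurable (F t)) \<and>
     (\<forall>s\<ge>0. prob_space.indep_set M (sets (F s))
        (sigma_sets (space M)
           {(\<lambda>\<omega>. W t f \<omega> - W s f \<omega>) -` A \<inter> space M | t f A. s \<le> t \<and> f \<in> L2 D \<and> A \<in> sets borel}))"


section \<open>The It\^o integral\<close>

definition progressively_measurable ::
    "(real \<Rightarrow> 'w measure) \<Rightarrow> (real \<Rightarrow> 'w \<Rightarrow> real) \<Rightarrow> bool" where
  "progressively_measurable F X \<longleftrightarrow>
     (\<forall>T\<ge>0. (\<lambda>(s, \<omega>). X s \<omega>) \<in> borel_measurable (restrict_space borel {0..T} \<Otimes>\<^sub>M F T))"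

text \<open>\<open>n\<close>, \<open>\<tau>\<close>, \<open>\<xi>\<close> encode the simple process $\sum_{i<n} \xi_i 1_{(\tau_i,\tau_{i+1}]}$.\<close>

definition simple_process ::
    "'w measure \<Rightarrow> (real \<Rightarrow> 'w measure) \<Rightarrow> nat \<Rightarrow> (nat \<Rightarrow> real) \<Rightarrow> (nat \<Rightarrow> 'w \<Rightarrow> real) \<Rightarrow> bool" where
  "simple_process M F n \<tau> \<xi> \<longleftrightarrow>
     0 \<le> \<tau> 0 \<and> (\<forall>i<n. \<tau> i \<le> \<tau> (Suc i)) \<and>
     (\<forall>i<n. \<xi> i \<in> borel_measurable (F (\<tau> i)) \<and> bounded (\<xi> i ` space M))"

definition simple_value :: "nat \<Rightarrow> (nat \<Rightarrow> real) \<Rightarrow> (nat \<Rightarrow> 'w \<Rightarrow> real) \<Rightarrow> real \<Rightarrow> 'w \<Rightarrow> real" where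
  "simple_value n \<tau> \<xi> s \<omega> = (\<Sum>i<n. \<xi> i \<omega> * indicator {\<tau> i<..\<tau> (Suc i)} s)"

definition simple_integral ::
    "(real \<Rightarrow> 'w \<Rightarrow> real) \<Rightarrow> nat \<Rightarrow> (nat \<Rightarrow> real) \<Rightarrow> (nat \<Rightarrow> 'w \<Rightarrow> real) \<Rightarrow> real \<Rightarrow> 'w \<Rightarrow> real" where
  "simple_integral B n \<tau> \<xi> t \<omega> =
     (\<Sum>i<n. \<xi> i \<omega> * (B (min t (\<tau> (Suc i))) \<omega> - B (min t (\<tau> i)) \<omega>))"

definition mean_square_limit :: "'w measure \<Rightarrow> (nat \<Rightarrow> 'w \<Rightarrow> real) \<Rightarrow> ('w \<Rightarrow> real) \<Rightarrow> bool" where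
  "mean_square_limit M X Y \<longleftrightarrow>
     (\<forall>n. X n \<in> borel_measurable M) \<and> Y \<in> borel_measurable M \<and>
     (\<lambda>n. \<integral>\<^sup>+\<omega>. ennreal ((X n \<omega> - Y \<omega>)\<^sup>2) \<partial>M) \<longlonglongrightarrow> 0"

text \<open>\<open>Y\<close> is a version of $\int_0^t X(s)\,dB(s)$: the mean square limit of the integrals of simple
  processes that converge to \<open>X\<close> in $L^2([0,t]\times\Omega)$. (Progressive measurability of \<open>X\<close>
  makes the integrand in the approximation condition jointly measurable.)\<close>

definition is_ito_integral ::
    "'w measure \<Rightarrow> (real \<Rightarrow> 'w measure) \<Rightarrow> (real \<Rightarrow> 'w \<Rightarrow> real) \<Rightarrow> (real \<Rightarrow> 'w \<Rightarrow> real) \<Rightarrow>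
     real \<Rightarrow> ('w \<Rightarrow> real) \<Rightarrow> bool" where
  "is_ito_integral M F B X t Y \<longleftrightarrow>
     progressively_measurable F X \<and>
     (\<exists>n \<tau> \<xi>. (\<forall>m::nat. simple_process M F (n m) (\<tau> m) (\<xi> m)) \<and>
        (\<lambda>m. \<integral>\<^sup>+\<omega>. (\<integral>\<^sup>+s\<in>{0..t}. ennreal ((simple_value (n m) (\<tau> m) (\<xi> m) s \<omega> - X s \<omega>)\<^sup>2)
               \<partial>lborel) \<partial>M) \<longlonglongrightarrow> 0 \<and>
        mean_square_limit M (\<lambda>m. simple_integral B (n m) (\<tau> m) (\<xi> m) t) Y)"


section \<open>The stochastic heat equation\<close>

definition triple_coeff ::
    "'a::euclidean_space set \<Rightarrow> (nat \<Rightarrow> 'a \<Rightarrow> real) \<Rightarrow> nat \<Rightarrow> nat \<Rightarrow> nat \<Rightarrow> real" where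
  "triple_coeff D e j k i = (LINT x|dom_measure D. e j x * e k x * e i x)"

text \<open>Adaptedness and joint measurability are imposed weakly, which in the separable space
  $L^2(D)$ is the same as strongly.\<close>

definition L2_process ::
    "'w measure \<Rightarrow> (real \<Rightarrow> 'w measure) \<Rightarrow> 'a::euclidean_space set \<Rightarrow>
     (real \<Rightarrow> 'w \<Rightarrow> 'a \<Rightarrow> real) \<Rightarrow> bool" where
  "L2_process M F D u \<longleftrightarrow>
     (\<forall>t\<ge>0. \<forall>\<omega>\<in>space M. u t \<omega> \<in> L2 D) \<and>
     (\<forall>f\<in>L2 D. progressively_measurable F (\<lambda>t \<omega>. L2_inner D (u t \<omega>) f)) \<and>
     (\<forall>t\<ge>0. integrable M (\<lambda>\<omega>. (L2_norm D (u t \<omega>))\<^sup>2)) \<and>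
     (\<forall>T\<ge>0. (\<integral>\<^sup>+s\<in>{0..T}. (\<integral>\<^sup>+\<omega>. ennreal ((L2_norm D (u s \<omega>))\<^sup>2) \<partial>M) \<partial>lborel) < \<infinity>)"

text \<open>The It\^o--Skorohod solution, in coordinates. \<open>J i j t\<close> is $\int_0^t u_i\,dB_j$ and \<open>S k t\<close>
  is the stochastic term $\sum_{i,j} a_{jki}\int_0^t u_i\,dB_j$, where the double series is the mean
  square limit of its square partial sums.\<close>

definition stochastic_heat_solution ::
    "'w measure \<Rightarrow> (real \<Rightarrow> 'w measure) \<Rightarrow> 'a::euclidean_space set \<Rightarrow>
     (real \<Rightarrow> ('a \<Rightarrow> real) \<Rightarrow> 'w \<Rightarrow> real) \<Rightarrow> (nat \<Rightarrow> real) \<Rightarrow> (nat \<Rightarrow> 'a \<Rightarrow> real) \<Rightarrow>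
     real \<Rightarrow> real \<Rightarrow> ('a \<Rightarrow> real) \<Rightarrow> (real \<Rightarrow> 'w \<Rightarrow> 'a \<Rightarrow> real) \<Rightarrow> bool" where
  "stochastic_heat_solution M F D W lam e \<beta>0 \<beta>1 u0 u \<longleftrightarrow>
     L2_process M F D u \<and>
     (\<exists>J S.
        (\<forall>i j. \<forall>t\<ge>0. is_ito_integral M F (\<lambda>s. W s (e j)) (\<lambda>s \<omega>. L2_inner D (u s \<omega>) (e i)) t (J i j t)) \<and>
        (\<forall>k. \<forall>t\<ge>0. mean_square_limit M
           (\<lambda>N \<omega>. \<Sum>i<N. \<Sum>j<N. triple_coeff D e j k i * J i j t \<omega>) (S k t)) \<and>
        (\<forall>k. \<forall>t\<ge>0. AE \<omega> in M.
           L2_inner D (u t \<omega>) (e k) = L2_inner D u0 (e k)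
             - (lam k + \<beta>0) * (LINT s:{0..t}|lborel. L2_inner D (u s \<omega>) (e k))
             + \<beta>1 * S k t \<omega>))"

end

theory Submission
  imports Defs
begin

text \<open>
  Let $w(t) = \mathbb{E}\|u(t)\|_2^2$ and let $Q(f,g) = \int_{D^2} q(x,y) f(x) g(y)\,dx\,dy$.

  Each mode solves $u_k(t) = N_k(t) - (\lambda_k+\beta_0)\int_0^t u_k$, where $N_k$ has orthogonal
  increments. Without It\^o's formula, this gives
  $\mathbb{E}u_k(t)^2 = \mathbb{E}N_k(t)^2 - 2(\lambda_k+\beta_0)\int_0^t\mathbb{E}u_k^2$, and by the It\^o isometry
  $\mathbb{E}N_k(t)^2 - \mathbb{E}N_k(s)^2 = \beta_1^2\int_s^t \mathbb{E}\,Q(e_ku, e_ku)$.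

  The sum over \<open>k\<close> is controlled by the trace inequality
  $\sum_k Q(e_kf, e_kf) \le \kappa\|f\|_2^2$. Since the kernel is merely measurable, Mercer's
  theorem is not available; compressing \<open>Q\<close> to step functions on a finite partition of \<open>D\<close> reduces
  the inequality to $|q| \le \kappa$ and the positivity of \<open>Q\<close>.

  Hence $w(t) - w(s) \le -\delta\int_s^t w$ with $\delta = 2(\lambda_1+\beta_0) - \beta_1^2\kappa > 0$, so
  that \<open>w\<close> decreases and $t\,w(t) \le \int_0^t w \le w(0)/\delta$.
\<close>

section \<open>Square integrable functions\<close>

text \<open>Formally the sum over k of e_k(x) e_k(y) is a delta function, so the left side of the
  trace inequality would be the integral of q(x,x) f(x)^2. But the diagonal is a null set, and a
  measurable kernel has no trace there. What remains usable is the bound of |q| by \<kappa> on all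
  of D x D, obtained from positivity on two points together with q >= 0; it makes Q continuous for
  L1 convergence. Positivity of Q is taken from the noise, since Q(f,g) is the covariance of
  \<open>W 1 f\<close> and \<open>W 1 g\<close>.

  The mode equations hold only almost surely at each fixed time, so no path is ever differentiated.
  Instead, covariances are treated as deterministic functions of time: uniqueness for a linear
  Volterra equation shows that past values of u_k are orthogonal to later increments of N_k, and
  splitting a square into two triangles replaces the chain rule.

  The constant \<delta> mixes two kinds of estimate: each decay rate 2(lambda_k + \<beta>0) is
  compared with that of the lowest mode, whereas the noise input is controlled only after summation
  over k.\<close>

definition square_integrable :: "'a measure \<Rightarrow> ('a \<Rightarrow> real) \<Rightarrow> bool" where
  "square_integrable M f \<longleftrightarrow> f \<in> borel_measurable M \<and> integrable M (\<lambda>x. (f x)\<^sup>2)"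

lemma L2_iff: "f \<in> L2 D \<longleftrightarrow> square_integrable (dom_measure D) f"
  by (simp add: L2_def square_integrable_def)

lemma square_integrable_measurable [measurable_dest]:
  "square_integrable M f \<Longrightarrow> f \<in> borel_measurable M"
  by (simp add: square_integrable_def)

lemma square_integrable_zero [simp]: "square_integrable M (\<lambda>_. 0)"
  by (simp add: square_integrable_def)

lemma abs_mult_le_squares: "\<bar>a * b\<bar> \<le> a\<^sup>2 + b\<^sup>2" for a b :: real
proof -
  have "2 * (\<bar>a\<bar> * \<bar>b\<bar>) \<le> a\<^sup>2 + b\<^sup>2"
    using sum_squares_bound[of "\<bar>a\<bar>" "\<bar>b\<bar>"] by (simp add: mult.assoc)
  moreover have "0 \<le> \<bar>a\<bar> * \<bar>b\<bar>" by simp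
  ultimately show ?thesis
    unfolding abs_mult by linarith
qed

lemma square_integrable_mult:
  assumes "square_integrable M f" "square_integrable M g"
  shows "integrable M (\<lambda>x. f x * g x)"
proof (rule Bochner_Integration.integrable_bound)
  show "integrable M (\<lambda>x. (f x)\<^sup>2 + (g x)\<^sup>2)"
    using assms by (auto simp: square_integrable_def)
  show "(\<lambda>x. f x * g x) \<in> borel_measurable M"
    using assms by (auto simp: square_integrable_def)
  show "AE x in M. norm (f x * g x) \<le> norm ((f x)\<^sup>2 + (g x)\<^sup>2)"
    using abs_mult_le_squares by auto
qed

lemma square_integrable_add:
  assumes "square_integrable M f" "square_integrable M g"
  shows "square_integrable M (\<lambda>x. f x + g x)"
  using square_integrable_mult[OF assms] assms
  by (auto simp: square_integrable_def power2_sum mult.assoc)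

lemma square_integrable_cmult:
  "square_integrable M f \<Longrightarrow> square_integrable M (\<lambda>x. c * f x)"
  by (auto simp: square_integrable_def power_mult_distrib)

lemma square_integrable_diff:
  assumes "square_integrable M f" "square_integrable M g"
  shows "square_integrable M (\<lambda>x. f x - g x)"
  using square_integrable_add[OF assms(1) square_integrable_cmult[OF assms(2), of "-1"]] by simp

lemma square_integrable_sum:
  "(\<And>i. i \<in> I \<Longrightarrow> square_integrable M (f i)) \<Longrightarrow> square_integrable M (\<lambda>x. \<Sum>i\<in>I. f i x)"
  by (induction I rule: infinite_finite_induct) (auto intro: square_integrable_add)

lemma square_integrable_bound:
  assumes "square_integrable M g" "f \<in> borel_measurable M" "AE x in M. \<bar>f x\<bar> \<le> \<bar>g x\<bar>"
  shows "square_integrable M f"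
  unfolding square_integrable_def
proof (intro conjI)
  show "integrable M (\<lambda>x. (f x)\<^sup>2)"
    by (rule Bochner_Integration.integrable_bound[of _ "\<lambda>x. (g x)\<^sup>2"])
       (use assms in \<open>auto simp: square_integrable_def abs_le_square_iff\<close>)
qed fact

lemma square_integrable_bounded_mult:
  assumes "square_integrable M g" "h \<in> borel_measurable M" "\<And>x. x \<in> space M \<Longrightarrow> \<bar>h x\<bar> \<le> B"
  shows "square_integrable M (\<lambda>x. h x * g x)"
proof (rule square_integrable_bound[OF square_integrable_cmult[OF assms(1), of "\<bar>B\<bar>"]])
  show "(\<lambda>x. h x * g x) \<in> borel_measurable M"
    using assms by (auto simp: square_integrable_def)
  show "AE x in M. \<bar>h x * g x\<bar> \<le> \<bar>\<bar>B\<bar> * g x\<bar>"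
    using assms(3) by (intro AE_I2) (auto simp: abs_mult intro!: mult_right_mono abs_ge_self
        order_trans[OF assms(3)])
qed

lemma square_integrable_const:
  "finite_measure M \<Longrightarrow> square_integrable M (\<lambda>_. c)"
  by (simp add: square_integrable_def finite_measure.integrable_const)

lemma square_integrable_integrable:
  "finite_measure M \<Longrightarrow> square_integrable M f \<Longrightarrow> integrable M f"
  by (simp add: square_integrable_def finite_measure.square_integrable_imp_integrable)

section \<open>Cauchy-Schwarz inequality and mean square limits\<close>

lemma integral_Cauchy_Schwarz:
  assumes f: "square_integrable M f" and g: "square_integrable M g"
  shows "\<bar>\<integral>x. f x * g x \<partial>M\<bar> \<le> sqrt (\<integral>x. (f x)\<^sup>2 \<partial>M) * sqrt (\<integral>x. (g x)\<^sup>2 \<partial>M)"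
proof -
  have [measurable]: "f \<in> borel_measurable M" "g \<in> borel_measurable M"
    using f g by (auto simp: square_integrable_def)
  have i: "integrable M (\<lambda>x. \<bar>f x * g x\<bar>)"
    using square_integrable_mult[OF f g] by simp
  have "(\<integral>\<^sup>+x. ennreal \<bar>f x\<bar> * ennreal \<bar>g x\<bar> \<partial>M)\<^sup>2 \<le>
        (\<integral>\<^sup>+x. ennreal \<bar>f x\<bar> ^ 2 \<partial>M) * (\<integral>\<^sup>+x. ennreal \<bar>g x\<bar> ^ 2 \<partial>M)"
    by (rule Cauchy_Schwarz_nn_integral) auto
  also have "(\<integral>\<^sup>+x. ennreal \<bar>f x\<bar> * ennreal \<bar>g x\<bar> \<partial>M) = ennreal (\<integral>x. \<bar>f x * g x\<bar> \<partial>M)"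
    using i by (subst nn_integral_eq_integral[symmetric]) (auto simp: abs_mult ennreal_mult)
  also have "(\<integral>\<^sup>+x. ennreal \<bar>f x\<bar> ^ 2 \<partial>M) = ennreal (\<integral>x. (f x)\<^sup>2 \<partial>M)"
    using f by (subst nn_integral_eq_integral[symmetric]) (auto simp: square_integrable_def
        ennreal_power)
  also have "(\<integral>\<^sup>+x. ennreal \<bar>g x\<bar> ^ 2 \<partial>M) = ennreal (\<integral>x. (g x)\<^sup>2 \<partial>M)"
    using g by (subst nn_integral_eq_integral[symmetric]) (auto simp: square_integrable_def
        ennreal_power)
  finally have "(\<integral>x. \<bar>f x * g x\<bar> \<partial>M)\<^sup>2 \<le> (\<integral>x. (f x)\<^sup>2 \<partial>M) * (\<integral>x. (g x)\<^sup>2 \<partial>M)"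
    by (simp add: ennreal_power flip: ennreal_mult)
  then have "(\<integral>x. \<bar>f x * g x\<bar> \<partial>M) \<le> sqrt ((\<integral>x. (f x)\<^sup>2 \<partial>M) * (\<integral>x. (g x)\<^sup>2 \<partial>M))"
    by (rule real_le_rsqrt)
  moreover have "\<bar>\<integral>x. f x * g x \<partial>M\<bar> \<le> (\<integral>x. \<bar>f x * g x\<bar> \<partial>M)"
    by (rule integral_abs_bound)
  ultimately show ?thesis
    unfolding real_sqrt_mult by linarith
qed

lemma integral_Cauchy_Schwarz_const:
  assumes "finite_measure M" "square_integrable M f"
  shows "(\<integral>x. \<bar>f x\<bar> \<partial>M)\<^sup>2 \<le> measure M (space M) * (\<integral>x. (f x)\<^sup>2 \<partial>M)"
proof -
  have "square_integrable M (\<lambda>x. \<bar>f x\<bar>)"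
    using assms by (auto simp: square_integrable_def)
  from integral_Cauchy_Schwarz[OF this square_integrable_const[OF assms(1), of 1]]
  have "\<bar>\<integral>x. \<bar>f x\<bar> \<partial>M\<bar> \<le> sqrt (measure M (space M) * (\<integral>x. (f x)\<^sup>2 \<partial>M))"
    by (simp add: real_sqrt_mult mult.commute)
  then show ?thesis
    using sqrt_ge_absD by blast
qed

text \<open>Mean square limits are given by extended nonnegative integrals and a merely measurable
  limit. One \<open>f n\<close> at finite distance from \<open>f'\<close> suffices:
  \<open>f'\<close> is then \<open>f n\<close> minus a square integrable difference, and the
  convergence can be restated with real integrals.\<close>

lemma square_integrable_L2_limit:
  assumes f: "\<And>n. square_integrable M (f n)" and [measurable]: "f' \<in> borel_measurable M"
    and lim: "(\<lambda>n::nat. \<integral>\<^sup>+x. ennreal ((f n x - f' x)\<^sup>2) \<partial>M) \<longlonglongrightarrow> 0"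
  shows "square_integrable M f'" "(\<lambda>n. \<integral>x. (f n x - f' x)\<^sup>2 \<partial>M) \<longlonglongrightarrow> 0"
proof -
  have [measurable]: "\<And>n. f n \<in> borel_measurable M"
    using f by (auto simp: square_integrable_def)
  have "eventually (\<lambda>n. (\<integral>\<^sup>+x. ennreal ((f n x - f' x)\<^sup>2) \<partial>M) < 1) sequentially"
    using lim by (rule order_tendstoD) simp
  then obtain n where "(\<integral>\<^sup>+x. ennreal ((f n x - f' x)\<^sup>2) \<partial>M) < 1"
    by (auto simp: eventually_sequentially)
  then have "(\<integral>\<^sup>+x. ennreal ((f n x - f' x)\<^sup>2) \<partial>M) < \<infinity>"
    using ennreal_one_less_top by (metis infinity_ennreal_def order_less_trans)
  then have "integrable M (\<lambda>x. (f n x - f' x)\<^sup>2)"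
    by (subst integrable_iff_bounded) auto
  then have "square_integrable M (\<lambda>x. f n x - f' x)"
    by (simp add: square_integrable_def)
  from square_integrable_diff[OF f[of n] this] show f': "square_integrable M f'" by simp
  have "integrable M (\<lambda>x. (f n x - f' x)\<^sup>2)" for n
    using square_integrable_diff[OF f[of n] f'] by (simp add: square_integrable_def)
  then have "(\<integral>\<^sup>+x. ennreal ((f n x - f' x)\<^sup>2) \<partial>M) = ennreal (\<integral>x. (f n x - f' x)\<^sup>2 \<partial>M)" for n
    by (intro nn_integral_eq_integral) auto
  with lim have "(\<lambda>n. ennreal (\<integral>x. (f n x - f' x)\<^sup>2 \<partial>M)) \<longlonglongrightarrow> ennreal 0"
    by simp
  then show "(\<lambda>n. \<integral>x. (f n x - f' x)\<^sup>2 \<partial>M) \<longlonglongrightarrow> 0"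
    by (subst (asm) tendsto_ennreal_iff) auto
qed

text \<open>Writing f_n = f' + (f_n - f') and g_n = g' + (g_n - g') leaves three error terms, each
  bounded by Cauchy-Schwarz. This continuity of the inner product carries means, covariances and the
  isometry from approximations to their limits.\<close>

lemma tendsto_integral_mult_L2:
  assumes f: "\<And>n. square_integrable M (f n)" "square_integrable M f'"
    and g: "\<And>n. square_integrable M (g n)" "square_integrable M g'"
    and limf: "(\<lambda>n::nat. \<integral>x. (f n x - f' x)\<^sup>2 \<partial>M) \<longlonglongrightarrow> 0"
    and limg: "(\<lambda>n. \<integral>x. (g n x - g' x)\<^sup>2 \<partial>M) \<longlonglongrightarrow> 0"
  shows "(\<lambda>n. \<integral>x. f n x * g n x \<partial>M) \<longlonglongrightarrow> (\<integral>x. f' x * g' x \<partial>M)"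
proof -
  define a where "a n = sqrt (\<integral>x. (f n x - f' x)\<^sup>2 \<partial>M)" for n
  define b where "b n = sqrt (\<integral>x. (g n x - g' x)\<^sup>2 \<partial>M)" for n
  define A where "A = sqrt (\<integral>x. (f' x)\<^sup>2 \<partial>M)"
  define B where "B = sqrt (\<integral>x. (g' x)\<^sup>2 \<partial>M)"
  have ab: "a \<longlonglongrightarrow> 0" "b \<longlonglongrightarrow> 0"
    unfolding a_def b_def using tendsto_real_sqrt[OF limf] tendsto_real_sqrt[OF limg] by auto
  have le: "\<bar>(\<integral>x. f n x * g n x \<partial>M) - (\<integral>x. f' x * g' x \<partial>M)\<bar> \<le> a n * b n + a n * B + A * b n" for n
  proof -
    have df: "square_integrable M (\<lambda>x. f n x - f' x)" and dg: "square_integrable M (\<lambda>x. g n x -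
        g' x)"
      using f g by (auto intro: square_integrable_diff)
    have "(\<integral>x. f n x * g n x \<partial>M) - (\<integral>x. f' x * g' x \<partial>M) =
        (\<integral>x. f n x * g n x - f' x * g' x \<partial>M)"
      using f g by (simp add: square_integrable_mult Bochner_Integration.integral_diff)
    also have "\<dots> = (\<integral>x. ((f n x - f' x) * (g n x - g' x) + (f n x - f' x) * g' x) + f' x * (g n
        x - g' x) \<partial>M)"
      by (rule Bochner_Integration.integral_cong) (auto simp: algebra_simps)
    also have "\<dots> = (\<integral>x. (f n x - f' x) * (g n x - g' x) \<partial>M) + (\<integral>x. (f n x - f' x) * g' x \<partial>M)
        + (\<integral>x. f' x * (g n x - g' x) \<partial>M)"
      using square_integrable_mult[OF df dg] square_integrable_mult[OF df g(2)]
          square_integrable_mult[OF f(2) dg]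
      by simp
    finally have eq: "(\<integral>x. f n x * g n x \<partial>M) - (\<integral>x. f' x * g' x \<partial>M) =
        (\<integral>x. (f n x - f' x) * (g n x - g' x) \<partial>M) + (\<integral>x. (f n x - f' x) * g' x \<partial>M)
        + (\<integral>x. f' x * (g n x - g' x) \<partial>M)" .
    show ?thesis
      unfolding eq a_def b_def A_def B_def
      by (intro order_trans[OF abs_triangle_ineq] order_trans[OF abs_triangle_ineq add_right_mono]
          add_mono integral_Cauchy_Schwarz df dg f g)
  qed
  have "(\<lambda>n. a n * b n) \<longlonglongrightarrow> 0" "(\<lambda>n. a n * B) \<longlonglongrightarrow> 0" "(\<lambda>n. A * b n) \<longlonglongrightarrow> 0"
    using ab by (auto intro: tendsto_mult_zero tendsto_mult_left_zero tendsto_mult_right_zero)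
  then have "(\<lambda>n. a n * b n + a n * B + A * b n) \<longlonglongrightarrow> 0"
    by (intro tendsto_add_zero)
  then have "(\<lambda>n. (\<integral>x. f n x * g n x \<partial>M) - (\<integral>x. f' x * g' x \<partial>M)) \<longlonglongrightarrow> 0"
    by (rule Lim_null_comparison[rotated]) (unfold real_norm_def, intro always_eventually allI le)
  then show ?thesis
    by (simp add: LIM_zero_iff)
qed

lemma tendsto_integral_mult_L2_nn:
  assumes f: "\<And>n. square_integrable M (f n)" "f' \<in> borel_measurable M"
    and g: "\<And>n. square_integrable M (g n)" "g' \<in> borel_measurable M"
    and limf: "(\<lambda>n::nat. \<integral>\<^sup>+x. ennreal ((f n x - f' x)\<^sup>2) \<partial>M) \<longlonglongrightarrow> 0"
    and limg: "(\<lambda>n. \<integral>\<^sup>+x. ennreal ((g n x - g' x)\<^sup>2) \<partial>M) \<longlonglongrightarrow> 0"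
  shows "(\<lambda>n. \<integral>x. f n x * g n x \<partial>M) \<longlonglongrightarrow> (\<integral>x. f' x * g' x \<partial>M)"
  by (rule tendsto_integral_mult_L2[OF f(1) square_integrable_L2_limit(1)[OF f limf] g(1)
        square_integrable_L2_limit(1)[OF g limg] square_integrable_L2_limit(2)[OF f limf]
        square_integrable_L2_limit(2)[OF g limg]])

section \<open>Second moments of linear Volterra processes\<close>

text \<open>Regularity is bootstrapped from integrability: the primitive \<open>I\<close> is
  continuous, so by the equation f is continuous, so \<open>I\<close> is differentiable with I' =
  -\<mu> I. Hence exp(\<mu> s) I(s) is constant, and it vanishes at 0.\<close>

lemma volterra_homogeneous:
  fixes f :: "real \<Rightarrow> real"
  assumes int: "set_integrable lborel {0..T} f"
    and eq: "\<And>s. 0 \<le> s \<Longrightarrow> s \<le> T \<Longrightarrow> f s = - \<mu> * (LINT r:{0..s}|lborel. f r)"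
    and s: "0 \<le> s" "s \<le> T"
  shows "f s = 0"
proof -
  define I where "I = (\<lambda>s. integral {0..s} f)"
  have sub: "set_integrable lborel {0..s} f" if "s \<le> T" for s
    using int by (rule set_integrable_subset) (use that in auto)
  have fI: "f s = - \<mu> * I s" if "0 \<le> s" "s \<le> T" for s
    using eq[OF that] set_borel_integral_eq_integral(2)[OF sub[OF that(2)]] by (simp add: I_def)
  have "continuous_on {0..T} I"
    unfolding I_def using set_borel_integral_eq_integral(1)[OF int] by (rule
        indefinite_integral_continuous_1)
  then have "continuous_on {0..T} (\<lambda>s. - \<mu> * I s)"
    by (intro continuous_intros)
  then have cont: "continuous_on {0..T} f"
    by (rule continuous_on_cong[THEN iffD1, rotated -1]) (auto simp: fI)
  have "((\<lambda>s. exp (\<mu> * s) * I s) has_real_derivative 0) (at s within {0..T})" if "s \<in> {0..T}" for s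
  proof -
    have "(I has_real_derivative f s) (at s within {0..T})"
      unfolding I_def using cont that by (rule integral_has_real_derivative)
    then have "((\<lambda>s. exp (\<mu> * s) * I s) has_real_derivative
        exp (\<mu> * s) * f s + exp (\<mu> * s) * \<mu> * I s) (at s within {0..T})"
      by (auto intro!: derivative_eq_intros)
    then show ?thesis
      using that by (simp add: fI)
  qed
  from has_field_derivative_zero_constant[OF convex_closed_interval this]
  obtain c where c: "\<And>s. s \<in> {0..T} \<Longrightarrow> exp (\<mu> * s) * I s = c"
    by blast
  have "I 0 = 0"
    by (simp add: I_def)
  then have "c = 0"
    using c[of 0] s by simp
  then have "I s = 0"
    using c[of s] s by simp
  then show ?thesis
    using fI s by simp
qed

lemma (in pair_sigma_finite) integrable_pair_mult:
  fixes f :: "'a \<Rightarrow> real" and g :: "'b \<Rightarrow> real"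
  assumes "integrable M1 f" "integrable M2 g"
  shows "integrable (M1 \<Otimes>\<^sub>M M2) (\<lambda>(x, y). f x * g y)"
proof (rule Fubini_integrable)
  show "(\<lambda>(x, y). f x * g y) \<in> borel_measurable (M1 \<Otimes>\<^sub>M M2)"
    using assms[THEN borel_measurable_integrable] by measurable
  show "integrable M1 (\<lambda>x. LINT y|M2. norm (case (x, y) of (x, y) \<Rightarrow> f x * g y))"
    using assms by (simp add: abs_mult)
  show "AE x in M1. integrable M2 (\<lambda>y. case (x, y) of (x, y) \<Rightarrow> f x * g y)"
    using assms by simp
qed

lemma integrable_interval [simp]: "integrable lborel (indicator {a..b::real} :: real \<Rightarrow> real)"
  by (simp add: integrable_indicator_iff emeasure_lborel_Icc_eq)

text \<open>The diagonal is a null set, so a symmetric kernel has equal integrals over the two triangles.\<close>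

lemma symmetric_integral_triangle:
  fixes C :: "real \<Rightarrow> real \<Rightarrow> real"
  assumes int: "integrable (lborel \<Otimes>\<^sub>M lborel) (\<lambda>(s, r). indicator {0..t} s * indicator {0..t} r
      * C s r)"
    and sym: "\<And>s r. C s r = C r s"
  shows "(LINT s:{0..t}|lborel. LINT r:{0..t}|lborel. C s r) =
    2 * (LINT s:{0..t}|lborel. LINT r:{0..s}|lborel. C s r)"
proof -
  define G where "G = (\<lambda>s r. indicator {0..t} s * indicator {0..t} r * C s r)"
  define G1 where "G1 = (\<lambda>s r. (if r \<le> s then G s r else 0))"
  define G2 where "G2 = (\<lambda>s r. (if s < r then G s r else 0))"
  have intG: "integrable (lborel \<Otimes>\<^sub>M lborel) (case_prod G)"
    using int by (simp add: G_def case_prod_unfold)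
  have [measurable]: "case_prod G \<in> borel_measurable (lborel \<Otimes>\<^sub>M lborel)"
    using intG by (rule borel_measurable_integrable)
  have [measurable]: "(\<lambda>x. G (fst x) (snd x)) \<in> borel_measurable (lborel \<Otimes>\<^sub>M lborel)"
    using intG[THEN borel_measurable_integrable] by (simp add: case_prod_unfold)
  have int1: "integrable (lborel \<Otimes>\<^sub>M lborel) (case_prod G1)"
    by (rule Bochner_Integration.integrable_bound[OF intG]) (auto simp: G1_def case_prod_unfold)
  have int2: "integrable (lborel \<Otimes>\<^sub>M lborel) (case_prod G2)"
    by (rule Bochner_Integration.integrable_bound[OF intG]) (auto simp: G2_def case_prod_unfold)
  have "(LINT s:{0..t}|lborel. LINT r:{0..t}|lborel. C s r) = (LINT s|lborel. LINT r|lborel. G s r)"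
    by (simp add: set_lebesgue_integral_def G_def mult.assoc)
  also have "\<dots> = (LINT (s, r)|(lborel \<Otimes>\<^sub>M lborel). G s r)"
    using lborel_pair.integral_fst[OF intG] by simp
  also have "\<dots> = (LINT z|(lborel \<Otimes>\<^sub>M lborel). (case_prod G1 z + case_prod G2 z))"
    by (rule Bochner_Integration.integral_cong) (auto simp: G1_def G2_def)
  also have "\<dots> = (LINT (s, r)|(lborel \<Otimes>\<^sub>M lborel). G1 s r) + (LINT (s, r)|(lborel \<Otimes>\<^sub>M lborel).
      G2 s r)"
    using int1 int2 by simp
  also have "(LINT (s, r)|(lborel \<Otimes>\<^sub>M lborel). G2 s r) = (LINT r|lborel. LINT s|lborel. G2 s r)"
    using lborel_pair.integral_snd[OF int2] by simp
  also have "\<dots> = (LINT r|lborel. LINT s|lborel. G1 r s)"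
  proof (rule Bochner_Integration.integral_cong[OF refl])
    fix r :: real
    have [measurable]: "(\<lambda>s. G s r) \<in> borel_measurable lborel" "(\<lambda>s. G r s) \<in> borel_measurable
        lborel"
      using measurable_compose[OF measurable_Pair2' intG[THEN borel_measurable_integrable], of r]
        measurable_compose[OF measurable_Pair1' intG[THEN borel_measurable_integrable], of r] by
            simp_all
    show "(LINT s|lborel. G2 s r) = (LINT s|lborel. G1 r s)"
    proof (rule integral_cong_AE)
      show "AE s in lborel. G2 s r = G1 r s"
        using AE_lborel_singleton[of r] by eventually_elim (auto simp: G1_def G2_def G_def
            sym[of r])
      show "(\<lambda>s. G2 s r) \<in> borel_measurable lborel" "G1 r \<in> borel_measurable lborel"
        unfolding G1_def G2_def by measurable
    qed
  qed
  also have "(LINT r|lborel. LINT s|lborel. G1 r s) = (LINT (s, r)|(lborel \<Otimes>\<^sub>M lborel). G1 s r)"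
    using lborel_pair.integral_fst[OF int1] by simp
  also have "(LINT (s, r)|(lborel \<Otimes>\<^sub>M lborel). G1 s r) + (LINT (s, r)|(lborel \<Otimes>\<^sub>M lborel). G1 s r)
     = 2 * (LINT s|lborel. LINT r|lborel. G1 s r)"
    using lborel_pair.integral_fst[OF int1] by simp
  also have "(LINT s|lborel. LINT r|lborel. G1 s r) = (LINT s:{0..t}|lborel. LINT
      r:{0..s}|lborel. C s r)"
    unfolding set_lebesgue_integral_def
  proof (rule Bochner_Integration.integral_cong[OF refl])
    fix s :: real
    show "(LINT r|lborel. G1 s r) = indicator {0..t} s *\<^sub>R (LINT r|lborel. indicator {0..s} r
        *\<^sub>R C s r)"
    proof (cases "s \<in> {0..t}")
      case True
      then have "G1 s = (\<lambda>r. indicator {0..s} r *\<^sub>R C s r)"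
        by (auto simp: G1_def G_def indicator_def fun_eq_iff)
      with True show ?thesis by simp
    next
      case False
      then have "G1 s = (\<lambda>r. 0)"
        by (auto simp: G1_def G_def indicator_def fun_eq_iff)
      with False show ?thesis by simp
    qed
  qed
  finally show ?thesis .
qed

text \<open>An abstract mode: \<open>N\<close> is the initial value plus the stochastic term and
  \<Gamma> its second moment. \<open>N_cov\<close> expresses orthogonal increments, the covariance
  being a function of the earlier time only. The equation is required at each fixed time separately,
  with a null set that may depend on t.\<close>

locale linear_volterra_process = prob_space M for M :: "'w measure" +
  fixes X N :: "real \<Rightarrow> 'w \<Rightarrow> real" and \<Gamma> :: "real \<Rightarrow> real" and \<mu> :: real
  assumes X_measurable [measurable]: "(\<lambda>(s, \<omega>). X s \<omega>) \<in> borel_measurable (lborel \<Otimes>\<^sub>M M)"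
    and X_integrable: "integrable (lborel \<Otimes>\<^sub>M M) (\<lambda>(s, \<omega>). indicator {0..T} s * (X s \<omega>)\<^sup>2)"
    and X_square: "0 \<le> t \<Longrightarrow> square_integrable M (X t)"
    and N_square: "0 \<le> t \<Longrightarrow> square_integrable M (N t)"
    and equation: "0 \<le> t \<Longrightarrow> AE \<omega> in M. X t \<omega> = N t \<omega> - \<mu> * (LINT s:{0..t}|lborel. X s \<omega>)"
    and N_cov: "0 \<le> s \<Longrightarrow> s \<le> t \<Longrightarrow> expectation (\<lambda>\<omega>. N s \<omega> * N t \<omega>) = \<Gamma> s"
    and \<mu>_pos: "0 < \<mu>"
begin

sublocale LM: pair_sigma_finite lborel M ..

definition H :: "real \<Rightarrow> 'w \<Rightarrow> real" where
  "H t \<omega> = (LINT s:{0..t}|lborel. X s \<omega>)"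

lemma H_measurable [measurable]: "H t \<in> borel_measurable M"
  unfolding H_def set_lebesgue_integral_def by measurable

lemma X_H: "0 \<le> t \<Longrightarrow> AE \<omega> in M. N t \<omega> = X t \<omega> + \<mu> * H t \<omega>"
  using equation[of t] by (auto simp: H_def)

text \<open>Since \<mu> is not 0, the equation itself expresses the time integral as (N - X)/\<mu>,
  a combination of two square integrable variables.\<close>

lemma H_square:
  assumes "0 \<le> t"
  shows "square_integrable M (H t)"
proof (rule square_integrable_bound)
  show "square_integrable M (\<lambda>\<omega>. (1 / \<mu>) * (N t \<omega> - X t \<omega>))"
    by (intro square_integrable_cmult square_integrable_diff X_square N_square assms)
  show "AE \<omega> in M. \<bar>H t \<omega>\<bar> \<le> \<bar>(1 / \<mu>) * (N t \<omega> - X t \<omega>)\<bar>"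
    using X_H[OF assms] by eventually_elim (use \<mu>_pos in auto)
qed measurable

text \<open>The domination |Y X| <= X^2 + Y^2 on the bounded time interval justifies every later
  exchange of expectation and time integral.\<close>

lemma X_mult_integrable:
  assumes "square_integrable M Y"
  shows "integrable (lborel \<Otimes>\<^sub>M M) (\<lambda>(s, \<omega>). indicator {0..t} s * (Y \<omega> * X s \<omega>))"
proof (rule Bochner_Integration.integrable_bound)
  have [measurable]: "Y \<in> borel_measurable M"
    using assms by (simp add: square_integrable_def)
  have "integrable (lborel \<Otimes>\<^sub>M M) (\<lambda>(s, \<omega>). indicator {0..t} s * (Y \<omega>)\<^sup>2)"
    using assms by (intro LM.integrable_pair_mult) (auto simp: square_integrable_def)
  from Bochner_Integration.integrable_add[OF X_integrable[of t] this]
  show "integrable (lborel \<Otimes>\<^sub>M M) (\<lambda>(s, \<omega>). indicator {0..t} s * ((X s \<omega>)\<^sup>2 + (Y \<omega>)\<^sup>2))"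
    by (simp add: case_prod_unfold algebra_simps)
  show "(\<lambda>(s, \<omega>). indicator {0..t} s * (Y \<omega> * X s \<omega>)) \<in> borel_measurable (lborel \<Otimes>\<^sub>M M)"
    by measurable
  show "AE z in lborel \<Otimes>\<^sub>M M. norm (case z of (s, \<omega>) \<Rightarrow> indicator {0..t} s * (Y \<omega> * X s \<omega>))
      \<le> norm (case z of (s, \<omega>) \<Rightarrow> indicator {0..t} s * ((X s \<omega>)\<^sup>2 + (Y \<omega>)\<^sup>2))"
    using abs_mult_le_squares[of "Y _" "X _ _"] by (auto simp: indicator_def add.commute)
qed

lemma expectation_mult_H:
  assumes Y: "square_integrable M Y"
  shows "set_integrable lborel {0..t} (\<lambda>s. expectation (\<lambda>\<omega>. Y \<omega> * X s \<omega>))"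
    and "expectation (\<lambda>\<omega>. Y \<omega> * H t \<omega>) = (LINT s:{0..t}|lborel. expectation (\<lambda>\<omega>. Y \<omega> * X s \<omega>))"
proof -
  have eq: "(\<lambda>(s, \<omega>). indicator {0..t} s * (Y \<omega> * X s \<omega>)) = (\<lambda>(s, \<omega>). Y \<omega> * (indicator {0..t} s
      * X s \<omega>))"
    by (auto simp: ac_simps)
  note i = X_mult_integrable[OF Y, of t]
  show "set_integrable lborel {0..t} (\<lambda>s. expectation (\<lambda>\<omega>. Y \<omega> * X s \<omega>))"
    using LM.integrable_fst[OF i] by (simp add: set_integrable_def)
  have "expectation (\<lambda>\<omega>. Y \<omega> * H t \<omega>) = expectation (\<lambda>\<omega>. LINT s|lborel. indicator {0..t} s * (Y
      \<omega> * X s \<omega>))"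
    by (simp add: H_def set_lebesgue_integral_def mult.left_commute[of "indicator _ _"])
  also have "\<dots> = (LINT s|lborel. expectation (\<lambda>\<omega>. indicator {0..t} s * (Y \<omega> * X s \<omega>)))"
    by (rule LM.Fubini_integral[OF i])
  finally show "expectation (\<lambda>\<omega>. Y \<omega> * H t \<omega>) = (LINT s:{0..t}|lborel. expectation (\<lambda>\<omega>. Y \<omega> * X
      s \<omega>))"
    by (simp add: set_lebesgue_integral_def)
qed

lemma expectation_X_N:
  assumes "0 \<le> s" "s \<le> t'" "t' \<le> t"
  shows "expectation (\<lambda>\<omega>. N t \<omega> * X s \<omega>) = expectation (\<lambda>\<omega>. N t' \<omega> * X s \<omega>)"
proof -
  define Y where "Y = (\<lambda>\<omega>. N t \<omega> - N t' \<omega>)"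
  have Nt: "square_integrable M (N t)" "square_integrable M (N t')"
    using assms by (auto intro: N_square)
  have Y: "square_integrable M Y"
    unfolding Y_def using Nt by (rule square_integrable_diff)
  have "expectation (\<lambda>\<omega>. Y \<omega> * X s \<omega>) = 0"
  proof (rule volterra_homogeneous[OF expectation_mult_H(1)[OF Y]])
    fix s assume s: "0 \<le> s" "s \<le> t'"
    have Ns: "square_integrable M (N s)" using s by (intro N_square)
    note sq = square_integrable_mult[OF Y Ns] square_integrable_mult[OF Y H_square[OF s(1)]]
    have "expectation (\<lambda>\<omega>. Y \<omega> * X s \<omega>) = expectation (\<lambda>\<omega>. Y \<omega> * N s \<omega> - \<mu> * (Y \<omega> * H s \<omega>))"
    proof (rule integral_cong_AE)
      show "AE \<omega> in M. Y \<omega> * X s \<omega> = Y \<omega> * N s \<omega> - \<mu> * (Y \<omega> * H s \<omega>)"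
        using X_H[OF s(1)] by eventually_elim (simp add: algebra_simps)
    qed (use Y Ns X_square[OF s(1)] in \<open>auto simp: square_integrable_def\<close>)
    also have "\<dots> = expectation (\<lambda>\<omega>. Y \<omega> * N s \<omega>) - \<mu> * expectation (\<lambda>\<omega>. Y \<omega> * H s \<omega>)"
      using sq by simp
    also have "expectation (\<lambda>\<omega>. Y \<omega> * N s \<omega>) = expectation (\<lambda>\<omega>. N s \<omega> * N t \<omega> - N s \<omega> * N t' \<omega>)"
      by (rule Bochner_Integration.integral_cong) (auto simp: Y_def algebra_simps)
    also have "\<dots> = 0"
      using s assms Nt Ns by (simp add: square_integrable_mult N_cov)
    finally show "expectation (\<lambda>\<omega>. Y \<omega> * X s \<omega>) =
        - \<mu> * (LINT r:{0..s}|lborel. expectation (\<lambda>\<omega>. Y \<omega> * X r \<omega>))"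
      by (simp add: expectation_mult_H(2)[OF Y])
  qed (use assms in auto)
  moreover have "expectation (\<lambda>\<omega>. Y \<omega> * X s \<omega>) = expectation (\<lambda>\<omega>. N t \<omega> * X s \<omega> - N t' \<omega> * X s \<omega>)"
    by (rule Bochner_Integration.integral_cong) (auto simp: Y_def algebra_simps)
  ultimately show ?thesis
    using Nt X_square[OF assms(1)] by (simp add: square_integrable_mult)
qed

text \<open>The square of H_t is a double time integral of the symmetric covariance of X, which is
  twice its integral over the triangle r <= s; the inner integral there is E(X_s H_s). This is the
  averaged form of d(H^2) = 2 H X dt.\<close>

lemma expectation_H_square:
  assumes "0 \<le> t"
  shows "expectation (\<lambda>\<omega>. H t \<omega> * H t \<omega>) = 2 * (LINT s:{0..t}|lborel. expectation (\<lambda>\<omega>. X s \<omega> * H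
      s \<omega>))"
proof -
  define C where "C = (\<lambda>s r. expectation (\<lambda>\<omega>. X s \<omega> * X r \<omega>))"
  define v where "v = (\<lambda>s. expectation (\<lambda>\<omega>. (X s \<omega>)\<^sup>2))"
  have [measurable]: "v \<in> borel_measurable lborel"
    unfolding v_def by measurable
  have C_meas [measurable]: "(\<lambda>(s, r). C s r) \<in> borel_measurable (lborel \<Otimes>\<^sub>M lborel)"
    unfolding C_def by measurable
  have v_int: "integrable lborel (\<lambda>s. indicator {0..t} s * v s)"
    using LM.integrable_fst[OF X_integrable[of t]] by (simp add: v_def)
  have "integrable (lborel \<Otimes>\<^sub>M lborel) (\<lambda>(s, r). indicator {0..t} s * indicator {0..t} r * C s r)"
  proof (rule Bochner_Integration.integrable_bound)
    have "integrable (lborel \<Otimes>\<^sub>M lborel) (\<lambda>(s, r). indicator {0..t} s * v s * indicator {0..t} r)"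
      and "integrable (lborel \<Otimes>\<^sub>M lborel) (\<lambda>(s, r). indicator {0..t} s * (indicator {0..t} r * v
          r))"
      by (intro lborel_pair.integrable_pair_mult v_int integrable_interval)+
    from Bochner_Integration.integrable_add[OF this]
    show "integrable (lborel \<Otimes>\<^sub>M lborel) (\<lambda>(s, r). indicator {0..t} s * indicator {0..t} r * (v
        s + v r))"
      by (simp add: case_prod_unfold algebra_simps)
    \<comment> \<open>Cauchy-Schwarz and the inequality of arithmetic and geometric means reduce
      integrability of the covariance on the square to integrability of the variance on
      [0, t].\<close>
    have "\<bar>C s r\<bar> \<le> \<bar>v s + v r\<bar>" if "0 \<le> s" "0 \<le> r" for s r
    proof -
      have v0: "0 \<le> v s" "0 \<le> v r" by (auto simp: v_def)
      have "\<bar>C s r\<bar> \<le> sqrt (v s) * sqrt (v r)"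
        unfolding C_def v_def by (intro integral_Cauchy_Schwarz X_square that)
      also have "\<dots> \<le> v s + v r"
        using arith_geo_mean_sqrt[OF v0] v0 by (simp add: real_sqrt_mult)
      also have "\<dots> \<le> \<bar>v s + v r\<bar>" by (rule abs_ge_self)
      finally show ?thesis .
    qed
    then show "AE z in lborel \<Otimes>\<^sub>M lborel. norm (case z of (s, r) \<Rightarrow> indicator {0..t} s *
        indicator {0..t} r * C s r)
        \<le> norm (case z of (s, r) \<Rightarrow> indicator {0..t} s * indicator {0..t} r * (v s + v r))"
      by (intro AE_I2) (auto simp: indicator_def)
  qed measurable
  then have "(LINT s:{0..t}|lborel. LINT r:{0..t}|lborel. C s r) =
      2 * (LINT s:{0..t}|lborel. LINT r:{0..s}|lborel. C s r)"
    by (rule symmetric_integral_triangle) (simp add: C_def mult.commute)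
  moreover have CH: "(LINT r:{0..t}|lborel. C s r) = expectation (\<lambda>\<omega>. X s \<omega> * H t \<omega>)" if "0 \<le> s"
      for s t
    unfolding C_def using expectation_mult_H(2)[OF X_square[OF that], of t] by simp
  moreover have "(LINT s:{0..t}|lborel. LINT r:{0..t}|lborel. C s r) =
      (LINT s:{0..t}|lborel. expectation (\<lambda>\<omega>. X s \<omega> * H t \<omega>))"
    "(LINT s:{0..t}|lborel. LINT r:{0..s}|lborel. C s r) =
      (LINT s:{0..t}|lborel. expectation (\<lambda>\<omega>. X s \<omega> * H s \<omega>))"
    by (rule set_lebesgue_integral_cong; simp add: CH)+
  ultimately have "(LINT s:{0..t}|lborel. expectation (\<lambda>\<omega>. X s \<omega> * H t \<omega>)) =
      2 * (LINT s:{0..t}|lborel. expectation (\<lambda>\<omega>. X s \<omega> * H s \<omega>))"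
    by (simp only:)
  then show ?thesis
    using expectation_mult_H(2)[OF H_square[OF assms], of t] by (simp add: mult.commute)
qed

text \<open>E(N_t H_t) is computed twice: by Fubini as the time integral of \<rho>(s) = E(N_s X_s),
  and by inserting N = X + \<mu> H. Together with \<rho> = v + \<mu> p and \<Gamma> = \<rho> + \<mu>
  times the integral of \<rho>, this is a linear system from which \<rho> and p are
  eliminated.\<close>

theorem second_moment:
  assumes t: "0 \<le> t"
  shows "expectation (\<lambda>\<omega>. (X t \<omega>)\<^sup>2) = \<Gamma> t - 2 * \<mu> * (LINT s:{0..t}|lborel. expectation (\<lambda>\<omega>. (X
      s \<omega>)\<^sup>2))"
proof -
  define v where "v = (\<lambda>s. expectation (\<lambda>\<omega>. (X s \<omega>)\<^sup>2))"
  define \<rho> where "\<rho> = (\<lambda>s. expectation (\<lambda>\<omega>. N s \<omega> * X s \<omega>))"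
  define p where "p = (\<lambda>s. expectation (\<lambda>\<omega>. X s \<omega> * H s \<omega>))"
  have N_mult: "expectation (\<lambda>\<omega>. Y \<omega> * N s \<omega>) = expectation (\<lambda>\<omega>. Y \<omega> * X s \<omega>) + \<mu> * expectation
      (\<lambda>\<omega>. Y \<omega> * H s \<omega>)"
    if Y: "square_integrable M Y" and s: "0 \<le> s" for Y s
  proof -
    have "expectation (\<lambda>\<omega>. Y \<omega> * N s \<omega>) = expectation (\<lambda>\<omega>. Y \<omega> * X s \<omega> + \<mu> * (Y \<omega> * H s \<omega>))"
    proof (rule integral_cong_AE)
      show "AE \<omega> in M. Y \<omega> * N s \<omega> = Y \<omega> * X s \<omega> + \<mu> * (Y \<omega> * H s \<omega>)"
        using X_H[OF s(1)] by eventually_elim (simp add: algebra_simps)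
    qed (use Y N_square[OF s] X_square[OF s] in \<open>auto simp: square_integrable_def\<close>)
    then show ?thesis
      using Y H_square[OF s] X_square[OF s] by (simp add: square_integrable_mult)
  qed
  have \<rho>_eq: "\<rho> s = v s + \<mu> * p s" if "0 \<le> s" for s
    using N_mult[OF X_square[OF that] that] by (simp add: \<rho>_def v_def p_def power2_eq_square
        mult.commute)
  have N_X: "expectation (\<lambda>\<omega>. N t \<omega> * X s \<omega>) = \<rho> s" if "s \<in> {0..t}" for s
    unfolding \<rho>_def using expectation_X_N[of s s t] that by simp
  have \<rho>_int: "set_integrable lborel {0..t} \<rho>"
    using expectation_mult_H(1)[OF N_square[OF t], of t] N_X
    by (subst set_integrable_cong[OF refl refl]) auto
  have v_int: "set_integrable lborel {0..t} v"
    using LM.integrable_fst[OF X_integrable[of t]] by (simp add: v_def set_integrable_def)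
  \<comment> \<open>Integrability of p is not visible from its definition, since H itself depends on
    s; it is read off from p = (\<rho> - v)/\<mu>.\<close>
  have p_int: "set_integrable lborel {0..t} p"
  proof (subst set_integrable_cong[OF refl refl])
    show "p s = (\<rho> s - v s) / \<mu>" if "s \<in> {0..t}" for s
      using \<rho>_eq[of s] that \<mu>_pos by simp
    show "set_integrable lborel {0..t} (\<lambda>s. (\<rho> s - v s) / \<mu>)"
      using \<rho>_int v_int by (intro set_integrable_divide set_integral_diff)
  qed
  have "(LINT s:{0..t}|lborel. \<rho> s) = (LINT s:{0..t}|lborel. v s + \<mu> * p s)"
    by (intro set_lebesgue_integral_cong) (auto simp: \<rho>_eq)
  also have "\<dots> = (LINT s:{0..t}|lborel. v s) + \<mu> * (LINT s:{0..t}|lborel. p s)"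
    using v_int p_int by (simp add: set_integral_add)
  finally have 1: "(LINT s:{0..t}|lborel. \<rho> s) = (LINT s:{0..t}|lborel. v s) + \<mu> * (LINT
      s:{0..t}|lborel. p s)" .
  have "expectation (\<lambda>\<omega>. N t \<omega> * H t \<omega>) = (LINT s:{0..t}|lborel. expectation (\<lambda>\<omega>. N t \<omega> * X s \<omega>))"
    by (rule expectation_mult_H[OF N_square[OF t]])
  also have "\<dots> = (LINT s:{0..t}|lborel. \<rho> s)"
    by (intro set_lebesgue_integral_cong) (auto simp: N_X)
  finally have 2: "expectation (\<lambda>\<omega>. N t \<omega> * H t \<omega>) = (LINT s:{0..t}|lborel. \<rho> s)" .
  have 3: "expectation (\<lambda>\<omega>. H t \<omega> * N t \<omega>) = p t + \<mu> * (2 * (LINT s:{0..t}|lborel. p s))"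
    using N_mult[OF H_square[OF t] t] expectation_H_square[OF t] by (simp add: p_def mult.commute)
  have 4: "\<Gamma> t = \<rho> t + \<mu> * (LINT s:{0..t}|lborel. \<rho> s)"
    using N_mult[OF N_square[OF t] t] N_cov[OF t order_refl] 2 by (simp add: \<rho>_def)
  \<comment> \<open>With the factor \<mu> kept, the elimination is linear in
    \<open>\<mu> * p t\<close> and in \<mu> squared times the integral of p.\<close>
  have "\<mu> * (LINT s:{0..t}|lborel. \<rho> s) = \<mu> * (p t + \<mu> * (2 * (LINT s:{0..t}|lborel. p s)))"
    using 2 3 by (simp add: mult.commute)
  moreover have "expectation (\<lambda>\<omega>. (X t \<omega>)\<^sup>2) = v t" "(LINT s:{0..t}|lborel. expectation (\<lambda>\<omega>. (X
      s \<omega>)\<^sup>2)) = (LINT s:{0..t}|lborel. v s)"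
    by (simp_all add: v_def)
  ultimately show ?thesis
    using 1 4 \<rho>_eq[OF t] by (simp add: algebra_simps)
qed

end

section \<open>The It\^o isometry\<close>

lemma (in pair_sigma_finite) integral_pair_mult:
  fixes f :: "'a \<Rightarrow> real" and g :: "'b \<Rightarrow> real"
  assumes "integrable M1 f" "integrable M2 g"
  shows "(LINT (x, y)|(M1 \<Otimes>\<^sub>M M2). f x * g y) = (LINT x|M1. f x) * (LINT y|M2. g y)"
  using integral_fst[OF integrable_pair_mult[OF assms]] by simp

lemma centered_gaussian_square_integrable:
  assumes "centered_gaussian M X"
  shows "square_integrable M X" and "(LINT \<omega>|M. X \<omega>) = 0"
proof -
  have [measurable]: "X \<in> borel_measurable M"
    using assms by (simp add: centered_gaussian_def)
  from assms consider "AE \<omega> in M. X \<omega> = 0"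
    | \<sigma> where "\<sigma> > 0" "distributed M lborel X (\<lambda>x. ennreal (normal_density 0 \<sigma> x))"
    by (auto simp: centered_gaussian_def)
  then have "square_integrable M X \<and> (LINT \<omega>|M. X \<omega>) = 0"
  proof cases
    case 1
    then have "square_integrable M X"
      by (intro square_integrable_bound[OF square_integrable_zero]) auto
    moreover have "(LINT \<omega>|M. X \<omega>) = (LINT \<omega>|M. 0)"
      using 1 by (intro integral_cong_AE) auto
    ultimately show ?thesis by simp
  next
    case 2
    have "integrable M (\<lambda>\<omega>. (X \<omega>)\<^sup>2)"
      using integrable_normal_moment[of \<sigma> 0 2] 2
      by (subst distributed_integrable[OF 2(2), symmetric]) auto
    moreover have "(LINT \<omega>|M. X \<omega>) = (LINT x|lborel. normal_density 0 \<sigma> x * x)"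
      by (subst distributed_integral[OF 2(2)]) auto
    ultimately show ?thesis
      using 2(1) by (simp add: square_integrable_def integral_normal_moment_nz_1)
  qed
  then show "square_integrable M X" "(LINT \<omega>|M. X \<omega>) = 0" by auto
qed

text \<open>On the strip over [0, T] the identity is measurable from the full product into the
  smaller product with \<open>F T\<close>; composing with it and extending by zero gives joint
  measurability for the one product measure on which Fubini is applied.\<close>

lemma progressively_measurable_product:
  assumes X: "progressively_measurable F X" and F: "subalgebra M (F T)" and T: "0 \<le> T"
  shows "(\<lambda>(s, \<omega>). indicator {0..T} s * X s \<omega>) \<in> borel_measurable (lborel \<Otimes>\<^sub>M M)"
proof -
  let ?R = "restrict_space (lborel \<Otimes>\<^sub>M M) {z. fst z \<in> {0..T}}"
  have id: "(\<lambda>z. z) \<in> measurable ?R (restrict_space borel {0..T} \<Otimes>\<^sub>M F T)"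
  proof (rule measurable_pair)
    show "fst \<circ> (\<lambda>z. z) \<in> measurable ?R (restrict_space borel {0..T})"
      by (rule measurable_restrict_space2)
         (auto simp: space_restrict_space comp_def intro!: measurable_restrict_space1)
    have "snd \<in> measurable (lborel \<Otimes>\<^sub>M M) (F T)"
      using F measurable_snd[of lborel M] unfolding measurable_def subalgebra_def by auto
    then show "snd \<circ> (\<lambda>z. z) \<in> measurable ?R (F T)"
      by (auto simp: comp_def intro!: measurable_restrict_space1)
  qed
  have X': "(\<lambda>(s, \<omega>). X s \<omega>) \<in> borel_measurable (restrict_space borel {0..T} \<Otimes>\<^sub>M F T)"
    using X T by (simp add: progressively_measurable_def)
  have set: "{z \<in> space (lborel \<Otimes>\<^sub>M M). fst z \<in> {0..T}} \<in> sets (lborel \<Otimes>\<^sub>M M)"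
    by measurable
  have "(\<lambda>(s, \<omega>). X s \<omega>) \<in> borel_measurable ?R"
    using measurable_compose[OF id X'] by simp
  then have "(\<lambda>z. if fst z \<in> {0..T} then (\<lambda>(s, \<omega>). X s \<omega>) z else 0) \<in> borel_measurable (lborel
      \<Otimes>\<^sub>M M)"
    unfolding measurable_If_restrict_space_iff[OF set] by auto
  also have "(\<lambda>z. if fst z \<in> {0..T} then (\<lambda>(s, \<omega>). X s \<omega>) z else 0) =
      (\<lambda>(s, \<omega>). indicator {0..T} s * X s \<omega>)"
    by (auto simp: indicator_def)
  finally show ?thesis .
qed

section \<open>Noise increments and their independence of the past\<close>

locale white_noise = prob_space M
  for M :: "'w measure" and F :: "real \<Rightarrow> 'w measure" and D :: "'a::euclidean_space set"
    and q :: "'a \<Rightarrow> 'a \<Rightarrow> real" and W :: "real \<Rightarrow> ('a \<Rightarrow> real) \<Rightarrow> 'w \<Rightarrow> real" +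
  assumes noise: "white_in_time_noise M D q W" and filt: "noise_filtration M F D W"
begin

sublocale LM: pair_sigma_finite lborel M ..

lemma subalgebra_F: "subalgebra M (F t)"
  using filt by (simp add: noise_filtration_def)

lemma F_measurable_M: "f \<in> borel_measurable (F t) \<Longrightarrow> f \<in> borel_measurable M"
  by (rule measurable_from_subalg[OF subalgebra_F])

lemma F_mono:
  assumes "s \<le> t" "f \<in> borel_measurable (F s)"
  shows "f \<in> borel_measurable (F t)"
proof -
  have "filtration (space M) F" using filt by (simp add: noise_filtration_def)
  from filtration.sets_F_mono[OF this assms(1)] filtration.space_F[OF this]
  have "subalgebra (F t) (F s)" by (simp add: subalgebra_def)
  then show ?thesis by (rule measurable_from_subalg) fact
qed

lemma W_adapted: "0 \<le> t \<Longrightarrow> f \<in> L2 D \<Longrightarrow> W t f \<in> borel_measurable (F t)"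
  using filt by (simp add: noise_filtration_def)

lemma W_gaussian: "0 \<le> t \<Longrightarrow> f \<in> L2 D \<Longrightarrow> centered_gaussian M (W t f)"
  using noise unfolding white_in_time_noise_def
  by (elim conjE allE[of _ "Suc 0"] allE[of _ "\<lambda>_. 1"] allE[of _ "\<lambda>_. t"] allE[of _ "\<lambda>_. f"]) simp

lemmas W_square = centered_gaussian_square_integrable(1)[OF W_gaussian]
lemmas W_mean = centered_gaussian_square_integrable(2)[OF W_gaussian]

lemma W_cov:
  "0 \<le> t \<Longrightarrow> 0 \<le> s \<Longrightarrow> f \<in> L2 D \<Longrightarrow> g \<in> L2 D \<Longrightarrow>
    expectation (\<lambda>\<omega>. W t f \<omega> * W s g \<omega>) = min t s * kernel_form D q f g"
  using noise by (simp add: white_in_time_noise_def)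

text \<open>Read off from the covariance of the noise at time 1, where the two factors
  commute.\<close>

lemma kernel_form_sym: "f \<in> L2 D \<Longrightarrow> g \<in> L2 D \<Longrightarrow> kernel_form D q f g = kernel_form D q g f"
  using W_cov[of 1 1 f g] W_cov[of 1 1 g f] by (simp add: mult.commute)

text \<open>The sigma-algebra of the future from \<open>noise_filtration\<close>, packaged as a
  measure space so that measurability with respect to it can be stated. Its generators are
  increments that start exactly at s.\<close>

definition increment_algebra :: "real \<Rightarrow> 'w measure" where
  "increment_algebra s = sigma (space M)
     {(\<lambda>\<omega>. W t f \<omega> - W s f \<omega>) -` A \<inter> space M | t f A. s \<le> t \<and> f \<in> L2 D \<and> A \<in> sets borel}"

lemma space_increment_algebra [simp]: "space (increment_algebra s) = space M"
  unfolding increment_algebra_def by (rule space_measure_of) auto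

text \<open>An increment between two times after s is a difference of two generating increments from
  s.\<close>

lemma increment_algebra_measurable:
  assumes "s \<le> a" "s \<le> b" "f \<in> L2 D"
  shows "(\<lambda>\<omega>. W b f \<omega> - W a f \<omega>) \<in> borel_measurable (increment_algebra s)"
proof -
  have *: "(\<lambda>\<omega>. W t f \<omega> - W s f \<omega>) \<in> borel_measurable (increment_algebra s)" if "s \<le> t" for t
  proof (rule measurableI)
    fix A :: "real set" assume "A \<in> sets borel"
    then show "(\<lambda>\<omega>. W t f \<omega> - W s f \<omega>) -` A \<inter> space (increment_algebra s) \<in> sets
        (increment_algebra s)"
      using that assms unfolding space_increment_algebra unfolding increment_algebra_def
      by (subst sets_measure_of) (auto intro!: sigma_sets.Basic)
  qed auto
  have "(\<lambda>\<omega>. (W b f \<omega> - W s f \<omega>) - (W a f \<omega> - W s f \<omega>)) \<in> borel_measurable (increment_algebra s)"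
    using *[OF assms(1)] *[OF assms(2)] by measurable
  then show ?thesis by simp
qed

text \<open>The substitute for conditional expectations: a factor known at time s separates from any
  variable of the future, in particular from a product of increments in different noise
  directions.\<close>

lemma expectation_F_increment:
  fixes \<xi> Z :: "'w \<Rightarrow> real"
  assumes s: "0 \<le> s" and \<xi>: "\<xi> \<in> borel_measurable (F s)" "integrable M \<xi>"
    and Z: "Z \<in> borel_measurable (increment_algebra s)" "integrable M Z"
  shows "expectation (\<lambda>\<omega>. \<xi> \<omega> * Z \<omega>) = expectation \<xi> * expectation Z"
proof (rule indep_var_lebesgue_integral)
  have ind: "indep_set (sets (F s)) (sets (increment_algebra s))"
    using filt s unfolding noise_filtration_def increment_algebra_def
    by (subst sets_measure_of) auto
  have "sigma_sets (space M) {\<xi> -` A \<inter> space M |A. A \<in> sets borel} \<subseteq> sets (F s)"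
    using sets.sigma_sets_subset[of "{\<xi> -` A \<inter> space M |A. A \<in> sets borel}" "F s"] \<xi>(1)
        subalgebra_F[of s]
    by (auto simp: subalgebra_def measurable_def)
  moreover have "sigma_sets (space M) {Z -` A \<inter> space M |A. A \<in> sets borel} \<subseteq> sets
      (increment_algebra s)"
    using sets.sigma_sets_subset[of "{Z -` A \<inter> space M |A. A \<in> sets borel}" "increment_algebra
        s"] Z(1)
    by (auto simp: measurable_def)
  ultimately have "indep_set (sigma_sets (space M) {\<xi> -` A \<inter> space M |A. A \<in> sets borel})
      (sigma_sets (space M) {Z -` A \<inter> space M |A. A \<in> sets borel})"
    using ind unfolding indep_sets2_eq by blast
  then show "indep_var borel \<xi> borel Z"
    unfolding indep_var_eq using \<xi>(2) Z(2) by auto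
qed fact+

lemma increment_square:
  "0 \<le> a \<Longrightarrow> 0 \<le> b \<Longrightarrow> f \<in> L2 D \<Longrightarrow> square_integrable M (\<lambda>\<omega>. W b f \<omega> - W a f \<omega>)"
  by (intro square_integrable_diff W_square)

lemma increment_mean:
  assumes "0 \<le> a" "0 \<le> b" "f \<in> L2 D"
  shows "expectation (\<lambda>\<omega>. W b f \<omega> - W a f \<omega>) = 0"
  using assms W_mean square_integrable_integrable[OF finite_measure_axioms W_square]
  by simp

lemma increment_cov:
  assumes "0 \<le> c" "c \<le> b" "c \<le> d" "f \<in> L2 D" "g \<in> L2 D"
  shows "expectation (\<lambda>\<omega>. (W b f \<omega> - W c f \<omega>) * (W d g \<omega> - W c g \<omega>)) = (min b d - c) *
      kernel_form D q f g"
proof -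
  have i: "integrable M (\<lambda>\<omega>. W s f \<omega> * W t g \<omega>)" if "0 \<le> s" "0 \<le> t" for s t
    using that assms by (intro square_integrable_mult W_square)
  have "expectation (\<lambda>\<omega>. (W b f \<omega> - W c f \<omega>) * (W d g \<omega> - W c g \<omega>)) =
      expectation (\<lambda>\<omega>. (W b f \<omega> * W d g \<omega> - W b f \<omega> * W c g \<omega>) - (W c f \<omega> * W d g \<omega> - W c f \<omega> *
          W c g \<omega>))"
    by (rule Bochner_Integration.integral_cong) (auto simp: algebra_simps)
  also have "\<dots> = (min b d - min b c - (min c d - min c c)) * kernel_form D q f g"
    using assms i by (simp add: W_cov algebra_simps)
  finally show ?thesis
    using assms by (simp add: min_def)
qed

lemma bounded_F_increment:
  assumes "\<xi> \<in> borel_measurable (F a)" "bounded (\<xi> ` space M)" "0 \<le> a" "0 \<le> b" "f \<in> L2 D"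
  shows "square_integrable M (\<lambda>\<omega>. \<xi> \<omega> * (W b f \<omega> - W a f \<omega>))"
proof -
  obtain B where "\<And>\<omega>. \<omega> \<in> space M \<Longrightarrow> \<bar>\<xi> \<omega>\<bar> \<le> B"
    using assms(2) by (auto simp: bounded_iff)
  then show ?thesis
    using assms F_measurable_M[OF assms(1)] by (intro square_integrable_bounded_mult
        increment_square) auto
qed

lemma bounded_square_integrable:
  assumes "\<xi> \<in> borel_measurable M" "bounded (\<xi> ` space M)"
  shows "square_integrable M \<xi>"
proof -
  obtain B where "\<And>\<omega>. \<omega> \<in> space M \<Longrightarrow> \<bar>\<xi> \<omega>\<bar> \<le> B"
    using assms(2) by (auto simp: bounded_iff)
  then show ?thesis
    using square_integrable_bounded_mult[OF square_integrable_const[OF finite_measure_axioms, of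
        1] assms(1), of B]
    by simp
qed

lemma expectation_simple_term:
  assumes \<xi>: "\<xi> \<in> borel_measurable (F a)" "bounded (\<xi> ` space M)" and ab: "0 \<le> a" "a \<le> b" and f:
      "f \<in> L2 D"
  shows "expectation (\<lambda>\<omega>. \<xi> \<omega> * (W b f \<omega> - W a f \<omega>)) = 0"
proof -
  have "integrable M \<xi>"
    using \<xi> by (intro square_integrable_integrable bounded_square_integrable F_measurable_M
        finite_measure_axioms)
  moreover have "integrable M (\<lambda>\<omega>. W b f \<omega> - W a f \<omega>)"
    using ab f by (intro square_integrable_integrable increment_square finite_measure_axioms) auto
  ultimately show ?thesis
    using expectation_F_increment[OF ab(1) \<xi>(1) _ increment_algebra_measurable[OF order_refl
        ab(2) f]]
      increment_mean[of a b f] ab f by simp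
qed

text \<open>The increment over (a, b] is cut at c. Its part before c is known at time c and meets an
  independent increment of mean zero, so it contributes nothing. After c both increments start at c,
  are jointly independent of the coefficients, and have covariance proportional to the overlap
  length.\<close>

lemma expectation_simple_product_aux:
  assumes \<xi>: "\<xi> \<in> borel_measurable (F a)" "bounded (\<xi> ` space M)" and ab: "0 \<le> a" "a \<le> b" and f:
      "f \<in> L2 D"
    and \<eta>: "\<eta> \<in> borel_measurable (F c)" "bounded (\<eta> ` space M)" and cd: "c \<le> d" and g: "g \<in> L2 D"
    and ac: "a \<le> c"
  shows "expectation (\<lambda>\<omega>. (\<xi> \<omega> * (W b f \<omega> - W a f \<omega>)) * (\<eta> \<omega> * (W d g \<omega> - W c g \<omega>))) =
    kernel_form D q f g * (expectation (\<lambda>\<omega>. \<xi> \<omega> * \<eta> \<omega>) * max 0 (min b d - max a c))"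
proof -
  have \<xi>c: "\<xi> \<in> borel_measurable (F c)" by (rule F_mono[OF ac \<xi>(1)])
  have c: "0 \<le> c" using ab ac by simp
  have Zg: "(\<lambda>\<omega>. W d g \<omega> - W c g \<omega>) \<in> borel_measurable (increment_algebra c)"
    using cd g by (intro increment_algebra_measurable) auto
  have Zg_int: "integrable M (\<lambda>\<omega>. W d g \<omega> - W c g \<omega>)"
    using c cd g by (intro square_integrable_integrable increment_square finite_measure_axioms) auto
  have \<eta>_sq: "square_integrable M \<eta>" and \<xi>_sq: "square_integrable M \<xi>"
    using \<xi> \<eta> by (auto intro!: bounded_square_integrable F_measurable_M)
  \<comment> \<open>The free endpoint b' takes two values: b when the intervals do not overlap, and
    c when the first increment is cut there.\<close>
  have past: "expectation (\<lambda>\<omega>. (\<xi> \<omega> * (W b' f \<omega> - W a f \<omega>)) * (\<eta> \<omega> * (W d g \<omega> - W c g \<omega>))) = 0"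
    if b': "a \<le> b'" "b' \<le> c" for b'
  proof -
    have [measurable]: "W b' f \<in> borel_measurable (F c)" "W a f \<in> borel_measurable (F c)"
      using b' ab ac f by (auto intro: F_mono[OF _ W_adapted])
    have "(\<lambda>\<omega>. (\<xi> \<omega> * (W b' f \<omega> - W a f \<omega>)) * \<eta> \<omega>) \<in> borel_measurable (F c)"
      using \<xi>c \<eta>(1) by measurable
    moreover have "integrable M (\<lambda>\<omega>. (\<xi> \<omega> * (W b' f \<omega> - W a f \<omega>)) * \<eta> \<omega>)"
      using b' ab f by (intro square_integrable_mult bounded_F_increment \<xi> \<eta>_sq) auto
    ultimately have "expectation (\<lambda>\<omega>. ((\<xi> \<omega> * (W b' f \<omega> - W a f \<omega>)) * \<eta> \<omega>) * (W d g \<omega> - W c g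
        \<omega>)) = 0"
      using expectation_F_increment[OF c _ _ Zg Zg_int] increment_mean[of c d g] c cd g by simp
    then show ?thesis by (simp add: mult.assoc)
  qed
  show ?thesis
  proof (cases "b \<le> c")
    case True
    then show ?thesis using past[of b] ab ac by simp
  next
    case False
    then have bc: "c \<le> b" by simp
    let ?P = "\<lambda>\<omega>. (\<xi> \<omega> * (W c f \<omega> - W a f \<omega>)) * (\<eta> \<omega> * (W d g \<omega> - W c g \<omega>))"
    let ?Q = "\<lambda>\<omega>. (\<xi> \<omega> * \<eta> \<omega>) * ((W b f \<omega> - W c f \<omega>) * (W d g \<omega> - W c g \<omega>))"
    have "integrable M ?P"
      using ab c cd f g by (intro square_integrable_mult bounded_F_increment \<xi> \<eta>) auto
    moreover have "integrable M (\<lambda>\<omega>. (\<xi> \<omega> * (W b f \<omega> - W c f \<omega>)) * (\<eta> \<omega> * (W d g \<omega> - W c g \<omega>)))"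
      using ab c cd bc f g by (intro square_integrable_mult bounded_F_increment \<xi> \<xi>c \<eta>) auto
    then have "integrable M ?Q" by (simp add: ac_simps)
    ultimately have "expectation (\<lambda>\<omega>. ?P \<omega> + ?Q \<omega>) = expectation ?P + expectation ?Q"
      by (rule Bochner_Integration.integral_add)
    moreover have "expectation ?P = 0"
      using past[of c] ac by simp
    moreover have "expectation ?Q = expectation (\<lambda>\<omega>. \<xi> \<omega> * \<eta> \<omega>) *
        expectation (\<lambda>\<omega>. (W b f \<omega> - W c f \<omega>) * (W d g \<omega> - W c g \<omega>))"
    proof (rule expectation_F_increment[OF c])
      show "(\<lambda>\<omega>. \<xi> \<omega> * \<eta> \<omega>) \<in> borel_measurable (F c)"
        using \<xi>c \<eta>(1) by measurable
      show "(\<lambda>\<omega>. (W b f \<omega> - W c f \<omega>) * (W d g \<omega> - W c g \<omega>)) \<in> borel_measurable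
          (increment_algebra c)"
        using Zg increment_algebra_measurable[OF order_refl bc f] by measurable
      show "integrable M (\<lambda>\<omega>. \<xi> \<omega> * \<eta> \<omega>)"
        by (intro square_integrable_mult \<xi>_sq \<eta>_sq)
      show "integrable M (\<lambda>\<omega>. (W b f \<omega> - W c f \<omega>) * (W d g \<omega> - W c g \<omega>))"
        using c bc cd f g by (intro square_integrable_mult increment_square) auto
    qed
    moreover have "expectation (\<lambda>\<omega>. (W b f \<omega> - W c f \<omega>) * (W d g \<omega> - W c g \<omega>)) = (min b d - c) *
        kernel_form D q f g"
      using c bc cd f g by (intro increment_cov)
    moreover have "expectation (\<lambda>\<omega>. (\<xi> \<omega> * (W b f \<omega> - W a f \<omega>)) * (\<eta> \<omega> * (W d g \<omega> - W c g \<omega>))) =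
        expectation (\<lambda>\<omega>. ?P \<omega> + ?Q \<omega>)"
      by (rule Bochner_Integration.integral_cong) (auto simp: algebra_simps)
    moreover have "max 0 (min b d - max a c) = min b d - c"
      using bc cd ac by (simp add: max_def min_def)
    ultimately show ?thesis by simp
  qed
qed

lemma expectation_simple_product:
  assumes \<xi>: "\<xi> \<in> borel_measurable (F a)" "bounded (\<xi> ` space M)" and ab: "0 \<le> a" "a \<le> b" and f:
      "f \<in> L2 D"
    and \<eta>: "\<eta> \<in> borel_measurable (F c)" "bounded (\<eta> ` space M)" and cd: "0 \<le> c" "c \<le> d" and g:
        "g \<in> L2 D"
  shows "expectation (\<lambda>\<omega>. (\<xi> \<omega> * (W b f \<omega> - W a f \<omega>)) * (\<eta> \<omega> * (W d g \<omega> - W c g \<omega>))) =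
    kernel_form D q f g * (expectation (\<lambda>\<omega>. \<xi> \<omega> * \<eta> \<omega>) * max 0 (min b d - max a c))"
proof (cases "a \<le> c")
  case True
  then show ?thesis by (intro expectation_simple_product_aux assms)
next
  case False
  then have "c \<le> a" by simp
  from expectation_simple_product_aux[OF \<eta> cd g \<xi> ab(2) f this] show ?thesis
    using kernel_form_sym[OF f g] by (simp add: mult.commute max.commute min.commute)
qed

end

section \<open>Isometry for simple processes\<close>

lemma indicator_square: "(indicator A x)\<^sup>2 = (indicator A x :: real)"
  by (simp add: indicator_def)

text \<open>The right side is the overlap of the two intervals with endpoints clipped at t and s
  separately, the form in which the covariance of stopped increments produces it.\<close>

lemma integral_interval_product:
  fixes x x' y y' s t :: real
  assumes "0 \<le> x" "x \<le> x'" "0 \<le> y" "y \<le> y'" "0 \<le> s" "0 \<le> t"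
  shows "integrable lborel (\<lambda>r. indicator {0..min t s} r * (indicator {x<..x'} r * indicator
      {y<..y'} r) :: real)" (is ?int)
    and "(LINT r|lborel. indicator {0..min t s} r * (indicator {x<..x'} r * indicator {y<..y'} r)) =
      max 0 (min (min t x') (min s y') - max (min t x) (min s y))" (is ?eq)
proof -
  have *: "(\<lambda>r. indicator {0..min t s} r * (indicator {x<..x'} r * indicator {y<..y'} r) :: real) =
      indicator {max x y<..min (min t s) (min x' y')}"
    using assms by (auto simp: indicator_def fun_eq_iff)
  have "measure lborel {a<..b} = max 0 (b - a)" for a b :: real
    by (cases "a \<le> b") auto
  then have "(LINT r|lborel. indicator {max x y<..min (min t s) (min x' y')} r) =
      max 0 (min (min t s) (min x' y') - max x y)"
    by simp
  also have "\<dots> = max 0 (min (min t x') (min s y') - max (min t x) (min s y))"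
    using assms by (auto simp: min_def max_def)
  finally show ?eq unfolding * .
  have "emeasure lborel {a<..b} < \<infinity>" for a b :: real
    by (cases "a \<le> b") auto
  then show ?int
    unfolding * by (intro integrable_real_indicator) auto
qed

lemma simple_process_nonneg:
  assumes "simple_process M F n \<tau> \<xi>" "i \<le> n"
  shows "0 \<le> \<tau> i"
  using assms(2)
proof (induction i)
  case (Suc i)
  then show ?case using assms(1) by (auto simp: simple_process_def intro: order_trans)
qed (use assms in \<open>simp add: simple_process_def\<close>)

context white_noise
begin

lemma simple_process_square:
  assumes "simple_process M F n \<tau> \<xi>" "i < n"
  shows "square_integrable M (\<xi> i)"
  using assms by (intro bounded_square_integrable F_measurable_M[of _ "\<tau> i"]) (auto simp:
      simple_process_def)

text \<open>A coefficient \<open>\<xi> i\<close> with \<open>t < \<tau> i\<close> multiplies a vanishing increment. Replacing it by 0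
    makes it
  measurable at the stopped time \<open>min t (\<tau> i)\<close>.\<close>

lemma stopped_coefficient:
  assumes "simple_process M F n \<tau> \<xi>" "i < n" "0 \<le> t"
  defines "\<zeta> \<equiv> (if \<tau> i \<le> t then \<xi> i else (\<lambda>_. 0))"
  shows "\<zeta> \<in> borel_measurable (F (min t (\<tau> i)))" "bounded (\<zeta> ` space M)"
    and "\<xi> i \<omega> * (W (min t (\<tau> (Suc i))) f \<omega> - W (min t (\<tau> i)) f \<omega>) =
      \<zeta> \<omega> * (W (min t (\<tau> (Suc i))) f \<omega> - W (min t (\<tau> i)) f \<omega>)"
    and "0 \<le> min t (\<tau> i)" "min t (\<tau> i) \<le> min t (\<tau> (Suc i))"
proof -
  have *: "0 \<le> \<tau> i" "\<tau> i \<le> \<tau> (Suc i)" "\<xi> i \<in> borel_measurable (F (\<tau> i))" "bounded (\<xi> i ` space M)"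
    using assms(1,2) simple_process_nonneg[OF assms(1), of i] by (auto simp: simple_process_def)
  show "\<zeta> \<in> borel_measurable (F (min t (\<tau> i)))"
    using *(3) by (cases "\<tau> i \<le> t") (simp_all add: \<zeta>_def min_absorb2)
  have "(\<lambda>_. 0 :: real) ` space M \<subseteq> {0}" by auto
  then have "bounded ((\<lambda>_. 0 :: real) ` space M)"
    by (rule bounded_subset[rotated]) simp
  then show "bounded (\<zeta> ` space M)"
    using *(4) by (cases "\<tau> i \<le> t") (simp_all add: \<zeta>_def)
  show "\<xi> i \<omega> * (W (min t (\<tau> (Suc i))) f \<omega> - W (min t (\<tau> i)) f \<omega>) =
      \<zeta> \<omega> * (W (min t (\<tau> (Suc i))) f \<omega> - W (min t (\<tau> i)) f \<omega>)"
    using *(2) by (cases "\<tau> i \<le> t") (simp_all add: \<zeta>_def min_absorb1)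
  show "0 \<le> min t (\<tau> i)" "min t (\<tau> i) \<le> min t (\<tau> (Suc i))"
    using * assms(3) by auto
qed

lemma simple_integral_square:
  assumes "simple_process M F n \<tau> \<xi>" "0 \<le> t" "f \<in> L2 D"
  shows "square_integrable M (simple_integral (\<lambda>s. W s f) n \<tau> \<xi> t)"
  unfolding simple_integral_def
proof (rule square_integrable_sum)
  fix i assume "i \<in> {..<n}"
  then have i: "i < n" by simp
  note st = stopped_coefficient[OF assms(1) i assms(2)]
  show "square_integrable M (\<lambda>\<omega>. \<xi> i \<omega> * (W (min t (\<tau> (Suc i))) f \<omega> - W (min t (\<tau> i)) f \<omega>))"
    unfolding st(3) using st(4,5) by (intro bounded_F_increment st(1,2) assms) auto
qed

lemma simple_integral_mean:
  assumes "simple_process M F n \<tau> \<xi>" "0 \<le> t" "f \<in> L2 D"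
  shows "expectation (simple_integral (\<lambda>s. W s f) n \<tau> \<xi> t) = 0"
proof -
  have *: "integrable M (\<lambda>\<omega>. \<xi> i \<omega> * (W (min t (\<tau> (Suc i))) f \<omega> - W (min t (\<tau> i)) f \<omega>))"
    "expectation (\<lambda>\<omega>. \<xi> i \<omega> * (W (min t (\<tau> (Suc i))) f \<omega> - W (min t (\<tau> i)) f \<omega>)) = 0" if i: "i <
        n" for i
  proof -
    note st = stopped_coefficient[OF assms(1) i assms(2)]
    show "integrable M (\<lambda>\<omega>. \<xi> i \<omega> * (W (min t (\<tau> (Suc i))) f \<omega> - W (min t (\<tau> i)) f \<omega>))"
      unfolding st(3) using st(4,5)
      by (intro square_integrable_integrable[OF finite_measure_axioms] bounded_F_increment
          st(1,2) assms) auto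
    show "expectation (\<lambda>\<omega>. \<xi> i \<omega> * (W (min t (\<tau> (Suc i))) f \<omega> - W (min t (\<tau> i)) f \<omega>)) = 0"
      unfolding st(3) by (intro expectation_simple_term st assms)
  qed
  show ?thesis
    unfolding simple_integral_def by (subst Bochner_Integration.integral_sum) (use * in auto)
qed

text \<open>Expanding both sides over pairs of intervals gives the same number for each pair: kernel
  form times E(\<xi>_i \<eta>_j) times overlap length. Working with overlaps avoids a common
  refinement of the two partitions. Two directions and two end times are allowed because the double
  series mixes all Brownian motions and orthogonality of increments compares different
  times.\<close>

lemma simple_isometry:
  assumes X: "simple_process M F n \<tau> \<xi>" and Y: "simple_process M F m \<sigma> \<eta>"
    and t: "0 \<le> t" and s: "0 \<le> s" and f: "f \<in> L2 D" and g: "g \<in> L2 D"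
  shows "expectation (\<lambda>\<omega>. simple_integral (\<lambda>s. W s f) n \<tau> \<xi> t \<omega> * simple_integral (\<lambda>s. W s g) m
      \<sigma> \<eta> s \<omega>) =
    kernel_form D q f g * (LINT (r, \<omega>)|(lborel \<Otimes>\<^sub>M M).
      indicator {0..min t s} r * (simple_value n \<tau> \<xi> r \<omega> * simple_value m \<sigma> \<eta> r \<omega>))"
proof -
  define I where "I = (\<lambda>i \<omega>. \<xi> i \<omega> * (W (min t (\<tau> (Suc i))) f \<omega> - W (min t (\<tau> i)) f \<omega>))"
  define J where "J = (\<lambda>j \<omega>. \<eta> j \<omega> * (W (min s (\<sigma> (Suc j))) g \<omega> - W (min s (\<sigma> j)) g \<omega>))"
  define len where "len = (\<lambda>i j. max 0 (min (min t (\<tau> (Suc i))) (min s (\<sigma> (Suc j))) - max (min t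
      (\<tau> i)) (min s (\<sigma> j))))"
  have IJ: "integrable M (\<lambda>\<omega>. I i \<omega> * J j \<omega>)"
    "expectation (\<lambda>\<omega>. I i \<omega> * J j \<omega>) = kernel_form D q f g * (expectation (\<lambda>\<omega>. \<xi> i \<omega> * \<eta> j \<omega>) *
        len i j)"
    if i: "i < n" and j: "j < m" for i j
  proof -
    note a = stopped_coefficient[OF X i t]
    note b = stopped_coefficient[OF Y j s]
    show "integrable M (\<lambda>\<omega>. I i \<omega> * J j \<omega>)"
      unfolding I_def J_def a(3) b(3) using a(4,5) b(4,5) 
      by (intro square_integrable_mult bounded_F_increment a(1,2) b(1,2) f g) auto
    have "expectation (\<lambda>\<omega>. I i \<omega> * J j \<omega>) = kernel_form D q f g *
        (expectation (\<lambda>\<omega>. (if \<tau> i \<le> t then \<xi> i else (\<lambda>_. 0)) \<omega> * (if \<sigma> j \<le> s then \<eta> j else (\<lambda>_.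
            0)) \<omega>) * len i j)"
      unfolding I_def J_def a(3) b(3) len_def by (intro expectation_simple_product a b f g)
    \<comment> \<open>If an interval begins after its end time, its clipped version is empty; the
      zero coefficient used there may be replaced by the original one.\<close>
    moreover have "len i j = 0" if "\<not> \<tau> i \<le> t \<or> \<not> \<sigma> j \<le> s"
      using that a(5) b(5) by (auto simp: len_def)
    ultimately show "expectation (\<lambda>\<omega>. I i \<omega> * J j \<omega>) =
        kernel_form D q f g * (expectation (\<lambda>\<omega>. \<xi> i \<omega> * \<eta> j \<omega>) * len i j)"
      by (cases "\<tau> i \<le> t \<and> \<sigma> j \<le> s") auto
  qed
  define K where "K = (\<lambda>i j (r, \<omega>). (indicator {0..min t s} r * (indicator {\<tau> i<..\<tau> (Suc i)} r *
      indicator {\<sigma> j<..\<sigma> (Suc j)} r)) *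
      (\<xi> i \<omega> * \<eta> j \<omega>))"
  have K: "integrable (lborel \<Otimes>\<^sub>M M) (K i j)" "(LINT z|(lborel \<Otimes>\<^sub>M M). K i j z) = len i j *
      expectation (\<lambda>\<omega>. \<xi> i \<omega> * \<eta> j \<omega>)"
    if i: "i < n" and j: "j < m" for i j
  proof -
    have *: "0 \<le> \<tau> i" "\<tau> i \<le> \<tau> (Suc i)" "0 \<le> \<sigma> j" "\<sigma> j \<le> \<sigma> (Suc j)"
      using X Y i j simple_process_nonneg[OF X, of i] simple_process_nonneg[OF Y, of j]
      by (auto simp: simple_process_def)
    have \<xi>\<eta>: "integrable M (\<lambda>\<omega>. \<xi> i \<omega> * \<eta> j \<omega>)"
      using X Y i j by (intro square_integrable_mult simple_process_square)
    note e = integral_interval_product[OF * s t]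
    show "integrable (lborel \<Otimes>\<^sub>M M) (K i j)"
      unfolding K_def by (intro LM.integrable_pair_mult e \<xi>\<eta>)
    show "(LINT z|(lborel \<Otimes>\<^sub>M M). K i j z) = len i j * expectation (\<lambda>\<omega>. \<xi> i \<omega> * \<eta> j \<omega>)"
      unfolding K_def LM.integral_pair_mult[OF e(1) \<xi>\<eta>] e(2) len_def ..
  qed
  have "expectation (\<lambda>\<omega>. simple_integral (\<lambda>s. W s f) n \<tau> \<xi> t \<omega> * simple_integral (\<lambda>s. W s g) m \<sigma>
      \<eta> s \<omega>) =
      expectation (\<lambda>\<omega>. \<Sum>i<n. \<Sum>j<m. I i \<omega> * J j \<omega>)"
    by (simp add: simple_integral_def I_def J_def sum_product)
  also have "\<dots> = (\<Sum>i<n. \<Sum>j<m. expectation (\<lambda>\<omega>. I i \<omega> * J j \<omega>))"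
    by (subst Bochner_Integration.integral_sum)
       (auto intro!: Bochner_Integration.integrable_sum sum.cong
           Bochner_Integration.integral_sum IJ(1))
  also have "\<dots> = (\<Sum>i<n. \<Sum>j<m. kernel_form D q f g * (LINT z|(lborel \<Otimes>\<^sub>M M). K i j z))"
    by (intro sum.cong refl) (simp add: IJ K)
  also have "\<dots> = kernel_form D q f g * (\<Sum>i<n. \<Sum>j<m. (LINT z|(lborel \<Otimes>\<^sub>M M). K i j z))"
    by (simp add: sum_distrib_left)
  also have "(\<Sum>i<n. \<Sum>j<m. (LINT z|(lborel \<Otimes>\<^sub>M M). K i j z)) = (LINT z|(lborel \<Otimes>\<^sub>M M). (\<Sum>i<n.
      \<Sum>j<m. K i j z))"
    by (subst Bochner_Integration.integral_sum)
       (auto intro!: Bochner_Integration.integrable_sum sum.cong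
           Bochner_Integration.integral_sum[symmetric] K(1))
  also have "(\<lambda>z. \<Sum>i<n. \<Sum>j<m. K i j z) =
      (\<lambda>(r, \<omega>). indicator {0..min t s} r * (simple_value n \<tau> \<xi> r \<omega> * simple_value m \<sigma> \<eta> r \<omega>))"
    unfolding K_def simple_value_def sum_product case_prod_unfold unfolding sum_distrib_left
    by (intro ext sum.cong refl) (simp add: ac_simps)
  finally show ?thesis .
qed

lemma simple_value_square:
  assumes X: "simple_process M F n \<tau> \<xi>"
  shows "square_integrable (lborel \<Otimes>\<^sub>M M) (\<lambda>(r, \<omega>). indicator {0..t} r * simple_value n \<tau> \<xi> r \<omega>)"
proof -
  have "square_integrable (lborel \<Otimes>\<^sub>M M) (\<lambda>z. indicator {0..t} (fst z) * (\<xi> i (snd z) *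
      indicator {\<tau> i<..\<tau> (Suc i)} (fst z)))"
    if i: "i < n" for i
  proof (rule square_integrable_bound)
    have sq: "square_integrable M (\<xi> i)" by (rule simple_process_square[OF X i])
    have [measurable]: "\<xi> i \<in> borel_measurable M" using sq by (rule square_integrable_measurable)
    show "(\<lambda>z. indicator {0..t} (fst z) * (\<xi> i (snd z) * indicator {\<tau> i<..\<tau> (Suc i)} (fst z)))
        \<in> borel_measurable (lborel \<Otimes>\<^sub>M M)"
      by measurable
    have "integrable (lborel \<Otimes>\<^sub>M M) (\<lambda>(r, \<omega>). indicator {0..t} r * (\<xi> i \<omega>)\<^sup>2)"
      using sq by (intro LM.integrable_pair_mult integrable_interval) (simp add:
          square_integrable_def)
    then show "square_integrable (lborel \<Otimes>\<^sub>M M) (\<lambda>z. indicator {0..t} (fst z) * \<xi> i (snd z))"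
      by (simp add: square_integrable_def case_prod_unfold power_mult_distrib indicator_square)
    show "AE z in lborel \<Otimes>\<^sub>M M. \<bar>indicator {0..t} (fst z) * (\<xi> i (snd z) * indicator {\<tau> i<..\<tau>
        (Suc i)} (fst z))\<bar>
        \<le> \<bar>indicator {0..t} (fst z) * \<xi> i (snd z)\<bar>"
      by (auto simp: indicator_def)
  qed
  then have "square_integrable (lborel \<Otimes>\<^sub>M M)
      (\<lambda>z. \<Sum>i<n. indicator {0..t} (fst z) * (\<xi> i (snd z) * indicator {\<tau> i<..\<tau> (Suc i)} (fst z)))"
    by (intro square_integrable_sum) auto
  then show ?thesis
    unfolding simple_value_def sum_distrib_left case_prod_unfold .
qed

text \<open>Tonelli turns the iterated integral in the definition into a squared distance on the
  product of time and probability space, with the cut-off at t absorbed into both functions. The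
  limit lemmas for square integrable functions then apply to integrands as well as to
  integrals.\<close>

lemma ito_integral_approximation:
  assumes ito: "is_ito_integral M F (\<lambda>s. W s f) X t Y" and t: "0 \<le> t"
  obtains n \<tau> \<xi> where "\<forall>m::nat. simple_process M F (n m) (\<tau> m) (\<xi> m)"
    and "(\<lambda>m. \<integral>\<^sup>+z. ennreal (((\<lambda>(r, \<omega>). indicator {0..t} r * simple_value (n m) (\<tau> m) (\<xi> m) r \<omega>) z -
        (\<lambda>(r, \<omega>). indicator {0..t} r * X r \<omega>) z)\<^sup>2) \<partial>(lborel \<Otimes>\<^sub>M M)) \<longlonglongrightarrow> 0"
    and "Y \<in> borel_measurable M"
    and "(\<lambda>m. \<integral>\<^sup>+\<omega>. ennreal ((simple_integral (\<lambda>s. W s f) (n m) (\<tau> m) (\<xi> m) t \<omega> - Y \<omega>)\<^sup>2) \<partial>M) \<longlonglongrightarrow> 0"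
    and "(\<lambda>(r, \<omega>). indicator {0..t} r * X r \<omega>) \<in> borel_measurable (lborel \<Otimes>\<^sub>M M)"
proof -
  from ito obtain n \<tau> \<xi> where sp: "\<And>m. simple_process M F (n m) (\<tau> m) (\<xi> m)"
    and lim: "(\<lambda>m. \<integral>\<^sup>+\<omega>. (\<integral>\<^sup>+s\<in>{0..t}. ennreal ((simple_value (n m) (\<tau> m) (\<xi> m) s \<omega> - X s \<omega>)\<^sup>2)
        \<partial>lborel) \<partial>M) \<longlonglongrightarrow> 0"
    and ms: "mean_square_limit M (\<lambda>m. simple_integral (\<lambda>s. W s f) (n m) (\<tau> m) (\<xi> m) t) Y"
    and X: "progressively_measurable F X"
    by (auto simp: is_ito_integral_def)
  have Xm: "(\<lambda>(r, \<omega>). indicator {0..t} r * X r \<omega>) \<in> borel_measurable (lborel \<Otimes>\<^sub>M M)"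
    by (rule progressively_measurable_product[OF X subalgebra_F t])
  have "(\<integral>\<^sup>+\<omega>. (\<integral>\<^sup>+s\<in>{0..t}. ennreal ((simple_value (n m) (\<tau> m) (\<xi> m) s \<omega> - X s \<omega>)\<^sup>2) \<partial>lborel) \<partial>M) =
      (\<integral>\<^sup>+z. ennreal (((\<lambda>(r, \<omega>). indicator {0..t} r * simple_value (n m) (\<tau> m) (\<xi> m) r \<omega>) z -
        (\<lambda>(r, \<omega>). indicator {0..t} r * X r \<omega>) z)\<^sup>2) \<partial>(lborel \<Otimes>\<^sub>M M))" for m
  proof -
    have "(\<lambda>z. ennreal (((\<lambda>(r, \<omega>). indicator {0..t} r * simple_value (n m) (\<tau> m) (\<xi> m) r \<omega>) z -
        (\<lambda>(r, \<omega>). indicator {0..t} r * X r \<omega>) z)\<^sup>2)) \<in> borel_measurable (lborel \<Otimes>\<^sub>M M)"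
      using Xm square_integrable_measurable[OF simple_value_square[OF sp[of m], of t]] by measurable
    from LM.nn_integral_snd[OF this, symmetric] show ?thesis
      by (auto intro!: nn_integral_cong simp: indicator_def)
  qed
  with lim have lim': "(\<lambda>m. \<integral>\<^sup>+z. ennreal (((\<lambda>(r, \<omega>). indicator {0..t} r * simple_value (n m) (\<tau>
      m) (\<xi> m) r \<omega>) z -
        (\<lambda>(r, \<omega>). indicator {0..t} r * X r \<omega>) z)\<^sup>2) \<partial>(lborel \<Otimes>\<^sub>M M)) \<longlonglongrightarrow> 0"
    by simp
  show ?thesis
    by (rule that[OF _ lim' _ _ Xm]) (use sp ms in \<open>auto simp: mean_square_limit_def\<close>)
qed

lemma ito_integral_square:
  assumes ito: "is_ito_integral M F (\<lambda>s. W s f) X t Y" and t: "0 \<le> t" and f: "f \<in> L2 D"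
  shows "square_integrable M Y" and "expectation Y = 0"
proof -
  from ito t show "square_integrable M Y"
  proof (rule ito_integral_approximation)
    fix n \<tau> \<xi>
    assume "\<forall>m::nat. simple_process M F (n m) (\<tau> m) (\<xi> m)"
    note sp = spec[OF this]
    assume "Y \<in> borel_measurable M"
      "(\<lambda>m. \<integral>\<^sup>+\<omega>. ennreal ((simple_integral (\<lambda>s. W s f) (n m) (\<tau> m) (\<xi> m) t \<omega> - Y \<omega>)\<^sup>2) \<partial>M) \<longlonglongrightarrow> 0"
    then show "square_integrable M Y"
      by (rule square_integrable_L2_limit(1)[OF simple_integral_square[OF sp t f]])
  qed
  from ito t show "expectation Y = 0"
  proof (rule ito_integral_approximation)
    fix n \<tau> \<xi>
    assume sp0: "\<forall>m::nat. simple_process M F (n m) (\<tau> m) (\<xi> m)"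
      and Y: "Y \<in> borel_measurable M"
      and lim: "(\<lambda>m. \<integral>\<^sup>+\<omega>. ennreal ((simple_integral (\<lambda>s. W s f) (n m) (\<tau> m) (\<xi> m) t \<omega> - Y \<omega>)\<^sup>2)
          \<partial>M) \<longlonglongrightarrow> 0"
    note sp = spec[OF sp0]
    \<comment> \<open>Pairing with the constant 1 makes convergence of means a case of convergence
      of inner products.\<close>
    have "(\<lambda>m. expectation (\<lambda>\<omega>. simple_integral (\<lambda>s. W s f) (n m) (\<tau> m) (\<xi> m) t \<omega> * 1)) \<longlonglongrightarrow>
        expectation (\<lambda>\<omega>. Y \<omega> * 1)"
      by (rule tendsto_integral_mult_L2_nn[OF simple_integral_square[OF sp t f] Y
            square_integrable_const[OF finite_measure_axioms] _ lim]) auto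
    then show "expectation Y = 0"
      by (simp add: simple_integral_mean[OF sp t f] LIMSEQ_const_iff)
  qed
qed

text \<open>Both sides are inner products, one over the probability space and one over the product
  with time, and both pass to the limit along simple processes. The approximations of the two
  integrals are chosen independently of each other.\<close>

lemma ito_isometry:
  assumes X: "is_ito_integral M F (\<lambda>s. W s f) X t Y" and X': "is_ito_integral M F (\<lambda>s. W s g) X'
      s Y'"
    and t: "0 \<le> t" and s: "0 \<le> s" and f: "f \<in> L2 D" and g: "g \<in> L2 D"
  shows "expectation (\<lambda>\<omega>. Y \<omega> * Y' \<omega>) = kernel_form D q f g *
    (LINT (r, \<omega>)|(lborel \<Otimes>\<^sub>M M). indicator {0..min t s} r * (X r \<omega> * X' r \<omega>))"
proof -
  obtain n \<tau> \<xi> where sp: "\<forall>m::nat. simple_process M F (n m) (\<tau> m) (\<xi> m)"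
    and lim: "(\<lambda>m. \<integral>\<^sup>+z. ennreal (((\<lambda>(r, \<omega>). indicator {0..t} r * simple_value (n m) (\<tau> m) (\<xi> m)
        r \<omega>) z -
        (\<lambda>(r, \<omega>). indicator {0..t} r * X r \<omega>) z)\<^sup>2) \<partial>(lborel \<Otimes>\<^sub>M M)) \<longlonglongrightarrow> 0"
    and Y: "Y \<in> borel_measurable M"
    and limY: "(\<lambda>m. \<integral>\<^sup>+\<omega>. ennreal ((simple_integral (\<lambda>s. W s f) (n m) (\<tau> m) (\<xi> m) t \<omega> - Y \<omega>)\<^sup>2)
        \<partial>M) \<longlonglongrightarrow> 0"
    and Xm: "(\<lambda>(r, \<omega>). indicator {0..t} r * X r \<omega>) \<in> borel_measurable (lborel \<Otimes>\<^sub>M M)"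
    by (rule ito_integral_approximation[OF X t]) (rule that)
  obtain n' \<tau>' \<xi>' where sp': "\<forall>m. simple_process M F (n' m) (\<tau>' m) (\<xi>' m)"
    and lim': "(\<lambda>m. \<integral>\<^sup>+z. ennreal (((\<lambda>(r, \<omega>). indicator {0..s} r * simple_value (n' m) (\<tau>' m)
        (\<xi>' m) r \<omega>) z -
        (\<lambda>(r, \<omega>). indicator {0..s} r * X' r \<omega>) z)\<^sup>2) \<partial>(lborel \<Otimes>\<^sub>M M)) \<longlonglongrightarrow> 0"
    and Y': "Y' \<in> borel_measurable M"
    and limY': "(\<lambda>m. \<integral>\<^sup>+\<omega>. ennreal ((simple_integral (\<lambda>s. W s g) (n' m) (\<tau>' m) (\<xi>' m) s \<omega> - Y'
        \<omega>)\<^sup>2) \<partial>M) \<longlonglongrightarrow> 0"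
    and Xm': "(\<lambda>(r, \<omega>). indicator {0..s} r * X' r \<omega>) \<in> borel_measurable (lborel \<Otimes>\<^sub>M M)"
    by (rule ito_integral_approximation[OF X' s]) (rule that)
  note sp = spec[OF sp] and sp' = spec[OF sp']
  let ?I = "\<lambda>m. expectation (\<lambda>\<omega>. simple_integral (\<lambda>s. W s f) (n m) (\<tau> m) (\<xi> m) t \<omega> *
      simple_integral (\<lambda>s. W s g) (n' m) (\<tau>' m) (\<xi>' m) s \<omega>)"
  \<comment> \<open>The cut-off at the earlier time is the product of both cut-offs, so each
    integrand keeps its own time interval in the limit.\<close>
  have ind: "indicator {0..min t s} r * (a * b) = indicator {0..t} r * a * (indicator {0..s} r *
      b)" for r a b :: real
    by (auto simp: indicator_def)
  have "?I \<longlonglongrightarrow> expectation (\<lambda>\<omega>. Y \<omega> * Y' \<omega>)"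
    by (rule tendsto_integral_mult_L2_nn[OF simple_integral_square[OF sp t f] Y
        simple_integral_square[OF sp' s g] Y' limY limY'])
  moreover have "?I \<longlonglongrightarrow> kernel_form D q f g *
      (LINT (r, \<omega>)|(lborel \<Otimes>\<^sub>M M). indicator {0..min t s} r * (X r \<omega> * X' r \<omega>))"
    using tendsto_mult_left[OF tendsto_integral_mult_L2_nn[OF simple_value_square[OF sp] Xm
        simple_value_square[OF sp'] Xm' lim lim'],
        of "kernel_form D q f g"]
    unfolding simple_isometry[OF sp sp' t s f g] ind by (simp add: case_prod_unfold)
  ultimately show ?thesis by (rule LIMSEQ_unique)
qed

end

section \<open>Orthonormal bases of $L^2(D)$\<close>

lemma null_sequence_bound:
  fixes f g :: "nat \<Rightarrow> real"
  assumes "\<And>n. 0 \<le> f n" "\<And>n. f n \<le> g n" "g \<longlonglongrightarrow> 0"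
  shows "f \<longlonglongrightarrow> 0"
  by (rule tendsto_sandwich[OF _ _ tendsto_const assms(3)]) (use assms in auto)

lemma L2_inner_commute: "L2_inner D f g = L2_inner D g f"
  by (simp add: L2_inner_def mult.commute)

lemma L2_inner_square: "L2_inner D f f = (LINT x|dom_measure D. (f x)\<^sup>2)"
  by (simp add: L2_inner_def power2_eq_square)

lemma L2_inner_nonneg: "0 \<le> L2_inner D f f"
  by (simp add: L2_inner_square)

lemma L2_norm_square: "(L2_norm D f)\<^sup>2 = L2_inner D f f"
  by (simp add: L2_norm_def L2_inner_nonneg)

lemma L2_integrable_mult: "f \<in> L2 D \<Longrightarrow> g \<in> L2 D \<Longrightarrow> integrable (dom_measure D) (\<lambda>x. f x * g x)"
  by (simp add: L2_iff square_integrable_mult)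

lemma L2_sum: "(\<And>i. i \<in> I \<Longrightarrow> f i \<in> L2 D) \<Longrightarrow> (\<lambda>x. \<Sum>i\<in>I. c i * f i x) \<in> L2 D"
  unfolding L2_iff by (intro square_integrable_sum square_integrable_cmult)

lemma L2_diff: "f \<in> L2 D \<Longrightarrow> g \<in> L2 D \<Longrightarrow> (\<lambda>x. f x - g x) \<in> L2 D"
  unfolding L2_iff by (rule square_integrable_diff)

lemma L2_inner_diff_left:
  "f \<in> L2 D \<Longrightarrow> g \<in> L2 D \<Longrightarrow> h \<in> L2 D \<Longrightarrow> L2_inner D (\<lambda>x. f x - g x) h = L2_inner D f h - L2_inner D g h"
  by (simp add: L2_inner_def left_diff_distrib L2_integrable_mult)

lemma L2_inner_sum_left:
  assumes "\<And>i. i \<in> I \<Longrightarrow> f i \<in> L2 D" "g \<in> L2 D"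
  shows "L2_inner D (\<lambda>x. \<Sum>i\<in>I. c i * f i x) g = (\<Sum>i\<in>I. c i * L2_inner D (f i) g)"
proof -
  have "L2_inner D (\<lambda>x. \<Sum>i\<in>I. c i * f i x) g = (LINT x|dom_measure D. (\<Sum>i\<in>I. c i * (f i x * g x)))"
    by (simp add: L2_inner_def sum_distrib_right mult.assoc)
  also have "\<dots> = (\<Sum>i\<in>I. (LINT x|dom_measure D. c i * (f i x * g x)))"
    using assms by (intro Bochner_Integration.integral_sum integrable_mult_right L2_integrable_mult)
  finally show ?thesis by (simp add: L2_inner_def)
qed

text \<open>Boundedness of each basis function makes multiplication by it a bounded operator on L2;
  finiteness of the measure makes L2 convergence imply L1 convergence.\<close>

locale L2_basis =
  fixes D :: "'a::euclidean_space set" and e :: "nat \<Rightarrow> 'a \<Rightarrow> real"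
  assumes finite_D: "finite_measure (dom_measure D)"
    and basis: "L2_orthonormal_basis D e"
    and e_bounded: "\<exists>B. \<forall>x\<in>D. \<bar>e k x\<bar> \<le> B"
begin

sublocale dom: finite_measure "dom_measure D" by (rule finite_D)

lemma space_dom: "space (dom_measure D) = D"
  by (simp add: space_restrict_space)

lemma e_L2 [intro, simp]: "e k \<in> L2 D"
  using basis by (simp add: L2_orthonormal_basis_def)

lemma e_orthonormal: "L2_inner D (e i) (e j) = (if i = j then 1 else 0)"
  using basis by (simp add: L2_orthonormal_basis_def)

definition proj :: "nat \<Rightarrow> ('a \<Rightarrow> real) \<Rightarrow> 'a \<Rightarrow> real" where
  "proj n f x = (\<Sum>k<n. L2_inner D f (e k) * e k x)"

lemma proj_L2 [intro, simp]: "proj n f \<in> L2 D"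
  unfolding proj_def by (intro L2_sum e_L2)

lemma inner_proj: "g \<in> L2 D \<Longrightarrow> L2_inner D (proj n f) g = (\<Sum>k<n. L2_inner D f (e k) * L2_inner D
    (e k) g)"
  unfolding proj_def by (intro L2_inner_sum_left e_L2)

lemma proj_norm: "L2_inner D (proj n f) (proj n f) = (\<Sum>k<n. (L2_inner D f (e k))\<^sup>2)"
proof -
  have "L2_inner D (e k) (proj n f) = L2_inner D f (e k)" if "k < n" for k
  proof -
    have "L2_inner D (proj n f) (e k) = (\<Sum>j<n. if j = k then L2_inner D f (e k) else 0)"
      unfolding inner_proj[OF e_L2] by (rule sum.cong) (auto simp: e_orthonormal)
    also have "\<dots> = L2_inner D f (e k)" using that by simp
    finally show ?thesis by (simp add: L2_inner_commute)
  qed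
  then show ?thesis
    by (simp add: inner_proj power2_eq_square)
qed

lemma residual_norm:
  assumes f: "f \<in> L2 D"
  shows "L2_inner D (\<lambda>x. f x - proj n f x) (\<lambda>x. f x - proj n f x) =
    L2_inner D f f - (\<Sum>k<n. (L2_inner D f (e k))\<^sup>2)"
proof -
  have r: "(\<lambda>x. f x - proj n f x) \<in> L2 D" by (intro L2_diff f proj_L2)
  let ?S = "\<Sum>k<n. (L2_inner D f (e k))\<^sup>2"
  let ?r = "\<lambda>x. f x - proj n f x"
  have pf: "L2_inner D (proj n f) f = ?S"
    by (simp add: inner_proj f power2_eq_square L2_inner_commute[of D "e _" f])
  have "L2_inner D f ?r = L2_inner D f f - ?S"
    using L2_inner_diff_left[OF f proj_L2 f, of n f] pf by (simp add: L2_inner_commute[of D f ?r])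
  moreover have "L2_inner D (proj n f) ?r = 0"
    using L2_inner_diff_left[OF f proj_L2 proj_L2, of n f n f] pf proj_norm[of n f]
    by (simp add: L2_inner_commute[of D "proj n f" ?r] L2_inner_commute[of D f "proj n f"])
  ultimately show ?thesis
    using L2_inner_diff_left[OF f proj_L2 r, of n f] by simp
qed

lemma bessel: "f \<in> L2 D \<Longrightarrow> (\<Sum>k<n. (L2_inner D f (e k))\<^sup>2) \<le> L2_inner D f f"
  using residual_norm[of f n] L2_inner_nonneg[of D "\<lambda>x. f x - proj n f x"] by simp

lemma residual_tendsto:
  assumes f: "f \<in> L2 D"
  shows "(\<lambda>n. L2_inner D (\<lambda>x. f x - proj n f x) (\<lambda>x. f x - proj n f x)) \<longlonglongrightarrow> 0"
proof -
  have "(\<lambda>n. L2_norm D (\<lambda>x. f x - proj n f x)) \<longlonglongrightarrow> 0"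
    using basis f by (simp add: L2_orthonormal_basis_def proj_def)
  from tendsto_power[OF this, of 2] show ?thesis
    by (simp add: L2_norm_square)
qed

lemma parseval:
  assumes f: "f \<in> L2 D"
  shows "(\<lambda>n. \<Sum>k<n. (L2_inner D f (e k))\<^sup>2) \<longlonglongrightarrow> L2_inner D f f"
  using tendsto_diff[OF tendsto_const[of "L2_inner D f f"] residual_tendsto[OF f]]
  by (simp add: residual_norm[OF f])

lemma e_mult_L2:
  assumes f: "f \<in> L2 D"
  shows "(\<lambda>x. e k x * f x) \<in> L2 D"
proof -
  obtain B where B: "\<And>x. x \<in> D \<Longrightarrow> \<bar>e k x\<bar> \<le> B" using e_bounded[of k] by blast
  show ?thesis
    using f e_L2[of k] unfolding L2_iff
    by (intro square_integrable_bounded_mult[where B=B]) (auto simp: space_dom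
        square_integrable_def B)
qed

lemma e_mult_norm_le:
  assumes B: "\<And>x. x \<in> D \<Longrightarrow> \<bar>e k x\<bar> \<le> B" and f: "f \<in> L2 D"
  shows "L2_inner D (\<lambda>x. e k x * f x) (\<lambda>x. e k x * f x) \<le> B\<^sup>2 * L2_inner D f f"
proof -
  have "L2_inner D (\<lambda>x. e k x * f x) (\<lambda>x. e k x * f x) = (LINT x|dom_measure D. (e k x * f x)\<^sup>2)"
    by (simp add: L2_inner_square)
  also have "\<dots> \<le> (LINT x|dom_measure D. B\<^sup>2 * (f x)\<^sup>2)"
  proof (rule integral_mono)
    show "integrable (dom_measure D) (\<lambda>x. (e k x * f x)\<^sup>2)" "integrable (dom_measure D) (\<lambda>x. B\<^sup>2
        * (f x)\<^sup>2)"
      using f e_mult_L2[OF f, of k] by (auto simp: L2_def)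
    fix x assume "x \<in> space (dom_measure D)"
    then have "\<bar>e k x\<bar> \<le> B" by (intro B) (simp add: space_dom)
    then have "(e k x)\<^sup>2 \<le> B\<^sup>2"
      by (metis abs_ge_zero power2_abs power_mono)
    then show "(e k x * f x)\<^sup>2 \<le> B\<^sup>2 * (f x)\<^sup>2"
      by (simp add: power_mult_distrib mult_right_mono)
  qed
  finally show ?thesis by (simp add: L2_inner_square)
qed

lemma L1_le_L2:
  assumes "f \<in> L2 D"
  shows "(LINT x|dom_measure D. \<bar>f x\<bar>)\<^sup>2 \<le> measure (dom_measure D) D * L2_inner D f f"
  using integral_Cauchy_Schwarz_const[OF finite_D] assms by (simp add: L2_iff L2_inner_square
      space_dom)

lemma L2_integrable: "f \<in> L2 D \<Longrightarrow> integrable (dom_measure D) f"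
  unfolding L2_iff by (rule square_integrable_integrable[OF finite_D])

lemma L1_tendsto:
  assumes f: "\<And>n::nat. f n \<in> L2 D" and lim: "(\<lambda>n. L2_inner D (f n) (f n)) \<longlonglongrightarrow> 0"
  shows "(\<lambda>n. LINT x|dom_measure D. \<bar>f n x\<bar>) \<longlonglongrightarrow> 0"
proof -
  have "(\<lambda>n. measure (dom_measure D) D * L2_inner D (f n) (f n)) \<longlonglongrightarrow> 0"
    using tendsto_mult_left[OF lim, of "measure (dom_measure D) D"] by simp
  then have "(\<lambda>n. (LINT x|dom_measure D. \<bar>f n x\<bar>)\<^sup>2) \<longlonglongrightarrow> 0"
    by (rule null_sequence_bound[rotated 2]) (auto intro!: L1_le_L2 f)
  from tendsto_real_sqrt[OF this] show ?thesis
    by simp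
qed

text \<open>The coefficient of \<open>dB_j\<close> in the \<open>k\<close>-th equation is the \<open>j\<close>-th coordinate of \<open>e_k u\<close>;
  this is its truncation to \<open>N\<close> modes.\<close>

definition multiplier :: "nat \<Rightarrow> nat \<Rightarrow> ('a \<Rightarrow> real) \<Rightarrow> 'a \<Rightarrow> real" where
  "multiplier k N f = proj N (\<lambda>x. e k x * proj N f x)"

lemma multiplier_L2 [intro, simp]: "multiplier k N f \<in> L2 D"
  by (simp add: multiplier_def)

text \<open>Identifies the square partial sums in the definition of a solution with the operator:
  project to N modes, multiply by \<open>e k\<close>, project again.\<close>

lemma multiplier_eq:
  "multiplier k N f x = (\<Sum>j<N. (\<Sum>i<N. triple_coeff D e j k i * L2_inner D f (e i)) * e j x)"
proof -
  have "L2_inner D (\<lambda>x. e k x * proj N f x) (e j) = (\<Sum>i<N. triple_coeff D e j k i * L2_inner D f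
      (e i))" for j
  proof -
    have "L2_inner D (\<lambda>x. e k x * proj N f x) (e j) =
        L2_inner D (\<lambda>x. \<Sum>i<N. L2_inner D f (e i) * (e k x * e i x)) (e j)"
      by (simp add: proj_def sum_distrib_left ac_simps)
    also have "\<dots> = (\<Sum>i<N. L2_inner D f (e i) * L2_inner D (\<lambda>x. e k x * e i x) (e j))"
      by (intro L2_inner_sum_left e_mult_L2 e_L2)
    also have "\<dots> = (\<Sum>i<N. triple_coeff D e j k i * L2_inner D f (e i))"
      by (simp add: L2_inner_def triple_coeff_def ac_simps)
    finally show ?thesis .
  qed
  then show ?thesis by (simp add: multiplier_def proj_def)
qed

lemma multiplier_norm_le:
  assumes B: "\<And>x. x \<in> D \<Longrightarrow> \<bar>e k x\<bar> \<le> B" and f: "f \<in> L2 D"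
  shows "L2_inner D (multiplier k N f) (multiplier k N f) \<le> B\<^sup>2 * L2_inner D f f"
proof -
  have "L2_inner D (multiplier k N f) (multiplier k N f) \<le>
      L2_inner D (\<lambda>x. e k x * proj N f x) (\<lambda>x. e k x * proj N f x)"
    unfolding multiplier_def proj_norm by (intro bessel e_mult_L2 proj_L2)
  also have "\<dots> \<le> B\<^sup>2 * L2_inner D (proj N f) (proj N f)"
    by (intro e_mult_norm_le B proj_L2)
  also have "\<dots> \<le> B\<^sup>2 * L2_inner D f f"
    unfolding proj_norm by (intro mult_left_mono bessel f) auto
  finally show ?thesis .
qed

text \<open>The error splits into \<open>h1\<close>, the projected image of f - proj N f, and
  \<open>h2\<close>, the residual of \<open>e k\<close> f itself; both tend to 0 in L2. The
  conclusion is stated in L1 because that is the topology in which the kernel form is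
  continuous.\<close>

lemma multiplier_tendsto:
  assumes f: "f \<in> L2 D"
  shows "(\<lambda>N. LINT x|dom_measure D. \<bar>multiplier k N f x - e k x * f x\<bar>) \<longlonglongrightarrow> 0"
proof -
  obtain B where B: "\<And>x. x \<in> D \<Longrightarrow> \<bar>e k x\<bar> \<le> B" using e_bounded[of k] by blast
  define h1 where "h1 = (\<lambda>N. proj N (\<lambda>x. e k x * (f x - proj N f x)))"
  define h2 where "h2 = (\<lambda>N x. e k x * f x - proj N (\<lambda>x. e k x * f x) x)"
  have r: "(\<lambda>x. f x - proj N f x) \<in> L2 D" for N by (intro L2_diff f proj_L2)
  have h: "h1 N \<in> L2 D" "h2 N \<in> L2 D" for N
    unfolding h1_def h2_def by (auto intro!: L2_diff e_mult_L2 f)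
  have "(\<lambda>N. LINT x|dom_measure D. \<bar>h1 N x\<bar>) \<longlonglongrightarrow> 0"
  proof (rule L1_tendsto[OF h(1)])
    have "(\<lambda>N. B\<^sup>2 * L2_inner D (\<lambda>x. f x - proj N f x) (\<lambda>x. f x - proj N f x)) \<longlonglongrightarrow> 0"
      using tendsto_mult_left[OF residual_tendsto[OF f], of "B\<^sup>2"] by simp
    moreover have "L2_inner D (h1 N) (h1 N) \<le> B\<^sup>2 * L2_inner D (\<lambda>x. f x - proj N f x) (\<lambda>x. f x -
        proj N f x)" for N
      unfolding h1_def proj_norm
      by (rule order_trans[OF bessel[OF e_mult_L2[OF r]] e_mult_norm_le[OF B r]])
    ultimately show "(\<lambda>N. L2_inner D (h1 N) (h1 N)) \<longlonglongrightarrow> 0"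
      by (intro null_sequence_bound[OF L2_inner_nonneg])
  qed
  moreover have "(\<lambda>N. LINT x|dom_measure D. \<bar>h2 N x\<bar>) \<longlonglongrightarrow> 0"
    by (rule L1_tendsto[OF h(2)]) (unfold h2_def, rule residual_tendsto[OF e_mult_L2[OF f]])
  ultimately have "(\<lambda>N. (LINT x|dom_measure D. \<bar>h1 N x\<bar>) + (LINT x|dom_measure D. \<bar>h2 N x\<bar>)) \<longlonglongrightarrow> 0"
    by (rule tendsto_add_zero)
  moreover have "(LINT x|dom_measure D. \<bar>multiplier k N f x - e k x * f x\<bar>) \<le>
      (LINT x|dom_measure D. \<bar>h1 N x\<bar>) + (LINT x|dom_measure D. \<bar>h2 N x\<bar>)" for N
  proof -
    have "multiplier k N f x - e k x * f x = - h1 N x - h2 N x" for x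
    proof -
      have "L2_inner D (\<lambda>x. e k x * (f x - proj N f x)) (e j) =
          L2_inner D (\<lambda>x. e k x * f x) (e j) - L2_inner D (\<lambda>x. e k x * proj N f x) (e j)" for j
        unfolding right_diff_distrib by (intro L2_inner_diff_left e_mult_L2 f proj_L2 e_L2)
      then have "h1 N x = proj N (\<lambda>x. e k x * f x) x - multiplier k N f x"
        by (simp add: h1_def proj_def multiplier_def left_diff_distrib sum_subtractf)
      then show ?thesis by (simp add: h2_def)
    qed
    then have "(LINT x|dom_measure D. \<bar>multiplier k N f x - e k x * f x\<bar>) = (LINT x|dom_measure
        D. \<bar>- h1 N x - h2 N x\<bar>)"
      by simp
    also have "\<dots> \<le> (LINT x|dom_measure D. \<bar>h1 N x\<bar> + \<bar>h2 N x\<bar>)"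
      using h[of N, THEN L2_integrable] by (intro integral_mono) auto
    also have "\<dots> = (LINT x|dom_measure D. \<bar>h1 N x\<bar>) + (LINT x|dom_measure D. \<bar>h2 N x\<bar>)"
      using h[of N, THEN L2_integrable] by simp
    finally show ?thesis .
  qed
  ultimately show ?thesis
    by (intro null_sequence_bound[of "\<lambda>N. LINT x|dom_measure D. \<bar>multiplier k N f x - e k x * f
        x\<bar>"]) auto
qed

end

section \<open>The trace inequality\<close>

locale bounded_white_noise = white_noise M F D q W + L2_basis D e
  for M :: "'w measure" and F :: "real \<Rightarrow> 'w measure" and D :: "'a::euclidean_space set"
    and q :: "'a \<Rightarrow> 'a \<Rightarrow> real" and W :: "real \<Rightarrow> ('a \<Rightarrow> real) \<Rightarrow> 'w \<Rightarrow> real"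
    and e :: "nat \<Rightarrow> 'a \<Rightarrow> real" +
  fixes \<kappa> :: real
  assumes q_measurable [measurable]: "(\<lambda>(x, y). q x y) \<in> borel_measurable (dom_measure D \<Otimes>\<^sub>M
      dom_measure D)"
    and q_bound: "\<And>x y. x \<in> D \<Longrightarrow> y \<in> D \<Longrightarrow> \<bar>q x y\<bar> \<le> \<kappa>"
    and \<kappa>_nonneg: "0 \<le> \<kappa>"
begin

abbreviation dm :: "'a measure" where "dm \<equiv> dom_measure D"

abbreviation Q :: "('a \<Rightarrow> real) \<Rightarrow> ('a \<Rightarrow> real) \<Rightarrow> real" where "Q \<equiv> kernel_form D q"

sublocale DD: pair_sigma_finite dm dm ..

lemma Q_integrable:
  assumes f: "integrable dm f" and g: "integrable dm g"
  shows "integrable (dm \<Otimes>\<^sub>M dm) (\<lambda>(x, y). q x y * f x * g y)"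
proof (rule Bochner_Integration.integrable_bound)
  have [measurable]: "f \<in> borel_measurable dm" "g \<in> borel_measurable dm" using f g by auto
  show "integrable (dm \<Otimes>\<^sub>M dm) (\<lambda>z. \<kappa> * (\<lambda>(x, y). \<bar>f x\<bar> * \<bar>g y\<bar>) z)"
    using f g by (intro integrable_mult_right DD.integrable_pair_mult) auto
  show "(\<lambda>(x, y). q x y * f x * g y) \<in> borel_measurable (dm \<Otimes>\<^sub>M dm)"
    by measurable
  show "AE z in dm \<Otimes>\<^sub>M dm. norm (case z of (x, y) \<Rightarrow> q x y * f x * g y) \<le> norm (\<kappa> * (\<lambda>(x, y). \<bar>f
      x\<bar> * \<bar>g y\<bar>) z)"
  proof (rule AE_I2)
    fix z assume "z \<in> space (dm \<Otimes>\<^sub>M dm)"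
    then have "\<bar>q (fst z) (snd z)\<bar> \<le> \<kappa>"
      by (intro q_bound) (auto simp: space_pair_measure space_dom)
    then have "\<bar>q (fst z) (snd z)\<bar> * (\<bar>f (fst z)\<bar> * \<bar>g (snd z)\<bar>) \<le> \<kappa> * (\<bar>f (fst z)\<bar> * \<bar>g (snd z)\<bar>)"
      by (rule mult_right_mono) simp
    then show "norm (case z of (x, y) \<Rightarrow> q x y * f x * g y) \<le> norm (\<kappa> * (\<lambda>(x, y). \<bar>f x\<bar> * \<bar>g y\<bar>) z)"
      using \<kappa>_nonneg by (simp add: case_prod_unfold abs_mult mult.assoc)
  qed
qed

text \<open>The L1 norms matter twice: on a small cell they yield a factor equal to the measure of
  the cell, and they give continuity of the form under L1 convergence.\<close>

lemma Q_bound: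
  assumes f: "integrable dm f" and g: "integrable dm g"
  shows "\<bar>Q f g\<bar> \<le> \<kappa> * ((LINT x|dm. \<bar>f x\<bar>) * (LINT x|dm. \<bar>g x\<bar>))"
proof -
  have "\<bar>Q f g\<bar> \<le> (LINT z|(dm \<Otimes>\<^sub>M dm). \<bar>(\<lambda>(x, y). q x y * f x * g y) z\<bar>)"
    unfolding kernel_form_def by (rule integral_abs_bound)
  also have "\<dots> \<le> (LINT z|(dm \<Otimes>\<^sub>M dm). \<kappa> * (\<lambda>(x, y). \<bar>f x\<bar> * \<bar>g y\<bar>) z)"
  proof (rule integral_mono)
    show "integrable (dm \<Otimes>\<^sub>M dm) (\<lambda>z. \<bar>(\<lambda>(x, y). q x y * f x * g y) z\<bar>)"
      using Q_integrable[OF f g] by (rule integrable_abs)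
    show "integrable (dm \<Otimes>\<^sub>M dm) (\<lambda>z. \<kappa> * (\<lambda>(x, y). \<bar>f x\<bar> * \<bar>g y\<bar>) z)"
      using f g by (intro integrable_mult_right DD.integrable_pair_mult) auto
    fix z assume "z \<in> space (dm \<Otimes>\<^sub>M dm)"
    then have "\<bar>q (fst z) (snd z)\<bar> \<le> \<kappa>"
      by (intro q_bound) (auto simp: space_pair_measure space_dom)
    then have "\<bar>q (fst z) (snd z)\<bar> * (\<bar>f (fst z)\<bar> * \<bar>g (snd z)\<bar>) \<le> \<kappa> * (\<bar>f (fst z)\<bar> * \<bar>g (snd z)\<bar>)"
      by (rule mult_right_mono) simp
    then show "\<bar>(\<lambda>(x, y). q x y * f x * g y) z\<bar> \<le> \<kappa> * (\<lambda>(x, y). \<bar>f x\<bar> * \<bar>g y\<bar>) z"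
      by (simp add: case_prod_unfold abs_mult mult.assoc)
  qed
  also have "\<dots> = \<kappa> * ((LINT x|dm. \<bar>f x\<bar>) * (LINT x|dm. \<bar>g x\<bar>))"
    using f g by (subst integral_mult_right_zero, subst DD.integral_pair_mult) auto
  finally show ?thesis .
qed

lemma Q_diff_left:
  assumes "integrable dm f" "integrable dm g" "integrable dm h"
  shows "Q (\<lambda>x. f x - g x) h = Q f h - Q g h"
proof -
  have "Q (\<lambda>x. f x - g x) h = (LINT z|(dm \<Otimes>\<^sub>M dm). (\<lambda>(x, y). q x y * f x * h y) z - (\<lambda>(x, y). q
      x y * g x * h y) z)"
    unfolding kernel_form_def by (rule Bochner_Integration.integral_cong) (auto simp: algebra_simps)
  also have "\<dots> = Q f h - Q g h"
    unfolding kernel_form_def using assms by (intro Bochner_Integration.integral_diff Q_integrable)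
  finally show ?thesis .
qed

lemma Q_diff_right:
  assumes "integrable dm f" "integrable dm g" "integrable dm h"
  shows "Q h (\<lambda>x. f x - g x) = Q h f - Q h g"
proof -
  have "Q h (\<lambda>x. f x - g x) = (LINT z|(dm \<Otimes>\<^sub>M dm). (\<lambda>(x, y). q x y * h x * f y) z - (\<lambda>(x, y). q
      x y * h x * g y) z)"
    unfolding kernel_form_def by (rule Bochner_Integration.integral_cong) (auto simp: algebra_simps)
  also have "\<dots> = Q h f - Q h g"
    unfolding kernel_form_def using assms by (intro Bochner_Integration.integral_diff Q_integrable)
  finally show ?thesis .
qed

lemma Q_sum:
  assumes f: "\<And>a. a \<in> A \<Longrightarrow> integrable dm (f a)"
  shows "Q (\<lambda>x. \<Sum>a\<in>A. c a * f a x) (\<lambda>x. \<Sum>a\<in>A. c a * f a x) = (\<Sum>a\<in>A. \<Sum>b\<in>A. c a * c b * Q (f a) (f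
      b))"
proof -
  have i: "integrable (dm \<Otimes>\<^sub>M dm) (\<lambda>z. c a * c b * (\<lambda>(x, y). q x y * f a x * f b y) z)" if "a \<in>
      A" "b \<in> A" for a b
    using that f by (intro integrable_mult_right Q_integrable)
  have "Q (\<lambda>x. \<Sum>a\<in>A. c a * f a x) (\<lambda>x. \<Sum>a\<in>A. c a * f a x) =
      (LINT z|(dm \<Otimes>\<^sub>M dm). (\<Sum>a\<in>A. \<Sum>b\<in>A. c a * c b * (\<lambda>(x, y). q x y * f a x * f b y) z))"
    unfolding kernel_form_def
  proof (rule Bochner_Integration.integral_cong[OF refl])
    fix z :: "'a \<times> 'a"
    show "(case z of (x, y) \<Rightarrow> q x y * (\<Sum>a\<in>A. c a * f a x) * (\<Sum>a\<in>A. c a * f a y)) =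
        (\<Sum>a\<in>A. \<Sum>b\<in>A. c a * c b * (\<lambda>(x, y). q x y * f a x * f b y) z)"
      unfolding case_prod_unfold mult.assoc[of "q _ _"] sum_product
      unfolding sum_distrib_left by (intro sum.cong refl) (simp add: ac_simps)
  qed
  also have "\<dots> = (\<Sum>a\<in>A. (LINT z|(dm \<Otimes>\<^sub>M dm). (\<Sum>b\<in>A. c a * c b * (\<lambda>(x, y). q x y * f a x * f b y)
      z)))"
    by (intro Bochner_Integration.integral_sum Bochner_Integration.integrable_sum i)
  also have "\<dots> = (\<Sum>a\<in>A. \<Sum>b\<in>A. (LINT z|(dm \<Otimes>\<^sub>M dm). c a * c b * (\<lambda>(x, y). q x y * f a x * f b y) z))"
    by (intro sum.cong refl Bochner_Integration.integral_sum i)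
  also have "\<dots> = (\<Sum>a\<in>A. \<Sum>b\<in>A. c a * c b * Q (f a) (f b))"
    by (simp add: kernel_form_def)
  finally show ?thesis .
qed

lemma Q_tendsto:
  assumes f: "\<And>n::nat. integrable dm (f n)" and g: "integrable dm g"
    and lim: "(\<lambda>n. LINT x|dm. \<bar>f n x - g x\<bar>) \<longlonglongrightarrow> 0"
  shows "(\<lambda>n. Q (f n) (f n)) \<longlonglongrightarrow> Q g g"
proof -
  define \<delta> where "\<delta> = (\<lambda>n. LINT x|dm. \<bar>f n x - g x\<bar>)"
  define G where "G = (LINT x|dm. \<bar>g x\<bar>)"
  have d: "integrable dm (\<lambda>x. f n x - g x)" for n using f g by simp
  have "\<bar>Q (f n) (f n) - Q g g\<bar> \<le> \<kappa> * (\<delta> n * \<delta> n) + \<kappa> * (\<delta> n * G) + \<kappa> * (G * \<delta> n)" for n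
  proof -
    have "Q (f n) (f n) - Q g g = Q (\<lambda>x. f n x - g x) (\<lambda>x. f n x - g x) +
        Q (\<lambda>x. f n x - g x) g + Q g (\<lambda>x. f n x - g x)"
      using f[of n] g d[of n] by (simp add: Q_diff_left Q_diff_right)
    moreover have "\<bar>Q (\<lambda>x. f n x - g x) (\<lambda>x. f n x - g x)\<bar> \<le> \<kappa> * (\<delta> n * \<delta> n)"
      "\<bar>Q (\<lambda>x. f n x - g x) g\<bar> \<le> \<kappa> * (\<delta> n * G)" "\<bar>Q g (\<lambda>x. f n x - g x)\<bar> \<le> \<kappa> * (G * \<delta> n)"
      unfolding \<delta>_def G_def by (intro Q_bound d g)+
    ultimately show ?thesis by linarith
  qed
  moreover have "(\<lambda>n. \<kappa> * (\<delta> n * \<delta> n) + \<kappa> * (\<delta> n * G) + \<kappa> * (G * \<delta> n)) \<longlonglongrightarrow>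
      \<kappa> * (0 * 0) + \<kappa> * (0 * G) + \<kappa> * (G * 0)"
    using lim unfolding \<delta>_def[symmetric] by (intro tendsto_add tendsto_mult tendsto_const)
  ultimately have "(\<lambda>n. \<bar>Q (f n) (f n) - Q g g\<bar>) \<longlonglongrightarrow> 0"
    by (intro null_sequence_bound[of "\<lambda>n. \<bar>Q (f n) (f n) - Q g g\<bar>"]) auto
  then show ?thesis
    by (simp add: tendsto_rabs_zero_iff LIM_zero_iff)
qed

section \<open>Finite partitions of the domain and the trace bound\<close>

lemma indicator_mult_L2:
  assumes "f \<in> L2 D" "A \<in> sets dm"
  shows "(\<lambda>x. f x * indicator A x) \<in> L2 D"
  using assms unfolding L2_iff
  by (subst mult.commute, intro square_integrable_bounded_mult[where B=1]) (auto simp: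
      indicator_def)

lemma indicator_L2: "A \<in> sets dm \<Longrightarrow> (\<lambda>x. indicator A x :: real) \<in> L2 D"
  by (simp add: L2_def indicator_square dom.emeasure_eq_measure)

lemma inner_indicators:
  assumes "A \<in> sets dm" "B \<in> sets dm"
  shows "L2_inner D (indicator A) (indicator B) = measure dm (A \<inter> B)"
  using assms by (simp add: L2_inner_def flip: indicator_inter_arith)

text \<open>Conditional expectations on a finite partition reduce the trace estimate to Bessel's
  inequality for step functions, applied to the Gaussian vector \<open>W 1 (f 1\<^sub>a)\<close> whose covariance
  is the compressed kernel.\<close>

lemma trace_bound_partition:
  fixes C :: "'b \<Rightarrow> 'a set"
  assumes A: "finite A" and C: "\<And>a. a \<in> A \<Longrightarrow> C a \<in> sets dm" and disj: "disjoint_family_on C A"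
    and f: "f \<in> L2 D"
  defines "P \<equiv> \<lambda>l x. \<Sum>a\<in>A. L2_inner D (e l) (indicator (C a)) / measure dm (C a) * indicator (C
      a) x"
  shows "(\<Sum>l<n. Q (\<lambda>x. f x * P l x) (\<lambda>x. f x * P l x)) \<le> \<kappa> * L2_inner D f f"
proof -
  define w where "w = (\<lambda>l a. L2_inner D (e l) (indicator (C a)) / measure dm (C a))"
  define g where "g = (\<lambda>a x. f x * indicator (C a) x)"
  define V where "V = (\<lambda>a. W 1 (g a))"
  have g: "g a \<in> L2 D" if "a \<in> A" for a
    unfolding g_def using that by (intro indicator_mult_L2 f C)
  have ind: "indicator (C a) \<in> L2 D" if "a \<in> A" for a
    using indicator_L2[OF C[OF that]] .
  have V_int: "integrable M (\<lambda>\<omega>. V a \<omega> * V b \<omega>)" if "a \<in> A" "b \<in> A" for a b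
    unfolding V_def using that by (intro square_integrable_mult W_square g) auto
  have V_cov: "expectation (\<lambda>\<omega>. V a \<omega> * V b \<omega>) = Q (g a) (g b)" if "a \<in> A" "b \<in> A" for a b
    unfolding V_def using that by (simp add: W_cov g)
  have V_sq_int: "integrable M (\<lambda>\<omega>. (V a \<omega>)\<^sup>2)" if "a \<in> A" for a
    using V_int[OF that that] by (simp add: power2_eq_square)
  \<comment> \<open>Bessel's inequality for the step function \<open>h\<close> with value
    \<open>y a / measure dm (C a)\<close> on the cell \<open>C a\<close>. On a null cell all
    quotients are 0 by the convention for division by zero, so such cells drop out of both
    sides.\<close>
  have bess: "(\<Sum>l<n. (\<Sum>a\<in>A. w l a * y a)\<^sup>2) \<le> (\<Sum>a\<in>A. (y a)\<^sup>2 / measure dm (C a))" for y :: "'b \<Rightarrow>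
      real"
  proof -
    define h where "h = (\<lambda>x. \<Sum>a\<in>A. (y a / measure dm (C a)) * indicator (C a) x :: real)"
    have h: "h \<in> L2 D" unfolding h_def by (intro L2_sum ind)
    have h_inner: "L2_inner D h u = (\<Sum>a\<in>A. y a / measure dm (C a) * L2_inner D (indicator (C a))
        u)" if "u \<in> L2 D" for u
      unfolding h_def by (intro L2_inner_sum_left ind that)
    have "L2_inner D h (e l) = (\<Sum>a\<in>A. w l a * y a)" for l
      by (simp add: h_inner w_def L2_inner_commute[of D "indicator _"] mult.commute)
    moreover have "L2_inner D h h = (\<Sum>a\<in>A. (y a)\<^sup>2 / measure dm (C a))"
    proof -
      have "L2_inner D (indicator (C a)) h = y a" if a: "a \<in> A" and nz: "measure dm (C a) \<noteq> 0" for a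
      proof -
        have "L2_inner D h (indicator (C a)) = (\<Sum>b\<in>A. y b / measure dm (C b) * measure dm (C b \<inter>
            C a))"
          using a by (subst h_inner[OF ind]) (auto intro!: sum.cong simp: inner_indicators C)
        also have "\<dots> = (\<Sum>b\<in>A. if b = a then y a else 0)"
          using a nz disj by (intro sum.cong refl) (auto simp: disjoint_family_on_def)
        also have "\<dots> = y a" using A a by simp
        finally show ?thesis by (simp add: L2_inner_commute)
      qed
      then show ?thesis
        unfolding h_inner[OF h] by (intro sum.cong refl) (auto simp: power2_eq_square)
    qed
    ultimately show ?thesis
      using bessel[OF h, of n] by simp
  qed
  have "(\<Sum>l<n. Q (\<lambda>x. f x * P l x) (\<lambda>x. f x * P l x)) = (\<Sum>l<n. \<Sum>a\<in>A. \<Sum>b\<in>A. w l a * w l b * Q (g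
      a) (g b))"
  proof (rule sum.cong[OF refl])
    fix l
    have "(\<lambda>x. f x * P l x) = (\<lambda>x. \<Sum>a\<in>A. w l a * g a x)"
      by (simp add: P_def w_def g_def sum_distrib_left ac_simps)
    then show "Q (\<lambda>x. f x * P l x) (\<lambda>x. f x * P l x) = (\<Sum>a\<in>A. \<Sum>b\<in>A. w l a * w l b * Q (g a) (g b))"
      using Q_sum[of A g "w l"] g by (simp add: L2_integrable)
  qed
  \<comment> \<open>Here positivity of the form enters: the compressed kernel is the covariance
    matrix of the vector V, so its quadratic forms are means of squares.\<close>
  also have "\<dots> = (\<Sum>l<n. expectation (\<lambda>\<omega>. (\<Sum>a\<in>A. w l a * V a \<omega>)\<^sup>2))"
  proof (rule sum.cong[OF refl])
    fix l
    have "expectation (\<lambda>\<omega>. (\<Sum>a\<in>A. w l a * V a \<omega>)\<^sup>2) =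
        expectation (\<lambda>\<omega>. \<Sum>a\<in>A. \<Sum>b\<in>A. w l a * w l b * (V a \<omega> * V b \<omega>))"
      unfolding power2_eq_square sum_product by (simp add: ac_simps)
    also have "\<dots> = (\<Sum>a\<in>A. expectation (\<lambda>\<omega>. \<Sum>b\<in>A. w l a * w l b * (V a \<omega> * V b \<omega>)))"
      by (intro Bochner_Integration.integral_sum Bochner_Integration.integrable_sum
          integrable_mult_right V_int)
    also have "\<dots> = (\<Sum>a\<in>A. \<Sum>b\<in>A. expectation (\<lambda>\<omega>. w l a * w l b * (V a \<omega> * V b \<omega>)))"
      by (intro sum.cong refl Bochner_Integration.integral_sum integrable_mult_right V_int)
    also have "\<dots> = (\<Sum>a\<in>A. \<Sum>b\<in>A. w l a * w l b * Q (g a) (g b))"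
      by (simp add: V_cov)
    finally show "(\<Sum>a\<in>A. \<Sum>b\<in>A. w l a * w l b * Q (g a) (g b)) = expectation (\<lambda>\<omega>. (\<Sum>a\<in>A. w l a *
        V a \<omega>)\<^sup>2)" ..
  qed
  also have "\<dots> = expectation (\<lambda>\<omega>. \<Sum>l<n. (\<Sum>a\<in>A. w l a * V a \<omega>)\<^sup>2)"
  proof (rule Bochner_Integration.integral_sum[symmetric])
    fix l
    show "integrable M (\<lambda>\<omega>. (\<Sum>a\<in>A. w l a * V a \<omega>)\<^sup>2)"
      unfolding power2_eq_square sum_product mult.assoc mult.left_commute[of "V _ _" "w _ _"]
      by (intro Bochner_Integration.integrable_sum integrable_mult_right V_int)
  qed
  \<comment> \<open>Bessel's inequality is applied for each outcome, with y the realised vector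
    V.\<close>
  also have "\<dots> \<le> expectation (\<lambda>\<omega>. \<Sum>a\<in>A. (V a \<omega>)\<^sup>2 / measure dm (C a))"
  proof (rule integral_mono)
    show "integrable M (\<lambda>\<omega>. \<Sum>l<n. (\<Sum>a\<in>A. w l a * V a \<omega>)\<^sup>2)"
      unfolding power2_eq_square sum_product mult.assoc mult.left_commute[of "V _ _" "w _ _"]
      by (intro Bochner_Integration.integrable_sum integrable_mult_right V_int)
    show "integrable M (\<lambda>\<omega>. \<Sum>a\<in>A. (V a \<omega>)\<^sup>2 / measure dm (C a))"
      by (intro Bochner_Integration.integrable_sum integrable_divide V_sq_int)
    show "(\<Sum>l<n. (\<Sum>a\<in>A. w l a * V a \<omega>)\<^sup>2) \<le> (\<Sum>a\<in>A. (V a \<omega>)\<^sup>2 / measure dm (C a))" for \<omega>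
      by (rule bess)
  qed
  also have "\<dots> = (\<Sum>a\<in>A. expectation (\<lambda>\<omega>. (V a \<omega>)\<^sup>2 / measure dm (C a)))"
    by (intro Bochner_Integration.integral_sum integrable_divide V_sq_int)
  also have "\<dots> = (\<Sum>a\<in>A. Q (g a) (g a) / measure dm (C a))"
    using V_cov by (intro sum.cong refl) (simp add: power2_eq_square)
  \<comment> \<open>On one cell the L1 bound gives \<kappa> times the square of the integral of |f|,
    and Cauchy-Schwarz bounds that square by the measure of the cell times the integral of f^2. The
    measure cancels the denominator, so the constant is \<kappa> whatever the partition.\<close>
  also have "\<dots> \<le> (\<Sum>a\<in>A. \<kappa> * L2_inner D (g a) (g a))"
  proof (rule sum_mono)
    fix a assume a: "a \<in> A"
    have ga: "(\<lambda>x. \<bar>g a x\<bar>) \<in> L2 D"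
      using g[OF a] by (auto simp: L2_def)
    have "(LINT x|dm. \<bar>g a x\<bar> * indicator (C a) x) \<le> sqrt (LINT x|dm. \<bar>g a x\<bar>\<^sup>2) * sqrt (LINT
        x|dm. (indicator (C a) x)\<^sup>2)"
      using integral_Cauchy_Schwarz[OF ga[unfolded L2_iff] ind[OF a, unfolded L2_iff]] by (rule
          order_trans[OF abs_ge_self])
    also have "(LINT x|dm. (indicator (C a) x :: real)\<^sup>2) = measure dm (C a)"
      using inner_indicators[OF C[OF a] C[OF a]] by (simp add: L2_inner_square)
    also have "(LINT x|dm. \<bar>g a x\<bar>\<^sup>2) = L2_inner D (g a) (g a)"
      by (simp add: L2_inner_square)
    also have "(\<lambda>x. \<bar>g a x\<bar> * indicator (C a) x) = (\<lambda>x. \<bar>g a x\<bar>)"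
      by (auto simp: g_def indicator_def)
    finally have "(LINT x|dm. \<bar>g a x\<bar>)\<^sup>2 \<le> (sqrt (L2_inner D (g a) (g a)) * sqrt (measure dm (C
        a)))\<^sup>2"
      by (intro power_mono) auto
    then have "(LINT x|dm. \<bar>g a x\<bar>)\<^sup>2 \<le> L2_inner D (g a) (g a) * measure dm (C a)"
      by (simp add: power_mult_distrib L2_inner_nonneg)
    then have "\<kappa> * (LINT x|dm. \<bar>g a x\<bar>)\<^sup>2 \<le> \<kappa> * (L2_inner D (g a) (g a) * measure dm (C a))"
      by (rule mult_left_mono[OF _ \<kappa>_nonneg])
    moreover have "Q (g a) (g a) \<le> \<kappa> * (LINT x|dm. \<bar>g a x\<bar>)\<^sup>2"
      using Q_bound[OF L2_integrable[OF g[OF a]] L2_integrable[OF g[OF a]]] by (simp add: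
          power2_eq_square)
    ultimately have "Q (g a) (g a) \<le> \<kappa> * L2_inner D (g a) (g a) * measure dm (C a)"
      by (simp add: mult.assoc)
    then show "Q (g a) (g a) / measure dm (C a) \<le> \<kappa> * L2_inner D (g a) (g a)"
      using \<kappa>_nonneg L2_inner_nonneg[of D "g a"] by (cases "measure dm (C a) = 0") (simp_all
          add: divide_le_eq zero_less_measure_iff)
  qed
  also have "\<dots> = \<kappa> * (\<Sum>a\<in>A. L2_inner D (g a) (g a))"
    by (simp add: sum_distrib_left)
  also have "\<dots> \<le> \<kappa> * L2_inner D f f"
  proof (rule mult_left_mono[OF _ \<kappa>_nonneg])
    have gsq: "integrable dm (\<lambda>x. (g a x)\<^sup>2)" if "a \<in> A" for a
      using g[OF that] by (simp add: L2_def)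
    have "(\<Sum>a\<in>A. L2_inner D (g a) (g a)) = (LINT x|dm. (\<Sum>a\<in>A. (g a x)\<^sup>2))"
      unfolding L2_inner_square by (intro Bochner_Integration.integral_sum[symmetric] gsq)
    also have "\<dots> \<le> (LINT x|dm. (f x)\<^sup>2)"
    proof (rule integral_mono)
      show "integrable dm (\<lambda>x. \<Sum>a\<in>A. (g a x)\<^sup>2)"
        by (intro Bochner_Integration.integrable_sum gsq)
      show "integrable dm (\<lambda>x. (f x)\<^sup>2)" using f by (simp add: L2_def)
      fix x
      have "(\<Sum>a\<in>A. indicator (C a) x :: real) = indicator (\<Union>a\<in>A. C a) x"
        using indicator_UN_disjoint[OF A disj] by metis
      also have "\<dots> \<le> 1" by (rule indicator_le_1)
      finally have "(\<Sum>a\<in>A. indicator (C a) x :: real) \<le> 1" .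
      then have "(f x)\<^sup>2 * (\<Sum>a\<in>A. indicator (C a) x) \<le> (f x)\<^sup>2 * 1"
        by (rule mult_left_mono) simp
      then show "(\<Sum>a\<in>A. (g a x)\<^sup>2) \<le> (f x)\<^sup>2"
        by (simp add: g_def power_mult_distrib indicator_square sum_distrib_left)
    qed
    finally show "(\<Sum>a\<in>A. L2_inner D (g a) (g a)) \<le> L2_inner D f f"
      by (simp add: L2_inner_square)
  qed
  finally show ?thesis .
qed

text \<open>The partition is adapted to the first n basis functions: a cell collects the points
  where all rounded values of (m+1) e_l agree. Each e_l oscillates by at most 1/(m+1) on a cell, so
  its cell averages converge to it uniformly off a null set, and L1 continuity of the form passes
  the bound to the limit.\<close>

lemma trace_bound:
  assumes f: "f \<in> L2 D"
  shows "(\<Sum>l<n. Q (\<lambda>x. e l x * f x) (\<lambda>x. e l x * f x)) \<le> \<kappa> * L2_inner D f f"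
proof -
  define cell where "cell = (\<lambda>m x. map (\<lambda>l. \<lfloor>real (Suc m) * e l x\<rfloor>) [0..<n])"
  define A where "A = (\<lambda>m. cell m ` D)"
  define C where "C = (\<lambda>m a. {x \<in> D. cell m x = a})"
  define P where "P = (\<lambda>m l x. \<Sum>a\<in>A m. L2_inner D (e l) (indicator (C m a)) / measure dm (C m a)
      * indicator (C m a) x)"
  have e_meas [measurable]: "e l \<in> borel_measurable dm" for l
    using e_L2[of l] by (simp add: L2_def)
  have A_fin: "finite (A m)" for m
  proof -
    obtain B where B: "\<And>l x. x \<in> D \<Longrightarrow> \<bar>e l x\<bar> \<le> B l"
      using e_bounded by metis
    \<comment> \<open>Boundedness of the basis functions leaves finitely many rounded values, hence
      finitely many cells.\<close>
    define K where "K = (\<Union>l\<in>{..<n}. {\<lfloor>- (real (Suc m) * B l)\<rfloor>..\<lfloor>real (Suc m) * B l\<rfloor>})"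
    have "A m \<subseteq> {xs. set xs \<subseteq> K \<and> length xs = n}"
    proof
      fix a assume "a \<in> A m"
      then obtain x where x: "x \<in> D" and a: "a = cell m x" by (auto simp: A_def)
      have "\<lfloor>real (Suc m) * e l x\<rfloor> \<in> K" if "l < n" for l
      proof -
        have "- B l \<le> e l x" "e l x \<le> B l" using B[OF x, of l] by auto
        then have "real (Suc m) * - B l \<le> real (Suc m) * e l x" "real (Suc m) * e l x \<le> real
            (Suc m) * B l"
          by (intro mult_left_mono; simp)+
        then show ?thesis
          unfolding K_def using that by (auto intro!: bexI[of _ l] floor_mono)
      qed
      then show "a \<in> {xs. set xs \<subseteq> K \<and> length xs = n}"
        by (auto simp: a cell_def)
    qed
    moreover have "finite K" by (auto simp: K_def)
    ultimately show ?thesis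
      by (rule finite_subset[OF _ finite_lists_length_eq])
  qed
  have C_sets: "C m a \<in> sets dm" if "a \<in> A m" for m a
  proof -
    obtain y where "a = cell m y" using \<open>a \<in> A m\<close> by (auto simp: A_def)
    then have "C m a = {x \<in> space dm. \<forall>l\<in>{..<n}. \<lfloor>real (Suc m) * e l x\<rfloor> = \<lfloor>real (Suc m) * e l y\<rfloor>}"
      by (auto simp: C_def cell_def space_dom)
    also have "\<dots> \<in> sets dm" by measurable
    finally show ?thesis .
  qed
  have disj: "disjoint_family_on (C m) (A m)" for m
    by (auto simp: disjoint_family_on_def C_def)
  have P_value: "P m l x = L2_inner D (e l) (indicator (C m (cell m x))) / measure dm (C m (cell
      m x))" if "x \<in> D" for m l x
  proof -
    have "P m l x = (\<Sum>a\<in>A m. if a = cell m x then L2_inner D (e l) (indicator (C m a)) / measure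
        dm (C m a) else 0)"
      unfolding P_def using that by (intro sum.cong refl) (auto simp: C_def indicator_def)
    also have "\<dots> = L2_inner D (e l) (indicator (C m (cell m x))) / measure dm (C m (cell m x))"
      using that A_fin[of m] by (simp add: A_def)
    finally show ?thesis .
  qed
  have close: "\<bar>P m l x - e l x\<bar> \<le> 1 / real (Suc m)"
    if x: "x \<in> D" and l: "l < n" and nz: "measure dm (C m (cell m x)) \<noteq> 0" for m l x
  proof -
    let ?C = "C m (cell m x)"
    have Cs: "?C \<in> sets dm" using x by (intro C_sets) (simp add: A_def)
    have pos: "0 < measure dm ?C" using nz by (simp add: zero_less_measure_iff)
    have osc: "\<bar>e l y - e l x\<bar> \<le> 1 / real (Suc m)" if "y \<in> ?C" for y
    proof -
      have "\<lfloor>real (Suc m) * e l y\<rfloor> = \<lfloor>real (Suc m) * e l x\<rfloor>"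
        using that l by (auto simp: C_def cell_def)
      then have "\<bar>real (Suc m) * e l y - real (Suc m) * e l x\<bar> \<le> 1"
        by linarith
      then have "real (Suc m) * \<bar>e l y - e l x\<bar> \<le> 1"
        by (simp add: abs_mult flip: right_diff_distrib)
      then show ?thesis
        by (simp add: pos_le_divide_eq mult.commute)
    qed
    have i1: "integrable dm (\<lambda>y. e l y * indicator ?C y)" "integrable dm (\<lambda>y. e l x * indicator
        ?C y)"
      "integrable dm (\<lambda>y. 1 / real (Suc m) * indicator ?C y)"
      using Cs indicator_mult_L2[OF e_L2 Cs, THEN L2_integrable] by (auto simp:
          dom.emeasure_eq_measure)
    have int_ind: "(LINT y|dm. indicator ?C y) = measure dm ?C"
      using Cs sets.sets_into_space[OF Cs] by (simp add: Int_absorb2)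
    have "L2_inner D (e l) (indicator ?C) - e l x * measure dm ?C = (LINT y|dm. (e l y - e l x)
        * indicator ?C y)"
      using i1 int_ind by (simp add: L2_inner_def left_diff_distrib)
    also have "\<bar>\<dots>\<bar> \<le> (LINT y|dm. \<bar>(e l y - e l x) * indicator ?C y\<bar>)"
      by (rule integral_abs_bound)
    also have "\<dots> \<le> (LINT y|dm. 1 / real (Suc m) * indicator ?C y)"
    proof (rule integral_mono)
      show "integrable dm (\<lambda>y. \<bar>(e l y - e l x) * indicator ?C y\<bar>)"
        using i1 by (simp add: left_diff_distrib)
      show "\<bar>(e l y - e l x) * indicator ?C y\<bar> \<le> 1 / real (Suc m) * indicator ?C y" for y
        using osc[of y] by (auto simp: indicator_def)
    qed fact
    also have "\<dots> = 1 / real (Suc m) * measure dm ?C"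
      using int_ind by simp
    finally have "\<bar>(P m l x - e l x) * measure dm ?C\<bar> \<le> 1 / real (Suc m) * measure dm ?C"
      using nz by (simp add: P_value[OF x] left_diff_distrib)
    then have "\<bar>P m l x - e l x\<bar> * measure dm ?C \<le> 1 / real (Suc m) * measure dm ?C"
      unfolding abs_mult abs_of_pos[OF pos] .
    then show ?thesis
      using pos by (rule mult_right_le_imp_le)
  qed
  \<comment> \<open>The cell average is meaningful only on cells of positive measure; the remaining
    cells are finitely many null sets.\<close>
  have close_AE: "AE x in dm. \<bar>P m l x - e l x\<bar> \<le> 1 / real (Suc m)" if l: "l < n" for m l
  proof -
    have "AE x in dm. \<forall>a\<in>{a \<in> A m. measure dm (C m a) = 0}. x \<notin> C m a"
    proof (subst AE_finite_all)
      show "finite {a \<in> A m. measure dm (C m a) = 0}" using A_fin by simp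
      show "\<forall>a\<in>{a \<in> A m. measure dm (C m a) = 0}. AE x in dm. x \<notin> C m a"
        using C_sets by (auto intro!: AE_not_in simp: null_sets_def dom.emeasure_eq_measure)
    qed
    then show ?thesis
      using AE_space
    proof eventually_elim
      fix x assume x: "\<forall>a\<in>{a \<in> A m. measure dm (C m a) = 0}. x \<notin> C m a" "x \<in> space dm"
      then have "x \<in> D" by (simp add: space_dom)
      with x have "measure dm (C m (cell m x)) \<noteq> 0"
        by (auto simp: A_def C_def)
      with \<open>x \<in> D\<close> l show "\<bar>P m l x - e l x\<bar> \<le> 1 / real (Suc m)"
        by (intro close)
    qed
  qed
  have P_L2: "(\<lambda>x. f x * P m l x) \<in> L2 D" for m l
  proof -
    have "(\<lambda>x. f x * P m l x) = (\<lambda>x. \<Sum>a\<in>A m. L2_inner D (e l) (indicator (C m a)) / measure dm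
        (C m a) * (f x * indicator (C m a) x))"
      by (simp add: P_def sum_distrib_left ac_simps)
    also have "\<dots> \<in> L2 D" by (intro L2_sum indicator_mult_L2 f C_sets)
    finally show ?thesis .
  qed
  have fi: "integrable dm f" by (rule L2_integrable[OF f])
  have ei: "integrable dm (\<lambda>x. e l x * f x)" for l by (intro L2_integrable e_mult_L2 f)
  have lim: "(\<lambda>m. Q (\<lambda>x. f x * P m l x) (\<lambda>x. f x * P m l x)) \<longlonglongrightarrow> Q (\<lambda>x. e l x * f x) (\<lambda>x. e l x *
      f x)"
    if l: "l < n" for l
  proof (rule Q_tendsto[OF L2_integrable[OF P_L2] ei])
    have "(LINT x|dm. \<bar>f x * P m l x - e l x * f x\<bar>) \<le> 1 / real (Suc m) * (LINT x|dm. \<bar>f x\<bar>)" for m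
    proof -
      have "(LINT x|dm. \<bar>f x * P m l x - e l x * f x\<bar>) \<le> (LINT x|dm. 1 / real (Suc m) * \<bar>f x\<bar>)"
      proof (rule integral_mono_AE)
        show "integrable dm (\<lambda>x. \<bar>f x * P m l x - e l x * f x\<bar>)"
          using L2_integrable[OF P_L2] ei by simp
        show "integrable dm (\<lambda>x. 1 / real (Suc m) * \<bar>f x\<bar>)" using fi by simp
        show "AE x in dm. \<bar>f x * P m l x - e l x * f x\<bar> \<le> 1 / real (Suc m) * \<bar>f x\<bar>"
          using close_AE[OF l, of m]
        proof eventually_elim
          fix x assume "\<bar>P m l x - e l x\<bar> \<le> 1 / real (Suc m)"
          then have "\<bar>P m l x - e l x\<bar> * \<bar>f x\<bar> \<le> 1 / real (Suc m) * \<bar>f x\<bar>"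
            by (rule mult_right_mono) simp
          moreover have "f x * P m l x - e l x * f x = (P m l x - e l x) * f x"
            by (simp add: algebra_simps)
          ultimately show "\<bar>f x * P m l x - e l x * f x\<bar> \<le> 1 / real (Suc m) * \<bar>f x\<bar>"
            by (simp only: abs_mult)
        qed
      qed
      then show ?thesis by simp
    qed
    moreover have "(\<lambda>m. 1 / real (Suc m) * (LINT x|dm. \<bar>f x\<bar>)) \<longlonglongrightarrow> 0"
      using tendsto_mult_right[OF LIMSEQ_inverse_real_of_nat, of "LINT x|dm. \<bar>f x\<bar>"] by (simp
          add: inverse_eq_divide)
    ultimately show "(\<lambda>m. LINT x|dm. \<bar>f x * P m l x - e l x * f x\<bar>) \<longlonglongrightarrow> 0"
      by (intro null_sequence_bound[of "\<lambda>m. LINT x|dm. \<bar>f x * P m l x - e l x * f x\<bar>"]) auto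
  qed
  show ?thesis
  proof (rule tendsto_upperbound)
    show "(\<lambda>m. \<Sum>l<n. Q (\<lambda>x. f x * P m l x) (\<lambda>x. f x * P m l x)) \<longlonglongrightarrow>
        (\<Sum>l<n. Q (\<lambda>x. e l x * f x) (\<lambda>x. e l x * f x))"
      by (intro tendsto_sum lim) auto
    show "\<forall>\<^sub>F m in sequentially. (\<Sum>l<n. Q (\<lambda>x. f x * P m l x) (\<lambda>x. f x * P m l x)) \<le> \<kappa> *
        L2_inner D f f"
      unfolding P_def by (intro always_eventually allI trace_bound_partition A_fin C_sets disj f)
  qed simp
qed

section \<open>Truncated multiplication operators under the kernel form\<close>

lemma Q_multiplier_tendsto:
  assumes "f \<in> L2 D"
  shows "(\<lambda>N. Q (multiplier k N f) (multiplier k N f)) \<longlonglongrightarrow> Q (\<lambda>x. e k x * f x) (\<lambda>x. e k x * f x)"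
  using assms by (intro Q_tendsto L2_integrable multiplier_L2 e_mult_L2 multiplier_tendsto)

text \<open>The constant is \<kappa> times the measure of D times the squared bound of
  \<open>e k\<close>. It is uniform in the truncation N, which supplies the majorant for dominated
  convergence over time and outcomes.\<close>

lemma Q_multiplier_bound:
  "\<exists>c. \<forall>N. \<forall>f\<in>L2 D. \<bar>Q (multiplier k N f) (multiplier k N f)\<bar> \<le> c * L2_inner D f f"
proof -
  obtain B where B: "\<And>x. x \<in> D \<Longrightarrow> \<bar>e k x\<bar> \<le> B" using e_bounded[of k] by blast
  have "\<bar>Q (multiplier k N f) (multiplier k N f)\<bar> \<le> (\<kappa> * measure dm D * B\<^sup>2) * L2_inner D f f"
      if f: "f \<in> L2 D" for N f
  proof -
    let ?g = "multiplier k N f"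
    have gi: "integrable dm ?g" by (intro L2_integrable multiplier_L2)
    have "\<bar>Q ?g ?g\<bar> \<le> \<kappa> * (LINT x|dm. \<bar>?g x\<bar>)\<^sup>2"
      using Q_bound[OF gi gi] by (simp add: power2_eq_square)
    also have "\<dots> \<le> \<kappa> * (measure dm D * L2_inner D ?g ?g)"
      by (intro mult_left_mono L1_le_L2 multiplier_L2 \<kappa>_nonneg)
    also have "\<dots> \<le> \<kappa> * (measure dm D * (B\<^sup>2 * L2_inner D f f))"
      by (intro mult_left_mono multiplier_norm_le B f \<kappa>_nonneg measure_nonneg)
    finally show ?thesis by (simp add: mult.assoc)
  qed
  then show ?thesis by blast
qed

end

section \<open>Mean square stability\<close>

lemma expectation_sum_mult:
  assumes Y: "\<And>p. p \<in> I \<Longrightarrow> square_integrable M (Y p)" and Z: "\<And>p. p \<in> I \<Longrightarrow> square_integrable M (Z p)"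
  shows "(LINT \<omega>|M. (\<Sum>p\<in>I. c p * Y p \<omega>) * (\<Sum>p\<in>I. c p * Z p \<omega>)) =
    (\<Sum>p\<in>I. \<Sum>p'\<in>I. c p * c p' * (LINT \<omega>|M. Y p \<omega> * Z p' \<omega>))"
proof -
  have i: "integrable M (\<lambda>\<omega>. c p * c p' * (Y p \<omega> * Z p' \<omega>))" if "p \<in> I" "p' \<in> I" for p p'
    using that by (intro integrable_mult_right square_integrable_mult Y Z)
  have "(LINT \<omega>|M. (\<Sum>p\<in>I. c p * Y p \<omega>) * (\<Sum>p\<in>I. c p * Z p \<omega>)) =
      (LINT \<omega>|M. (\<Sum>p\<in>I. \<Sum>p'\<in>I. c p * c p' * (Y p \<omega> * Z p' \<omega>)))"
    unfolding sum_product by (simp add: ac_simps)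
  also have "\<dots> = (\<Sum>p\<in>I. (LINT \<omega>|M. (\<Sum>p'\<in>I. c p * c p' * (Y p \<omega> * Z p' \<omega>))))"
    by (intro Bochner_Integration.integral_sum Bochner_Integration.integrable_sum i)
  also have "\<dots> = (\<Sum>p\<in>I. \<Sum>p'\<in>I. (LINT \<omega>|M. c p * c p' * (Y p \<omega> * Z p' \<omega>)))"
    by (intro sum.cong refl Bochner_Integration.integral_sum i)
  finally show ?thesis by simp
qed

text \<open>The inequality makes w nonincreasing, so w(t) is at most its mean over (0, t]. This
  gives a rate 1/t by integration alone, without passing to a differential inequality for w.\<close>

lemma decay_of_integral_inequality:
  fixes w :: "real \<Rightarrow> real"
  assumes nonneg: "\<And>t. 0 \<le> t \<Longrightarrow> 0 \<le> w t"
    and int: "\<And>t. 0 \<le> t \<Longrightarrow> set_integrable lborel {0..t} w"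
    and ineq: "\<And>s t. 0 \<le> s \<Longrightarrow> s \<le> t \<Longrightarrow> w t - w s \<le> - \<delta> * (LINT r:{s<..t}|lborel. w r)"
    and \<delta>: "0 < \<delta>"
  shows "(w \<longlongrightarrow> 0) at_top"
proof -
  have int': "set_integrable lborel {s<..t} w" if "0 \<le> s" "0 \<le> t" for s t
    using int[OF that(2)] by (rule set_integrable_subset) (use that in auto)
  have pos: "0 \<le> (LINT r:{s<..t}|lborel. w r)" if "0 \<le> s" for s t
    unfolding set_lebesgue_integral_def
    by (rule Bochner_Integration.integral_nonneg) (use that nonneg in \<open>auto simp: indicator_def\<close>)
  have mono: "w t \<le> w s" if "0 \<le> s" "s \<le> t" for s t
    using ineq[OF that] mult_nonneg_nonneg[OF less_imp_le[OF \<delta>] pos[OF that(1), of t]] by simp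
  have bound: "w t \<le> w 0 / \<delta> / t" if t: "0 < t" for t
  proof -
    have "t * w t = (LINT r:{0<..t}|lborel. w t)"
      using t by (simp add: set_integral_const)
    also have "\<dots> \<le> (LINT r:{0<..t}|lborel. w r)"
    proof (rule set_integral_mono)
      show "set_integrable lborel {0<..t} (\<lambda>r. w t)"
        using t by (simp add: set_integrable_def)
      show "set_integrable lborel {0<..t} w" using int' t by simp
    qed (use mono in auto)
    also have "\<dots> \<le> w 0 / \<delta>"
      using ineq[of 0 t] nonneg[of t] t \<delta> by (simp add: pos_le_divide_eq mult.commute)
    finally show ?thesis
      unfolding pos_le_divide_eq[OF t] by (simp only: mult.commute)
  qed
  show ?thesis
  proof (rule tendsto_sandwich)
    show "\<forall>\<^sub>F t in at_top. 0 \<le> w t"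
      using eventually_ge_at_top[of 0] by eventually_elim (rule nonneg)
    show "\<forall>\<^sub>F t in at_top. w t \<le> w 0 / \<delta> / t"
      using eventually_gt_at_top[of 0] by eventually_elim (rule bound)
    show "((\<lambda>t. w 0 / \<delta> / t) \<longlongrightarrow> 0) at_top"
      by (intro tendsto_divide_0[OF tendsto_const] filterlim_at_top_imp_at_infinity filterlim_ident)
  qed simp
qed

text \<open>The kernel is not yet assumed bounded: for \<beta>1 = 0 the supremum \<kappa> may be
  infinite, and the second moment equations must cover that case too. \<open>gap\<close> with
  monotone eigenvalues makes every rate lam k + \<beta>0 positive.\<close>

locale heat_solution = white_noise M F D q W + L2_basis D e
  for M :: "'w measure" and F :: "real \<Rightarrow> 'w measure" and D :: "'a::euclidean_space set"
    and q :: "'a \<Rightarrow> 'a \<Rightarrow> real" and W :: "real \<Rightarrow> ('a \<Rightarrow> real) \<Rightarrow> 'w \<Rightarrow> real"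
    and e :: "nat \<Rightarrow> 'a \<Rightarrow> real" +
  fixes lam :: "nat \<Rightarrow> real" and \<beta>0 \<beta>1 :: real and u0 :: "'a \<Rightarrow> real" and u :: "real \<Rightarrow> 'w \<Rightarrow> 'a \<Rightarrow> real"
  assumes sol: "stochastic_heat_solution M F D W lam e \<beta>0 \<beta>1 u0 u"
    and lam_mono: "mono lam" and gap: "0 < lam 0 + \<beta>0"
begin

abbreviation P :: "(real \<times> 'w) measure" where "P \<equiv> lborel \<Otimes>\<^sub>M M"

lemma u_L2: "0 \<le> t \<Longrightarrow> \<omega> \<in> space M \<Longrightarrow> u t \<omega> \<in> L2 D"
  using sol by (simp add: stochastic_heat_solution_def L2_process_def)

text \<open>A solution is constrained only at nonnegative times; extension by zero makes the
  coordinate jointly measurable on the whole time line.\<close>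

definition X :: "nat \<Rightarrow> real \<Rightarrow> 'w \<Rightarrow> real" where
  "X k s \<omega> = indicator {0..} s * L2_inner D (u s \<omega>) (e k)"

definition energy :: "real \<Rightarrow> 'w \<Rightarrow> real" where
  "energy s \<omega> = indicator {0..} s * (L2_norm D (u s \<omega>))\<^sup>2"

lemma X_eq: "0 \<le> s \<Longrightarrow> X k s \<omega> = L2_inner D (u s \<omega>) (e k)"
  by (simp add: X_def)

lemma energy_eq: "0 \<le> s \<Longrightarrow> energy s \<omega> = L2_inner D (u s \<omega>) (u s \<omega>)"
  by (simp add: energy_def L2_norm_square)

lemma energy_nonneg: "0 \<le> energy s \<omega>"
  by (simp add: energy_def)

text \<open>Progressive measurability controls each strip [0, n]; at any given point the restricted
  processes are eventually constant in n.\<close>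

lemma X_measurable [measurable]: "(\<lambda>(s, \<omega>). X k s \<omega>) \<in> borel_measurable P"
proof (rule borel_measurable_LIMSEQ_real)
  have "progressively_measurable F (\<lambda>s \<omega>. L2_inner D (u s \<omega>) (e k))"
    using sol by (simp add: stochastic_heat_solution_def L2_process_def)
  from progressively_measurable_product[OF this subalgebra_F]
  show "(\<lambda>(s, \<omega>). indicator {0..real n} s * L2_inner D (u s \<omega>) (e k)) \<in> borel_measurable P" for n
    by simp
  fix z :: "real \<times> 'w"
  obtain n0 where n0: "fst z \<le> real n0"
    using real_arch_simple by blast
  have "\<forall>\<^sub>F n in sequentially. fst z \<le> real n"
    using eventually_ge_at_top[of n0] by eventually_elim (use n0 in linarith)
  then have "\<forall>\<^sub>F n in sequentially. (case z of (s, \<omega>) \<Rightarrow> indicator {0..real n} s * L2_inner D (u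
      s \<omega>) (e k)) =
      (case z of (s, \<omega>) \<Rightarrow> X k s \<omega>)"
    by eventually_elim (cases z, auto simp: X_def indicator_def)
  then show "(\<lambda>n. case z of (s, \<omega>) \<Rightarrow> indicator {0..real n} s * L2_inner D (u s \<omega>) (e k)) \<longlonglongrightarrow>
      (case z of (s, \<omega>) \<Rightarrow> X k s \<omega>)"
    by (rule tendsto_eventually)
qed

lemma X_section_measurable [measurable]: "X k s \<in> borel_measurable M"
  using measurable_compose[OF measurable_Pair1'[of s lborel M] X_measurable[of k]] by simp

lemma X_sum_tendsto:
  assumes "\<omega> \<in> space M"
  shows "(\<lambda>n. \<Sum>k<n. (X k s \<omega>)\<^sup>2) \<longlonglongrightarrow> energy s \<omega>"
  using parseval[OF u_L2[OF _ assms], of s] by (cases "0 \<le> s") (simp_all add: X_def energy_def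
      L2_norm_square)

lemma X_sum_le:
  assumes "\<omega> \<in> space M"
  shows "(\<Sum>k<n. (X k s \<omega>)\<^sup>2) \<le> energy s \<omega>"
  using bessel[OF u_L2[OF _ assms], of s n] by (cases "0 \<le> s") (simp_all add: X_def energy_def
      L2_norm_square)

lemma X_le:
  assumes "\<omega> \<in> space M"
  shows "(X k s \<omega>)\<^sup>2 \<le> energy s \<omega>"
proof -
  have "(X k s \<omega>)\<^sup>2 \<le> (\<Sum>j<Suc k. (X j s \<omega>)\<^sup>2)"
    by (rule member_le_sum) auto
  also have "\<dots> \<le> energy s \<omega>" by (rule X_sum_le[OF assms])
  finally show ?thesis .
qed

text \<open>By Parseval the energy is a pointwise limit of sums of squared coordinates, so weak
  measurability of the solution is enough.\<close>

lemma energy_measurable [measurable]: "(\<lambda>(s, \<omega>). energy s \<omega>) \<in> borel_measurable P"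
proof (rule borel_measurable_LIMSEQ_real)
  show "(\<lambda>z. \<Sum>k<n. ((\<lambda>(s, \<omega>). X k s \<omega>) z)\<^sup>2) \<in> borel_measurable P" for n
    by measurable
  show "z \<in> space P \<Longrightarrow> (\<lambda>n. \<Sum>k<n. ((\<lambda>(s, \<omega>). X k s \<omega>) z)\<^sup>2) \<longlonglongrightarrow> (case z of (s, \<omega>) \<Rightarrow> energy s \<omega>)" for z
    using X_sum_tendsto[of "snd z" "fst z"] by (auto simp: space_pair_measure case_prod_unfold)
qed

lemma energy_section_integrable: "integrable M (energy s)"
proof (cases "0 \<le> s")
  case True
  have "integrable M (\<lambda>\<omega>. (L2_norm D (u s \<omega>))\<^sup>2)"
    using sol True by (simp add: stochastic_heat_solution_def L2_process_def)
  then show ?thesis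
    using True by (simp add: energy_def[abs_def])
qed (simp add: energy_def[abs_def])

lemma energy_integrable: "integrable P (\<lambda>(s, \<omega>). indicator {0..T} s * energy s \<omega>)"
proof (cases "0 \<le> T")
  case T: True
  have fin: "(\<integral>\<^sup>+s\<in>{0..T}. (\<integral>\<^sup>+\<omega>. ennreal ((L2_norm D (u s \<omega>))\<^sup>2) \<partial>M) \<partial>lborel) < \<infinity>"
    using sol T by (simp add: stochastic_heat_solution_def L2_process_def)
  have meas: "(\<lambda>z. ennreal (norm (case z of (s, \<omega>) \<Rightarrow> indicator {0..T} s * energy s \<omega>))) \<in>
      borel_measurable P"
    by measurable
  show ?thesis
  proof (rule integrableI_bounded)
    have "(\<integral>\<^sup>+z. ennreal (norm (case z of (s, \<omega>) \<Rightarrow> indicator {0..T} s * energy s \<omega>)) \<partial>P) =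
        (\<integral>\<^sup>+s. (\<integral>\<^sup>+\<omega>. ennreal (norm (indicator {0..T} s * energy s \<omega>)) \<partial>M) \<partial>lborel)"
      using nn_integral_fst[OF meas] by simp
    also have "\<dots> = (\<integral>\<^sup>+s\<in>{0..T}. (\<integral>\<^sup>+\<omega>. ennreal ((L2_norm D (u s \<omega>))\<^sup>2) \<partial>M) \<partial>lborel)"
    proof (rule nn_integral_cong)
      fix s :: real
      show "(\<integral>\<^sup>+\<omega>. ennreal (norm (indicator {0..T} s * energy s \<omega>)) \<partial>M) =
          (\<integral>\<^sup>+\<omega>. ennreal ((L2_norm D (u s \<omega>))\<^sup>2) \<partial>M) * indicator {0..T} s"
        by (cases "s \<in> {0..T}") (simp_all add: energy_def)
    qed
    finally show "(\<integral>\<^sup>+z. ennreal (norm (case z of (s, \<omega>) \<Rightarrow> indicator {0..T} s * energy s \<omega>)) \<partial>P)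
        < \<infinity>"
      using fin by simp
  qed measurable
next
  case False
  then have "(\<lambda>(s, \<omega>). indicator {0..T} s * energy s \<omega>) = (\<lambda>_. 0)" by (auto simp: indicator_def)
  then show ?thesis by simp
qed

lemma X_integrable: "integrable P (\<lambda>(s, \<omega>). indicator {0..T} s * (X k s \<omega>)\<^sup>2)"
proof (rule Bochner_Integration.integrable_bound[OF energy_integrable[of T]])
  show "AE z in P. norm (case z of (s, \<omega>) \<Rightarrow> indicator {0..T} s * (X k s \<omega>)\<^sup>2)
      \<le> norm (case z of (s, \<omega>) \<Rightarrow> indicator {0..T} s * energy s \<omega>)"
    using X_le by (intro AE_I2) (auto simp: space_pair_measure indicator_def energy_nonneg)
qed measurable

lemma X_square: "square_integrable M (X k t)"
  unfolding square_integrable_def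
proof
  show "integrable M (\<lambda>\<omega>. (X k t \<omega>)\<^sup>2)"
    by (rule Bochner_Integration.integrable_bound[OF energy_section_integrable[of t]])
       (use X_le in \<open>auto simp: energy_nonneg\<close>)
qed measurable

lemma X_square_P: "square_integrable P (\<lambda>(s, \<omega>). indicator {0..T} s * X k s \<omega>)"
  using X_integrable[of T k] by (simp add: square_integrable_def case_prod_unfold
      power_mult_distrib indicator_square)

section \<open>Second moments of the modes and of the whole solution\<close>

definition v :: "nat \<Rightarrow> real \<Rightarrow> real" where "v k s = expectation (\<lambda>\<omega>. (X k s \<omega>)\<^sup>2)"

definition w :: "real \<Rightarrow> real" where "w s = expectation (energy s)"

lemma v_nonneg: "0 \<le> v k s" by (simp add: v_def)

lemma w_nonneg: "0 \<le> w s" by (simp add: w_def energy_nonneg)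

lemma w_integrable: "set_integrable lborel {0..T} w"
  using LM.integrable_fst[OF energy_integrable[of T]] by (simp add: w_def[abs_def]
      set_integrable_def)

lemma v_integrable: "set_integrable lborel {0..T} (v k)"
  using LM.integrable_fst[OF X_integrable[of T k]] by (simp add: v_def[abs_def] set_integrable_def)

lemma X_sq_integrable: "integrable M (\<lambda>\<omega>. (X k s \<omega>)\<^sup>2)"
  using X_square by (simp add: square_integrable_def)

lemma v_sum: "(\<Sum>k<n. v k s) = expectation (\<lambda>\<omega>. \<Sum>k<n. (X k s \<omega>)\<^sup>2)"
  unfolding v_def by (intro Bochner_Integration.integral_sum[symmetric] X_sq_integrable)

lemma v_sum_le: "(\<Sum>k<n. v k s) \<le> w s"
  unfolding v_sum w_def
  by (intro integral_mono Bochner_Integration.integrable_sum X_sq_integrable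
      energy_section_integrable X_sum_le)

lemma v_sum_tendsto: "(\<lambda>n. \<Sum>k<n. v k s) \<longlonglongrightarrow> w s"
  unfolding v_sum w_def
proof (rule integral_dominated_convergence[OF _ _ energy_section_integrable[of s]])
  show "energy s \<in> borel_measurable M" using energy_section_integrable by auto
  show "AE \<omega> in M. (\<lambda>n. \<Sum>k<n. (X k s \<omega>)\<^sup>2) \<longlonglongrightarrow> energy s \<omega>"
    by (intro AE_I2 X_sum_tendsto)
  show "AE \<omega> in M. norm (\<Sum>k<n. (X k s \<omega>)\<^sup>2) \<le> energy s \<omega>" for n
    by (intro AE_I2) (simp add: X_sum_le sum_nonneg)
qed measurable

lemma v_sum_integral_tendsto:
  assumes "0 \<le> s"
  shows "(\<lambda>n. LINT r:{s<..t}|lborel. (\<Sum>k<n. v k r)) \<longlonglongrightarrow> (LINT r:{s<..t}|lborel. w r)"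
  unfolding set_lebesgue_integral_def
proof (rule integral_dominated_convergence)
  have wi: "set_integrable lborel {s<..t} w"
    by (rule set_integrable_subset[OF w_integrable[of t]]) (use assms in auto)
  have vi: "set_integrable lborel {s<..t} (v k)" for k
    by (rule set_integrable_subset[OF v_integrable[of t]]) (use assms in auto)
  show "integrable lborel (\<lambda>r. indicator {s<..t} r *\<^sub>R w r)" using wi by (simp add:
      set_integrable_def)
  then show "(\<lambda>r. indicator {s<..t} r *\<^sub>R w r) \<in> borel_measurable lborel" by auto
  have "integrable lborel (\<lambda>r. \<Sum>k<n. indicator {s<..t} r *\<^sub>R v k r)" for n
    using vi by (intro Bochner_Integration.integrable_sum) (simp add: set_integrable_def)
  then show "(\<lambda>r. indicator {s<..t} r *\<^sub>R (\<Sum>k<n. v k r)) \<in> borel_measurable lborel" for n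
    by (simp add: sum_distrib_left borel_measurable_integrable)
  show "AE r in lborel. (\<lambda>n. indicator {s<..t} r *\<^sub>R (\<Sum>k<n. v k r)) \<longlonglongrightarrow> indicator {s<..t} r *\<^sub>R w r"
    by (intro AE_I2 tendsto_scaleR tendsto_const v_sum_tendsto)
  show "AE r in lborel. norm (indicator {s<..t} r *\<^sub>R (\<Sum>k<n. v k r)) \<le> indicator {s<..t} r *\<^sub>R w
      r" for n
    by (intro AE_I2) (auto simp: indicator_def v_sum_le sum_nonneg v_nonneg)
qed

section \<open>Covariance of the stochastic term\<close>

definition coef :: "nat \<Rightarrow> nat \<times> nat \<Rightarrow> real" where
  "coef k p = triple_coeff D e (snd p) k (fst p)"

definition alpha :: "nat \<times> nat \<Rightarrow> nat \<times> nat \<Rightarrow> real" where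
  "alpha p p' = kernel_form D q (e (snd p)) (e (snd p'))"

text \<open>The second moment at time t of the stochastic term of equation k, truncated to N modes
  and without the factor \<beta>1. A pair p = (i, j) stands for the integral of u_i against B_j, so
  \<open>alpha p p'\<close> involves only the second components and the time integral only the
  first.\<close>

definition R :: "nat \<Rightarrow> nat \<Rightarrow> real \<Rightarrow> real" where
  "R k N t = (\<Sum>p\<in>{..<N} \<times> {..<N}. \<Sum>p'\<in>{..<N} \<times> {..<N}. coef k p * coef k p' *
    (alpha p p' * (LINT (r, \<omega>)|P. indicator {0..t} r * (X (fst p) r \<omega> * X (fst p') r \<omega>))))"

text \<open>Square integrability, mean zero and covariances pass from the finite sums to their mean
  square limit. By the isometry the truncated covariance at times t and s depends on
  \<open>min t s\<close> alone; the limit inherits this, which is orthogonality of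
  increments.\<close>

lemma stochastic_term:
  obtains S where
    "\<And>k t. 0 \<le> t \<Longrightarrow> square_integrable M (S k t)"
    "\<And>k t. 0 \<le> t \<Longrightarrow> expectation (S k t) = 0"
    "\<And>k s t. 0 \<le> s \<Longrightarrow> 0 \<le> t \<Longrightarrow> (\<lambda>N. R k N (min t s)) \<longlonglongrightarrow> expectation (\<lambda>\<omega>. S k t \<omega> * S k s \<omega>)"
    "\<And>k t. 0 \<le> t \<Longrightarrow> AE \<omega> in M. X k t \<omega> = L2_inner D u0 (e k)
       - (lam k + \<beta>0) * (LINT s:{0..t}|lborel. X k s \<omega>) + \<beta>1 * S k t \<omega>"
proof -
  from sol obtain J S where
    J: "\<And>i j t. 0 \<le> t \<Longrightarrow> is_ito_integral M F (\<lambda>s. W s (e j)) (\<lambda>s \<omega>. L2_inner D (u s \<omega>) (e i)) t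
        (J i j t)"
    and S: "\<And>k t. 0 \<le> t \<Longrightarrow> mean_square_limit M
           (\<lambda>N \<omega>. \<Sum>i<N. \<Sum>j<N. triple_coeff D e j k i * J i j t \<omega>) (S k t)"
    and eq: "\<And>k t. 0 \<le> t \<Longrightarrow> AE \<omega> in M.
           L2_inner D (u t \<omega>) (e k) = L2_inner D u0 (e k)
             - (lam k + \<beta>0) * (LINT s:{0..t}|lborel. L2_inner D (u s \<omega>) (e k))
             + \<beta>1 * S k t \<omega>"
    unfolding stochastic_heat_solution_def by blast
  define Y where "Y = (\<lambda>k N t \<omega>. \<Sum>p\<in>{..<N} \<times> {..<N}. coef k p * J (fst p) (snd p) t \<omega>)"
  have Y_eq: "(\<lambda>\<omega>. \<Sum>i<N. \<Sum>j<N. triple_coeff D e j k i * J i j t \<omega>) = Y k N t" for k N t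
    by (simp add: Y_def coef_def sum.cartesian_product case_prod_unfold)
  have J_sq: "square_integrable M (J i j t)" "expectation (J i j t) = 0" if "0 \<le> t" for i j t
    using ito_integral_square[OF J[OF that] that e_L2] by auto
  have Y_sq: "square_integrable M (Y k N t)" if "0 \<le> t" for k N t
    unfolding Y_def by (intro square_integrable_sum square_integrable_cmult J_sq that)
  have Y_mean: "expectation (Y k N t) = 0" if "0 \<le> t" for k N t
  proof -
    have "integrable M (J i j t)" for i j
      by (intro square_integrable_integrable[OF finite_measure_axioms] J_sq that)
    then show ?thesis
      unfolding Y_def by (subst Bochner_Integration.integral_sum) (auto simp: J_sq that)
  qed
  have S_meas: "S k t \<in> borel_measurable M"
    and S_lim: "(\<lambda>N. \<integral>\<^sup>+\<omega>. ennreal ((Y k N t \<omega> - S k t \<omega>)\<^sup>2) \<partial>M) \<longlonglongrightarrow> 0" if "0 \<le> t" for k t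
    using S[OF that, of k] unfolding Y_eq mean_square_limit_def by auto
  have cov: "expectation (\<lambda>\<omega>. Y k N t \<omega> * Y k N s \<omega>) = R k N (min t s)" if s: "0 \<le> s" and t: "0
      \<le> t" for k N s t
  proof -
    have "expectation (\<lambda>\<omega>. J i j t \<omega> * J i' j' s \<omega>) = alpha (i, j) (i', j') *
        (LINT (r, \<omega>)|P. indicator {0..min t s} r * (X i r \<omega> * X i' r \<omega>))" for i j i' j'
    proof -
      have *: "indicator {0..min t s} r * (X i r \<omega> * X i' r \<omega>) =
          indicator {0..min t s} r * (L2_inner D (u r \<omega>) (e i) * L2_inner D (u r \<omega>) (e i'))" for r \<omega>
        by (auto simp: X_def indicator_def)
      show ?thesis
        unfolding * using ito_isometry[OF J[OF t] J[OF s] t s e_L2 e_L2] by (simp add: alpha_def)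
    qed
    then show ?thesis
      unfolding Y_def R_def by (subst expectation_sum_mult) (auto intro!: J_sq s t)
  qed
  show ?thesis
  proof (rule that)
    fix k and t :: real assume t: "0 \<le> t"
    show "square_integrable M (S k t)"
      by (rule square_integrable_L2_limit(1)[OF Y_sq[OF t] S_meas[OF t] S_lim[OF t]])
    have "(\<lambda>N. expectation (\<lambda>\<omega>. Y k N t \<omega> * 1)) \<longlonglongrightarrow> expectation (\<lambda>\<omega>. S k t \<omega> * 1)"
      by (rule tendsto_integral_mult_L2_nn[OF Y_sq[OF t] S_meas[OF t] square_integrable_const[OF
          finite_measure_axioms] _ S_lim[OF t]]) auto
    then show "expectation (S k t) = 0"
      by (simp add: Y_mean[OF t] LIMSEQ_const_iff)
    show "AE \<omega> in M. X k t \<omega> = L2_inner D u0 (e k)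
       - (lam k + \<beta>0) * (LINT s:{0..t}|lborel. X k s \<omega>) + \<beta>1 * S k t \<omega>"
    proof -
      have "(LINT s:{0..t}|lborel. X k s \<omega>) = (LINT s:{0..t}|lborel. L2_inner D (u s \<omega>) (e k))"
          for \<omega>
        by (rule set_lebesgue_integral_cong) (auto simp: X_def)
      then show ?thesis
        using eq[OF t, of k] t by (simp add: X_eq)
    qed
  next
    fix k and s t :: real assume st: "0 \<le> s" "0 \<le> t"
    have "(\<lambda>N. expectation (\<lambda>\<omega>. Y k N t \<omega> * Y k N s \<omega>)) \<longlonglongrightarrow> expectation (\<lambda>\<omega>. S k t \<omega> * S k s \<omega>)"
      using st by (intro tendsto_integral_mult_L2_nn Y_sq S_meas S_lim)
    then show "(\<lambda>N. R k N (min t s)) \<longlonglongrightarrow> expectation (\<lambda>\<omega>. S k t \<omega> * S k s \<omega>)"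
      using st by (simp add: cov)
  qed
qed

text \<open>The second moment identity is applied to N = c + \<beta>1 S; the mean zero of S removes
  the cross terms. \<open>G\<close> is characterised as the limit of \<open>R\<close>, so its
  increments can be estimated without returning to the chosen version of S.\<close>

lemma mode_equation:
  obtains G where "\<And>k t. 0 \<le> t \<Longrightarrow> (\<lambda>N. R k N t) \<longlonglongrightarrow> G k t"
    and "\<And>k t. 0 \<le> t \<Longrightarrow> v k t = (L2_inner D u0 (e k))\<^sup>2 + \<beta>1\<^sup>2 * G k t
      - 2 * (lam k + \<beta>0) * (LINT s:{0..t}|lborel. v k s)"
proof -
  obtain S where
    sq: "\<And>k t. 0 \<le> t \<Longrightarrow> square_integrable M (S k t)"
    and mean: "\<And>k t. 0 \<le> t \<Longrightarrow> expectation (S k t) = 0"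
    and cov: "\<And>k s t. 0 \<le> s \<Longrightarrow> 0 \<le> t \<Longrightarrow> (\<lambda>N. R k N (min t s)) \<longlonglongrightarrow> expectation (\<lambda>\<omega>. S k t \<omega> * S k s \<omega>)"
    and eq: "\<And>k t. 0 \<le> t \<Longrightarrow> AE \<omega> in M. X k t \<omega> = L2_inner D u0 (e k)
       - (lam k + \<beta>0) * (LINT s:{0..t}|lborel. X k s \<omega>) + \<beta>1 * S k t \<omega>"
    using stochastic_term by blast
  define G where "G = (\<lambda>k t. expectation (\<lambda>\<omega>. S k t \<omega> * S k t \<omega>))"
  define c where "c = (\<lambda>k. L2_inner D u0 (e k))"
  define N where "N = (\<lambda>k t \<omega>. c k + \<beta>1 * S k t \<omega>)"
  have G_lim: "(\<lambda>N. R k N t) \<longlonglongrightarrow> G k t" if "0 \<le> t" for k t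
    using cov[OF that that, of k] by (simp add: G_def)
  \<comment> \<open>At times s <= t the truncated covariance is \<open>R k N s\<close>, whose limit
    is already \<open>G k s\<close>.\<close>
  have S_cov: "expectation (\<lambda>\<omega>. S k s \<omega> * S k t \<omega>) = G k s" if "0 \<le> s" "s \<le> t" for k s t
  proof (rule LIMSEQ_unique[OF _ G_lim[OF that(1)]])
    show "(\<lambda>N. R k N s) \<longlonglongrightarrow> expectation (\<lambda>\<omega>. S k s \<omega> * S k t \<omega>)"
      using cov[of t s k] that by (simp add: min_absorb1)
  qed
  have lvp: "linear_volterra_process M (X k) (N k) (\<lambda>t. (c k)\<^sup>2 + \<beta>1\<^sup>2 * G k t) (lam k + \<beta>0)" for k
  proof
    show "(\<lambda>(s, \<omega>). X k s \<omega>) \<in> borel_measurable P" by (rule X_measurable)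
    show "integrable P (\<lambda>(s, \<omega>). indicator {0..T} s * (X k s \<omega>)\<^sup>2)" for T by (rule X_integrable)
    show "square_integrable M (X k t)" for t by (rule X_square)
    show "square_integrable M (N k t)" if "0 \<le> t" for t
      unfolding N_def using that
      by (intro square_integrable_add square_integrable_const square_integrable_cmult sq
          finite_measure_axioms)
    show "AE \<omega> in M. X k t \<omega> = N k t \<omega> - (lam k + \<beta>0) * (LINT s:{0..t}|lborel. X k s \<omega>)" if "0 \<le>
        t" for t
      using eq[OF that, of k] by eventually_elim (simp add: N_def c_def)
    show "expectation (\<lambda>\<omega>. N k s \<omega> * N k t \<omega>) = (c k)\<^sup>2 + \<beta>1\<^sup>2 * G k s" if st: "0 \<le> s" "s \<le> t"
        for s t
    proof -
      have t: "0 \<le> t" using st by simp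
      have i: "integrable M (S k s)" "integrable M (S k t)" "integrable M (\<lambda>\<omega>. S k s \<omega> * S k t \<omega>)"
        using st(1) t by (simp_all add: square_integrable_integrable[OF finite_measure_axioms
            sq] square_integrable_mult sq)
      have "expectation (\<lambda>\<omega>. N k s \<omega> * N k t \<omega>) =
          expectation (\<lambda>\<omega>. (c k)\<^sup>2 + c k * \<beta>1 * S k s \<omega> + c k * \<beta>1 * S k t \<omega> + \<beta>1\<^sup>2 * (S k s \<omega> *
              S k t \<omega>))"
        by (rule Bochner_Integration.integral_cong) (auto simp: N_def algebra_simps
            power2_eq_square)
      also have "\<dots> = (c k)\<^sup>2 + \<beta>1\<^sup>2 * G k s"
        using i st t by (simp add: mean S_cov prob_space)
      finally show ?thesis .
    qed
    show "0 < lam k + \<beta>0"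
      using gap monoD[OF lam_mono, of 0 k] by simp
  qed
  show ?thesis
  proof (rule that[OF G_lim])
    fix k and t :: real assume "0 \<le> t"
    from linear_volterra_process.second_moment[OF lvp this, of k]
    show "v k t = (L2_inner D u0 (e k))\<^sup>2 + \<beta>1\<^sup>2 * G k t - 2 * (lam k + \<beta>0) * (LINT
        s:{0..t}|lborel. v k s)"
      by (simp add: v_def c_def)
  qed
qed

section \<open>Summation over the modes and decay\<close>

lemma set_integral_diff_interval:
  fixes f :: "real \<Rightarrow> real"
  assumes "set_integrable lborel {0..t} f" "0 \<le> s" "s \<le> t"
  shows "(LINT r:{0..t}|lborel. f r) - (LINT r:{0..s}|lborel. f r) = (LINT r:{s<..t}|lborel. f r)"
proof -
  have "{0..t} = {0..s} \<union> {s<..t}" using assms by auto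
  moreover have "(LINT r:{0..s} \<union> {s<..t}|lborel. f r) = (LINT r:{0..s}|lborel. f r) + (LINT
      r:{s<..t}|lborel. f r)"
    by (rule set_integral_Un; (rule set_integrable_subset[OF assms(1)])?) (use assms in auto)
  ultimately show ?thesis by simp
qed

text \<open>The noise estimate is a hypothesis with a constant K, so that vanishing noise and a
  bounded kernel are treated alike. Finite sums over modes are estimated before n tends to infinity,
  since only the sum of the noise inputs is compared with w.\<close>

lemma stability:
  assumes \<delta>: "0 < 2 * (lam 0 + \<beta>0) - K"
    and noise_bound: "\<And>G n s t. (\<And>k t. 0 \<le> t \<Longrightarrow> (\<lambda>N. R k N t) \<longlonglongrightarrow> G k t) \<Longrightarrow> 0 \<le> s \<Longrightarrow> s \<le> t \<Longrightarrow>
      \<beta>1\<^sup>2 * (\<Sum>k<n. G k t - G k s) \<le> K * (LINT r:{s<..t}|lborel. w r)"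
  shows "(w \<longlongrightarrow> 0) at_top"
proof -
  obtain G where G: "\<And>k t. 0 \<le> t \<Longrightarrow> (\<lambda>N. R k N t) \<longlonglongrightarrow> G k t"
    and v: "\<And>k t. 0 \<le> t \<Longrightarrow> v k t = (L2_inner D u0 (e k))\<^sup>2 + \<beta>1\<^sup>2 * G k t
      - 2 * (lam k + \<beta>0) * (LINT s:{0..t}|lborel. v k s)"
    using mode_equation by blast
  show ?thesis
  proof (rule decay_of_integral_inequality[OF w_nonneg w_integrable _ \<delta>])
    fix s t :: real assume st: "0 \<le> s" "s \<le> t"
    have vi: "set_integrable lborel {s<..t} (v k)" for k
      by (rule set_integrable_subset[OF v_integrable[of t]]) (use st in auto)
    have step: "(\<Sum>k<n. v k t) - (\<Sum>k<n. v k s) \<le>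
        K * (LINT r:{s<..t}|lborel. w r) - 2 * (lam 0 + \<beta>0) * (LINT r:{s<..t}|lborel. (\<Sum>k<n. v k
            r))" for n
    proof -
      have "v k t - v k s \<le> \<beta>1\<^sup>2 * (G k t - G k s) - 2 * (lam 0 + \<beta>0) * (LINT r:{s<..t}|lborel.
          v k r)" for k
      proof -
        have "v k t - v k s = \<beta>1\<^sup>2 * (G k t - G k s) - 2 * (lam k + \<beta>0) *
            ((LINT r:{0..t}|lborel. v k r) - (LINT r:{0..s}|lborel. v k r))"
          using v[of t k] v[of s k] st by (simp add: algebra_simps)
        also have "(LINT r:{0..t}|lborel. v k r) - (LINT r:{0..s}|lborel. v k r) = (LINT
            r:{s<..t}|lborel. v k r)"
          by (rule set_integral_diff_interval[OF v_integrable st])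
        finally have "v k t - v k s = \<beta>1\<^sup>2 * (G k t - G k s) - 2 * (lam k + \<beta>0) * (LINT
            r:{s<..t}|lborel. v k r)" .
        \<comment> \<open>Replacing the rate of mode k by the lowest one weakens the dissipation,
          because second moments are nonnegative.\<close>
        moreover have "2 * (lam 0 + \<beta>0) * (LINT r:{s<..t}|lborel. v k r) \<le> 2 * (lam k + \<beta>0) *
            (LINT r:{s<..t}|lborel. v k r)"
        proof (rule mult_right_mono)
          show "0 \<le> (LINT r:{s<..t}|lborel. v k r)"
            unfolding set_lebesgue_integral_def
            by (rule Bochner_Integration.integral_nonneg) (simp add: v_nonneg)
        qed (use monoD[OF lam_mono, of 0 k] in simp)
        ultimately show ?thesis by linarith
      qed
      then have "(\<Sum>k<n. v k t - v k s) \<le>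
          (\<Sum>k<n. \<beta>1\<^sup>2 * (G k t - G k s) - 2 * (lam 0 + \<beta>0) * (LINT r:{s<..t}|lborel. v k r))"
        by (rule sum_mono)
      also have "\<dots> = \<beta>1\<^sup>2 * (\<Sum>k<n. G k t - G k s) - 2 * (lam 0 + \<beta>0) * (\<Sum>k<n. (LINT
          r:{s<..t}|lborel. v k r))"
        unfolding sum_distrib_left by (rule sum_subtractf)
      also have "(\<Sum>k<n. (LINT r:{s<..t}|lborel. v k r)) = (LINT r:{s<..t}|lborel. (\<Sum>k<n. v k r))"
        unfolding set_lebesgue_integral_def scaleR_sum_right
        by (intro Bochner_Integration.integral_sum[symmetric] vi[unfolded set_integrable_def])
      finally show ?thesis
        using noise_bound[OF G st, of n] by (simp add: sum_subtractf)
    qed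
    have "w t - w s \<le> K * (LINT r:{s<..t}|lborel. w r) - 2 * (lam 0 + \<beta>0) * (LINT
        r:{s<..t}|lborel. w r)"
    proof (rule LIMSEQ_le)
      show "(\<lambda>n. (\<Sum>k<n. v k t) - (\<Sum>k<n. v k s)) \<longlonglongrightarrow> w t - w s"
        by (intro tendsto_diff v_sum_tendsto)
      show "(\<lambda>n. K * (LINT r:{s<..t}|lborel. w r) - 2 * (lam 0 + \<beta>0) * (LINT r:{s<..t}|lborel.
          (\<Sum>k<n. v k r))) \<longlonglongrightarrow>
          K * (LINT r:{s<..t}|lborel. w r) - 2 * (lam 0 + \<beta>0) * (LINT r:{s<..t}|lborel. w r)"
        by (intro tendsto_diff tendsto_mult tendsto_const v_sum_integral_tendsto st)
      show "\<exists>N. \<forall>n\<ge>N. (\<Sum>k<n. v k t) - (\<Sum>k<n. v k s) \<le>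
          K * (LINT r:{s<..t}|lborel. w r) - 2 * (lam 0 + \<beta>0) * (LINT r:{s<..t}|lborel. (\<Sum>k<n. v
              k r))"
        by (intro exI[of _ 0] allI impI step)
    qed
    then show "w t - w s \<le> - (2 * (lam 0 + \<beta>0) - K) * (LINT r:{s<..t}|lborel. w r)"
      by (simp add: algebra_simps)
  qed
qed

end

section \<open>Noise estimate for a bounded kernel\<close>

locale bounded_heat_solution = heat_solution M F D q W e lam \<beta>0 \<beta>1 u0 u + bounded_white_noise M
    F D q W e \<kappa>
  for M :: "'w measure" and F :: "real \<Rightarrow> 'w measure" and D :: "'a::euclidean_space set"
    and q :: "'a \<Rightarrow> 'a \<Rightarrow> real" and W :: "real \<Rightarrow> ('a \<Rightarrow> real) \<Rightarrow> 'w \<Rightarrow> real"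
    and e :: "nat \<Rightarrow> 'a \<Rightarrow> real" and lam \<beta>0 \<beta>1 u0 u \<kappa>
begin

text \<open>Turns the fourfold sum in the integrand of \<open>R\<close> into a single value of the
  kernel form, to which the analytic bounds apply.\<close>

lemma Q_multiplier_coef:
  assumes "0 \<le> r"
  shows "Q (multiplier k N (u r \<omega>)) (multiplier k N (u r \<omega>)) =
    (\<Sum>p\<in>{..<N} \<times> {..<N}. \<Sum>p'\<in>{..<N} \<times> {..<N}. coef k p * coef k p' * (alpha p p' * (X (fst p) r
        \<omega> * X (fst p') r \<omega>)))"
proof -
  have "multiplier k N (u r \<omega>) = (\<lambda>x. \<Sum>p\<in>{..<N} \<times> {..<N}. (coef k p * X (fst p) r \<omega>) * e (snd p) x)"
  proof
    fix x
    have "multiplier k N (u r \<omega>) x = (\<Sum>j<N. \<Sum>i<N. (coef k (i, j) * X i r \<omega>) * e j x)"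
      by (simp add: multiplier_eq coef_def X_eq[OF assms] sum_distrib_right)
    also have "\<dots> = (\<Sum>i<N. \<Sum>j<N. (coef k (i, j) * X i r \<omega>) * e j x)"
      by (rule sum.swap)
    finally show "multiplier k N (u r \<omega>) x = (\<Sum>p\<in>{..<N} \<times> {..<N}. (coef k p * X (fst p) r \<omega>) * e
        (snd p) x)"
      by (simp add: sum.cartesian_product case_prod_unfold)
  qed
  then show ?thesis
    using Q_sum[of "{..<N} \<times> {..<N}" "\<lambda>p. e (snd p)" "\<lambda>p. coef k p * X (fst p) r \<omega>"]
        L2_integrable[OF e_L2]
    by (simp add: alpha_def ac_simps)
qed

definition qm :: "nat \<Rightarrow> nat \<Rightarrow> real \<times> 'w \<Rightarrow> real" where
  "qm k N z = indicator {0..} (fst z) * Q (multiplier k N (u (fst z) (snd z))) (multiplier k N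
      (u (fst z) (snd z)))"

text \<open>The rate of noise input into mode k at a given time and outcome, as the limit of the
  truncated rates \<open>qm k N\<close>.\<close>

definition qlim :: "nat \<Rightarrow> real \<times> 'w \<Rightarrow> real" where
  "qlim k z = indicator {0..} (fst z) * Q (\<lambda>x. e k x * u (fst z) (snd z) x) (\<lambda>x. e k x * u (fst
      z) (snd z) x)"

lemma qm_eq: "qm k N z = (\<Sum>p\<in>{..<N} \<times> {..<N}. \<Sum>p'\<in>{..<N} \<times> {..<N}.
    coef k p * coef k p' * (alpha p p' * (X (fst p) (fst z) (snd z) * X (fst p') (fst z) (snd z))))"
  by (cases "0 \<le> fst z") (simp_all add: qm_def Q_multiplier_coef X_def)

lemma qm_measurable [measurable]: "qm k N \<in> borel_measurable P"
  unfolding qm_eq[abs_def] using X_measurable unfolding case_prod_unfold by measurable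

lemma qm_tendsto: "z \<in> space P \<Longrightarrow> (\<lambda>N. qm k N z) \<longlonglongrightarrow> qlim k z"
  using Q_multiplier_tendsto[OF u_L2[of "fst z" "snd z"], of k]
  by (cases "0 \<le> fst z") (auto simp: qm_def qlim_def space_pair_measure)

lemma qlim_measurable [measurable]: "qlim k \<in> borel_measurable P"
  by (rule borel_measurable_LIMSEQ_real[OF qm_tendsto qm_measurable])

lemma R_integral:
  "integrable P (\<lambda>z. indicator {0..t} (fst z) * qm k N z)"
  "R k N t = (LINT z|P. indicator {0..t} (fst z) * qm k N z)"
proof -
  let ?I = "{..<N} \<times> {..<N}"
  let ?f = "\<lambda>p p' z. coef k p * coef k p' * (alpha p p' * (indicator {0..t} (fst z) * (X (fst p)
      (fst z) (snd z) * X (fst p') (fst z) (snd z))))"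
  have "integrable P (\<lambda>z. indicator {0..t} (fst z) * (X i (fst z) (snd z) * X i' (fst z) (snd
      z)))" for i i'
  proof -
    have "integrable P (\<lambda>z. (\<lambda>(s, \<omega>). indicator {0..t} s * X i s \<omega>) z * (\<lambda>(s, \<omega>). indicator
        {0..t} s * X i' s \<omega>) z)"
      by (intro square_integrable_mult X_square_P)
    also have "(\<lambda>z. (\<lambda>(s, \<omega>). indicator {0..t} s * X i s \<omega>) z * (\<lambda>(s, \<omega>). indicator {0..t} s * X
        i' s \<omega>) z) =
        (\<lambda>z. indicator {0..t} (fst z) * (X i (fst z) (snd z) * X i' (fst z) (snd z)))"
      by (auto simp: indicator_def)
    finally show ?thesis .
  qed
  then have i: "integrable P (?f p p')" for p p'
    by (intro integrable_mult_right)
  have eq: "(\<lambda>z. indicator {0..t} (fst z) * qm k N z) = (\<lambda>z. \<Sum>p\<in>?I. \<Sum>p'\<in>?I. ?f p p' z)"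
    unfolding qm_eq sum_distrib_left by (intro ext sum.cong refl) (simp add: ac_simps)
  show "integrable P (\<lambda>z. indicator {0..t} (fst z) * qm k N z)"
    unfolding eq by (intro Bochner_Integration.integrable_sum i)
  have "(LINT z|P. (\<Sum>p\<in>?I. \<Sum>p'\<in>?I. ?f p p' z)) = (\<Sum>p\<in>?I. (LINT z|P. (\<Sum>p'\<in>?I. ?f p p' z)))"
    by (intro Bochner_Integration.integral_sum Bochner_Integration.integrable_sum i)
  also have "\<dots> = (\<Sum>p\<in>?I. \<Sum>p'\<in>?I. (LINT z|P. ?f p p' z))"
    by (intro sum.cong refl Bochner_Integration.integral_sum i)
  also have "\<dots> = R k N t"
    unfolding R_def by (simp add: case_prod_unfold)
  finally show "R k N t = (LINT z|P. indicator {0..t} (fst z) * qm k N z)"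
    unfolding eq ..
qed

text \<open>For fixed k, dominated convergence in N identifies the increment of \<open>G\<close>
  with the integral of \<open>qlim k\<close> over the time interval and all outcomes. The trace
  inequality then bounds the sum over k under the integral, pointwise, by \<kappa> times the
  energy.\<close>

lemma noise_bound:
  assumes G: "\<And>k t. 0 \<le> t \<Longrightarrow> (\<lambda>N. R k N t) \<longlonglongrightarrow> G k t" and st: "0 \<le> s" "s \<le> t"
  shows "(\<Sum>k<n. G k t - G k s) \<le> \<kappa> * (LINT r:{s<..t}|lborel. w r)"
proof -
  have t: "0 \<le> t" using st by simp
  have E: "integrable P (\<lambda>z. indicator {s<..t} (fst z) * energy (fst z) (snd z))"
  proof (rule Bochner_Integration.integrable_bound[OF energy_integrable[of t]])
    show "(\<lambda>z. indicator {s<..t} (fst z) * energy (fst z) (snd z)) \<in> borel_measurable P"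
      using energy_measurable unfolding case_prod_unfold by measurable
  qed (use st in \<open>auto simp: indicator_def\<close>)
  have lim: "integrable P (\<lambda>z. indicator {s<..t} (fst z) * qlim k z)"
    "(LINT z|P. indicator {s<..t} (fst z) * qlim k z) = G k t - G k s" for k
  proof -
    \<comment> \<open>This c depends on k and on the kernel; it only provides a majorant and does
      not enter the final estimate.\<close>
    obtain c where c: "\<And>N f. f \<in> L2 D \<Longrightarrow> \<bar>Q (multiplier k N f) (multiplier k N f)\<bar> \<le> c * L2_inner
        D f f"
      using Q_multiplier_bound[of k] by blast
    have bd: "AE z in P. norm (indicator {s<..t} (fst z) * qm k N z) \<le> c * (indicator {s<..t}
        (fst z) * energy (fst z) (snd z))" for N
    proof (rule AE_I2)
      fix z assume z: "z \<in> space P"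
      show "norm (indicator {s<..t} (fst z) * qm k N z) \<le> c * (indicator {s<..t} (fst z) *
          energy (fst z) (snd z))"
      proof (cases "fst z \<in> {s<..t}")
        case True
        with z st c[OF u_L2[of "fst z" "snd z"], of N] show ?thesis
          by (auto simp: qm_def energy_eq space_pair_measure)
      qed simp
    qed
    have tends: "AE z in P. (\<lambda>N. indicator {s<..t} (fst z) * qm k N z) \<longlonglongrightarrow> indicator {s<..t} (fst
        z) * qlim k z"
      by (intro AE_I2 tendsto_mult tendsto_const qm_tendsto)
    have m: "(\<lambda>z. indicator {s<..t} (fst z) * qlim k z) \<in> borel_measurable P"
      "\<And>N. (\<lambda>z. indicator {s<..t} (fst z) * qm k N z) \<in> borel_measurable P"
      by measurable
    note dc = integrable_mult_right[OF E, of c]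
    show "integrable P (\<lambda>z. indicator {s<..t} (fst z) * qlim k z)"
      by (rule integrable_dominated_convergence[OF m dc tends bd])
    have "(\<lambda>N. LINT z|P. indicator {s<..t} (fst z) * qm k N z) \<longlonglongrightarrow> (LINT z|P. indicator {s<..t}
        (fst z) * qlim k z)"
      by (rule integral_dominated_convergence[OF m dc tends bd])
    moreover have "(LINT z|P. indicator {s<..t} (fst z) * qm k N z) = R k N t - R k N s" for N
    proof -
      have "(LINT z|P. indicator {s<..t} (fst z) * qm k N z) =
          (LINT z|P. indicator {0..t} (fst z) * qm k N z - indicator {0..s} (fst z) * qm k N z)"
        using st by (intro Bochner_Integration.integral_cong refl) (auto simp: indicator_def)
      also have "\<dots> = R k N t - R k N s"
        unfolding R_integral(2) by (intro Bochner_Integration.integral_diff R_integral(1))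
      finally show ?thesis .
    qed
    ultimately have "(\<lambda>N. R k N t - R k N s) \<longlonglongrightarrow> (LINT z|P. indicator {s<..t} (fst z) * qlim k z)"
      by simp
    then show "(LINT z|P. indicator {s<..t} (fst z) * qlim k z) = G k t - G k s"
      by (rule LIMSEQ_unique) (intro tendsto_diff G st t)
  qed
  have "(\<Sum>k<n. G k t - G k s) = (LINT z|P. (\<Sum>k<n. indicator {s<..t} (fst z) * qlim k z))"
    unfolding lim(2)[symmetric] by (intro Bochner_Integration.integral_sum[symmetric] lim(1))
  also have "\<dots> \<le> (LINT z|P. \<kappa> * (indicator {s<..t} (fst z) * energy (fst z) (snd z)))"
  proof (rule integral_mono)
    show "integrable P (\<lambda>z. \<Sum>k<n. indicator {s<..t} (fst z) * qlim k z)"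
      by (intro Bochner_Integration.integrable_sum lim(1))
    show "integrable P (\<lambda>z. \<kappa> * (indicator {s<..t} (fst z) * energy (fst z) (snd z)))"
      by (intro integrable_mult_right E)
    fix z assume z: "z \<in> space P"
    show "(\<Sum>k<n. indicator {s<..t} (fst z) * qlim k z) \<le> \<kappa> * (indicator {s<..t} (fst z) * energy
        (fst z) (snd z))"
    proof (cases "fst z \<in> {s<..t}")
      case True
      with z st trace_bound[OF u_L2[of "fst z" "snd z"], of n] show ?thesis
        by (auto simp: qlim_def energy_eq space_pair_measure)
    qed simp
  qed
  also have "\<dots> = \<kappa> * (LINT z|P. indicator {s<..t} (fst z) * energy (fst z) (snd z))"
    by simp
  also have "(LINT z|P. indicator {s<..t} (fst z) * energy (fst z) (snd z)) = (LINT
      r:{s<..t}|lborel. w r)"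
    using LM.integral_fst[of "\<lambda>r \<omega>. indicator {s<..t} r * energy r \<omega>"] E
    by (simp add: case_prod_unfold w_def set_lebesgue_integral_def)
  finally show ?thesis .
qed

end

text \<open>Since \<kappa> is an extended real, the proof distinguishes whether noise is present:
  for nonzero \<beta>1 the condition forces \<kappa> to be finite and the trace inequality applies,
  while for \<beta>1 = 0 the noise estimate is trivial.\<close>

theorem theorem2p1:
  fixes D :: "(real ^ 'd) set"
    and q :: "real ^ 'd \<Rightarrow> real ^ 'd \<Rightarrow> real"
    and lam :: "nat \<Rightarrow> real"
    and e :: "nat \<Rightarrow> real ^ 'd \<Rightarrow> real"
    and M :: "'w measure"
    and F :: "real \<Rightarrow> 'w measure"
    and W :: "real \<Rightarrow> (real ^ 'd \<Rightarrow> real) \<Rightarrow> 'w \<Rightarrow> real"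
    and \<beta>0 \<beta>1 :: real
    and \<kappa> :: ereal
    and u0 :: "real ^ 'd \<Rightarrow> real"
    and u :: "real \<Rightarrow> 'w \<Rightarrow> real ^ 'd \<Rightarrow> real"
  assumes domain: "smooth_bounded_domain D"
    and eigen: "dirichlet_eigensystem D lam e"
    and q_measurable: "(\<lambda>(x, y). q x y) \<in> borel_measurable (dom_measure D \<Otimes>\<^sub>M dom_measure D)"
    and q_positive: "\<And>x y. x \<in> D \<Longrightarrow> y \<in> D \<Longrightarrow> 0 \<le> q x y"
    and q_pos_def: "pos_def_kernel D q"
    and prob: "prob_space M"
    and noise: "white_in_time_noise M D q W"
    and filt: "noise_filtration M F D W"
    and init: "u0 \<in> L2 D"
    and sol: "stochastic_heat_solution M F D W lam e \<beta>0 \<beta>1 u0 u"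
    and kappa: "\<kappa> = (SUP \<xi>\<in>D. ereal \<bar>q \<xi> \<xi>\<bar>)"
    and cond: "ereal (2 * (lam 0 + \<beta>0)) - ereal (\<beta>1\<^sup>2) * \<kappa> > 0"
  shows "((\<lambda>t. sqrt (prob_space.expectation M (\<lambda>\<omega>. (L2_norm D (u t \<omega>))\<^sup>2))) \<longlongrightarrow> 0) at_top"
proof -
  let ?\<kappa> = "real_of_ereal \<kappa>"
  have D: "open D" "bounded D" "D \<noteq> {}"
    using domain by (auto simp: smooth_bounded_domain_def)
  have D_sets: "D \<in> sets lborel" using D(1) by simp
  have "emeasure lborel D < \<infinity>" using D(2) by (rule emeasure_bounded_finite)
  then have fin: "finite_measure (dom_measure D)"
    using D_sets by (intro finite_measureI) (simp add: space_restrict_space emeasure_restrict_space)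
  have e: "L2_orthonormal_basis D e" "mono lam" "\<And>k. continuous_on (closure D) (e k)"
    using eigen by (auto simp: dirichlet_eigensystem_def)
  have e_bounded: "\<exists>B. \<forall>x\<in>D. \<bar>e k x\<bar> \<le> B" for k
  proof -
    have "compact (e k ` closure D)"
      using D(2) by (intro compact_continuous_image e(3)) (simp add: compact_closure)
    then have "bounded (e k ` closure D)" by (rule compact_imp_bounded)
    then obtain B where "\<forall>y\<in>e k ` closure D. norm y \<le> B" by (auto simp: bounded_iff)
    then have "\<forall>x\<in>D. \<bar>e k x\<bar> \<le> B"
      using closure_subset[of D] by (simp add: subset_iff)
    then show ?thesis ..
  qed
  have \<kappa>_ge: "ereal \<bar>q \<xi> \<xi>\<bar> \<le> \<kappa>" if "\<xi> \<in> D" for \<xi>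
    unfolding kappa using that by (rule SUP_upper)
  obtain \<xi>0 where "\<xi>0 \<in> D" using D(3) by blast
  have "0 \<le> ereal \<bar>q \<xi>0 \<xi>0\<bar>" by simp
  also have "\<dots> \<le> \<kappa>" by (rule \<kappa>_ge) fact
  finally have \<kappa>0: "0 \<le> \<kappa>" .
  \<comment> \<open>For \<beta>1 = 0 the extended product with \<kappa> is 0 even if \<kappa> is
    infinite, and so is its real counterpart. For other \<beta>1 an infinite \<kappa> would make the
    left side of \<open>cond\<close> minus infinity.\<close>
  have \<delta>: "0 < 2 * (lam 0 + \<beta>0) - \<beta>1\<^sup>2 * ?\<kappa>" and \<kappa>_fin: "\<beta>1 \<noteq> 0 \<Longrightarrow> \<kappa> \<noteq> \<infinity>"
    using cond \<kappa>0 by (cases \<kappa>; cases "\<beta>1 = 0"; simp add: zero_less_power2)+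
  have \<kappa>r: "0 \<le> ?\<kappa>" using \<kappa>0 by (rule real_of_ereal_pos)
  have gap: "0 < lam 0 + \<beta>0"
    using order_le_less_trans[OF mult_nonneg_nonneg[OF zero_le_power2 \<kappa>r], of \<beta>1 "2 * (lam 0 +
        \<beta>0)"] \<delta>
    by simp
  interpret prob_space M by (rule prob)
  interpret heat_solution M F D q W e lam \<beta>0 \<beta>1 u0 u
    by (intro heat_solution.intro white_noise.intro white_noise_axioms.intro L2_basis.intro
        heat_solution_axioms.intro prob noise filt fin e(1) e_bounded sol e(2) gap)
  have "(w \<longlongrightarrow> 0) at_top"
  proof (rule stability[OF \<delta>])
    fix G n and s t :: real
    assume G: "\<And>k t. 0 \<le> t \<Longrightarrow> (\<lambda>N. R k N t) \<longlonglongrightarrow> G k t" and st: "0 \<le> s" "s \<le> t"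
    show "\<beta>1\<^sup>2 * (\<Sum>k<n. G k t - G k s) \<le> \<beta>1\<^sup>2 * ?\<kappa> * (LINT r:{s<..t}|lborel. w r)"
    proof (cases "\<beta>1 = 0")
      case False
      have \<kappa>_real: "ereal ?\<kappa> = \<kappa>"
        using \<kappa>_fin[OF False] \<kappa>0 by (cases \<kappa>) simp_all
      have diag: "\<bar>q x x\<bar> \<le> ?\<kappa>" if "x \<in> D" for x
      proof -
        have "ereal \<bar>q x x\<bar> \<le> ereal ?\<kappa>"
          unfolding \<kappa>_real by (rule \<kappa>_ge[OF that])
        then show ?thesis by simp
      qed
      have q_le: "\<bar>q x y\<bar> \<le> ?\<kappa>" if xy: "x \<in> D" "y \<in> D" for x y
      proof (cases "x = y")
        case True
        then show ?thesis using diag xy by simp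
      next
        case False
        \<comment> \<open>The weights 1 at x and -1 at y give 2 q(x,y) <= q(x,x) + q(y,y); since q
          is nonnegative, this bounds |q(x,y)| by \<kappa>.\<close>
        let ?c = "\<lambda>z. if z = x then 1 else - 1 :: real"
        have "\<forall>S c. finite S \<and> S \<subseteq> D \<longrightarrow> 0 \<le> (\<Sum>a\<in>S. \<Sum>b\<in>S. c a * c b * q a b)"
          using q_pos_def by (simp add: pos_def_kernel_def)
        from this[THEN spec, of "{x, y}", THEN spec, of ?c]
        have "0 \<le> (\<Sum>a\<in>{x, y}. \<Sum>b\<in>{x, y}. ?c a * ?c b * q a b)"
          using xy by simp
        then have "0 \<le> q x x + q y y - q x y - q y x"
          using False by simp
        moreover have "q y x = q x y"
          using q_pos_def xy by (simp add: pos_def_kernel_def)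
        ultimately show ?thesis
          using diag[OF xy(1)] diag[OF xy(2)] q_positive[OF xy] by simp
      qed
      interpret bounded_heat_solution M F D q W e lam \<beta>0 \<beta>1 u0 u ?\<kappa>
        by unfold_locales (rule q_measurable q_le \<kappa>r; assumption?)+
      show ?thesis
        using mult_left_mono[OF noise_bound[OF G st, of n], of "\<beta>1\<^sup>2"] by (simp add: mult.assoc)
    qed simp
  qed
  from tendsto_real_sqrt[OF this] have "((\<lambda>t. sqrt (w t)) \<longlongrightarrow> 0) at_top"
    by simp
  then show ?thesis
  \<comment> \<open>\<open>w\<close> is cut off at negative times, so the two functions agree only
    for t >= 0.\<close>
  proof (rule Lim_transform_eventually)
    show "\<forall>\<^sub>F t in at_top. sqrt (w t) = sqrt (expectation (\<lambda>\<omega>. (L2_norm D (u t \<omega>))\<^sup>2))"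
      using eventually_ge_at_top[of 0] by eventually_elim (simp add: w_def energy_def[abs_def])
  qed
qed

end
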